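(* The primitive complex reflection groups of rank two ($G_4,\ldots,G_{22}$ in the Shephard–Todd numbering) which have quaternionic systems of imprimitivity are $G_{12}$, $G_{13}$ (octahedral type) and $G_{22}$ (icosahedral type). When these three groups are given by the generators $$G_{12}=\langle F_1,F_2,F_3\rangle,\qquad G_{13}=\langle F_1,F_2,A_1\rangle,\qquad G_{22}=\langle A_1,A_2,A_3\rangle,$$ $$F_1=\tfrac{1}{\sqrt2}\begin{pmatrix}1&1\\1&-1\end{pmatrix},\quad F_2=\tfrac1{\sqrt2}\begin{pmatrix}1&i\\-i&-1\end{pmatrix},\quad F_3=\tfrac1{\sqrt2}\begin{pmatrix}0&1+i\\1-i&0\end{pmatrix},$$ $$A_1=\begin{pmatrix}1&0\\0&-1\end{pmatrix},\quad A_2=\begin{pmatrix}0&i\\-i&0\end{pmatrix},\quad A_3=\begin{pmatrix}\frac{\tau}{2}&-\frac12-\frac{\sigma}{2}i\\ -\frac12+\frac{\sigma}{2}i&-\frac{\tau}{2}\end{pmatrix},\qquad \tau=\tfrac{1+\sqrt5}{2},\ \sigma=1-\tau,$$ their quaternionic systems of imprimitivity are those given by $(1,zj)$, $z\in\mathbb{C}$, $|z|=1$, and a corresponding change of basis matrix conjugates them (in $\mathrm{GL}(\mathbb{H}^2)$) to the imprimitive quaternionic reflection groups $$G_{\mathcal T}(L_{12}^{\mathcal T},1),\qquad G_{\mathcal O}(L_{18}^{\mathcal O},1),\qquad G_{\mathcal I}(L_{30}^{\mathcal I},1),$$ respectively. The remaining $16$ groups $$G_4,G_5,G_6,G_7,\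 G_8,G_9,G_{10},G_{11},G_{14},G_{15},\ G_{16},G_{17},G_{18},G_{19},G_{20},G_{21}$$ have no quaternionic systems of imprimitivity.
   Context: $\mathbb{H}$ denotes the quaternions with standard units $i,j,k$, and $\mathbb{C}=\mathbb{R}+\mathbb{R}i\subset\mathbb{H}$. $\mathbb{H}^2$ is a right vector space (matrices act on the left) with inner product $\langle v,w\rangle=\sum_j\overline{v_j}w_j$. A quaternionic system of imprimitivity of a group $G\subset \mathrm{GL}(\mathbb{C}^2)\subset\mathrm{GL}(\mathbb{H}^2)$ is an unordered pair $\{V_1,V_2\}$ of one-dimensional $\mathbb{H}$-subspaces with $\mathbb{H}^2=V_1\oplus V_2$ which is permuted by every element of $G$. The system given by $(1,q)$ is the pair consisting of the span of $(1,q)$ and its orthogonal complement, the span of $(-\overline{q},1)$. A change of basis matrix corresponding to a system is an (invertible, which can be taken unitary) matrix $U$ whose two columns span the two subspaces of the system; it conjugates $g\mapsto U^{-1}gU$. For a set $\mathcal{L}$ of unit quaternions, let $\mathcal{G}(\mathcal{L},\{\})$ be the group generated by the reflections $\begin{pmatrix}0&\beta\\ \overline\beta&0\end{pmatrix}$, $\beta\in\mathcal{L}$. Then $G_{\mathcal T}(L_{12}^{\mathcal T},1)=\mathcal{G}(\{1,i,\frac{1+i+j+k}{2}\},\{\})$ (order $48$), $G_{\mathcal O}(L_{18}^{\mathcal O},1)=\mathcal{G}(\{1,\frac{1+i}{\sqrt2},\frac{1+i+j+k}{2}\},\{\})$ (order $96$), $G_{\mathcal I}(L_{30}^{\mathcal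 I},1)=\mathcal{G}(\{1,\frac{1+i+j+k}{2},\frac{\tau+\sigma i-j}{2}\},\{\})$ (order $240$). *)

theory Defs
  imports "HOL-Analysis.Analysis" "HOL-Algebra.Generated_Groups"
begin

section \<open>Quaternions\<close>

text \<open>\<open>Quat a b c d\<close> is the quaternion \<open>a + b i + c j + d k\<close>.\<close>

datatype quat = Quat (qre: real) (qim_i: real) (qim_j: real) (qim_k: real)

instantiation quat :: division_ring
begin

definition zero_quat :: quat where "0 = Quat 0 0 0 0"

definition one_quat :: quat where "1 = Quat 1 0 0 0"

definition plus_quat :: "quat \<Rightarrow> quat \<Rightarrow> quat" where
  "p + q = Quat (qre p + qre q) (qim_i p + qim_i q) (qim_j p + qim_j q) (qim_k p + qim_k q)"

definition uminus_quat :: "quat \<Rightarrow> quat" where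
  "- q = Quat (- qre q) (- qim_i q) (- qim_j q) (- qim_k q)"

definition minus_quat :: "quat \<Rightarrow> quat \<Rightarrow> quat" where
  "p - q = Quat (qre p - qre q) (qim_i p - qim_i q) (qim_j p - qim_j q) (qim_k p - qim_k q)"

definition times_quat :: "quat \<Rightarrow> quat \<Rightarrow> quat" where
  "p * q = Quat
     (qre p * qre q - qim_i p * qim_i q - qim_j p * qim_j q - qim_k p * qim_k q)
     (qre p * qim_i q + qim_i p * qre q + qim_j p * qim_k q - qim_k p * qim_j q)
     (qre p * qim_j q - qim_i p * qim_k q + qim_j p * qre q + qim_k p * qim_i q)
     (qre p * qim_k q + qim_i p * qim_j q - qim_j p * qim_i q + qim_k p * qre q)"

definition inverse_quat :: "quat \<Rightarrow> quat" where
  "inverse q = (let n = (qre q)\<^sup>2 + (qim_i q)\<^sup>2 + (qim_j q)\<^sup>2 + (qim_k q)\<^sup>2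
     in Quat (qre q / n) (- qim_i q / n) (- qim_j q / n) (- qim_k q / n))"

definition divide_quat :: "quat \<Rightarrow> quat \<Rightarrow> quat" where
  "p div (q::quat) = p * inverse q"

lemmas quat_defs = zero_quat_def one_quat_def plus_quat_def uminus_quat_def
  minus_quat_def times_quat_def inverse_quat_def divide_quat_def

instance
proof
  fix a b c :: quat
  show "a * b * c = a * (b * c)" by (simp add: quat_defs algebra_simps)
  show "a + b + c = a + (b + c)" by (simp add: quat_defs)
  show "a + b = b + a" by (simp add: quat_defs)
  show "0 + a = a" by (simp add: quat_defs)
  show "- a + a = 0" by (simp add: quat_defs)
  show "a - b = a + - b" by (simp add: quat_defs)
  show "1 * a = a" by (simp add: quat_defs)
  show "a * 1 = a" by (simp add: quat_defs)
  show "(a + b) * c = a * c + b * c" by (simp add: quat_defs algebra_simps)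
  show "a * (b + c) = a * b + a * c" by (simp add: quat_defs algebra_simps)
  show "(0::quat) \<noteq> 1" by (simp add: quat_defs)
  show "inverse (0::quat) = 0" by (simp add: quat_defs)
  show "a div b = a * inverse b" by (simp add: divide_quat_def)
next
  fix a :: quat
  assume "a \<noteq> 0"
  define n where "n = (qre a)\<^sup>2 + (qim_i a)\<^sup>2 + (qim_j a)\<^sup>2 + (qim_k a)\<^sup>2"
  have "n \<noteq> 0"
  proof
    assume "n = 0"
    then have "qre a = 0" "qim_i a = 0" "qim_j a = 0" "qim_k a = 0"
      unfolding n_def by (smt (verit) zero_le_power2 power_eq_0_iff)+
    with \<open>a \<noteq> 0\<close> show False by (cases a) (simp add: zero_quat_def)
  qed
  then have d: "qre a * qre a / n + qim_i a * qim_i a / n + qim_j a * qim_j a / n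
      + qim_k a * qim_k a / n = 1"
    by (simp add: n_def power2_eq_square flip: add_divide_distrib)
  show "inverse a * a = 1" "a * inverse a = 1"
    using d unfolding inverse_quat_def n_def[symmetric] Let_def times_quat_def one_quat_def
    by (simp_all add: algebra_simps)
qed

end

definition quat_j :: quat where "quat_j = Quat 0 0 1 0"

definition qcnj :: "quat \<Rightarrow> quat" where
  "qcnj q = Quat (qre q) (- qim_i q) (- qim_j q) (- qim_k q)"

definition quat_of_complex :: "complex \<Rightarrow> quat" where
  "quat_of_complex z = Quat (Re z) (Im z) 0 0"


section \<open>Matrix groups\<close>

definition mat2 :: "'a::zero \<Rightarrow> 'a \<Rightarrow> 'a \<Rightarrow> 'a \<Rightarrow> 'a^2^2" where
  "mat2 a b c d = vector [vector [a, b], vector [c, d]]"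

definition scale_mat :: "'a::times \<Rightarrow> 'a^'n^'m \<Rightarrow> 'a^'n^'m" where
  "scale_mat c A = (\<chi> r s. c * A $ r $ s)"

definition GL :: "('a::semiring_1^'n^'n) monoid" where
  "GL = \<lparr>carrier = {A. invertible A}, monoid.mult = (**), one = mat 1\<rparr>"

lemma group_GL: "group (GL :: ('a::semiring_1^'n^'n) monoid)"
proof (rule groupI)
  fix A :: "'a^'n^'n"
  assume "A \<in> carrier GL"
  then obtain B where "A ** B = mat 1" "B ** A = mat 1"
    by (auto simp: GL_def invertible_def)
  then show "\<exists>B\<in>carrier GL. B \<otimes>\<^bsub>GL\<^esub> A = \<one>\<^bsub>GL\<^esub>"
    by (auto simp: GL_def invertible_def)
qed (auto simp: GL_def invertible_mult matrix_mul_assoc invertible_def[of "mat 1"])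

definition conj_by :: "'a::semiring_1^'n^'n \<Rightarrow> ('a^'n^'n) set \<Rightarrow> ('a^'n^'n) set" where
  "conj_by U G = (\<lambda>g. matrix_inv U ** g ** U) ` G"

definition quat_mat :: "complex^'n^'m \<Rightarrow> quat^'n^'m" where
  "quat_mat A = (\<chi> r s. quat_of_complex (A $ r $ s))"


section \<open>Systems of imprimitivity in rank two\<close>

text \<open>Scalars act on the right; over a field this is the usual scalar multiplication, so that the
  notions below serve for complex as well as for quaternionic systems of imprimitivity.\<close>

definition right_span :: "'a::division_ring^2 \<Rightarrow> ('a^2) set" where
  "right_span v = range (\<lambda>q. \<chi> r. v $ r * q)"

definition is_line :: "('a::division_ring^2) set \<Rightarrow> bool" where
  "is_line V \<longleftrightarrow> (\<exists>v. v \<noteq> 0 \<and> V = right_span v)"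

definition system_of_imprimitivity ::
  "('a::division_ring^2^2) set \<Rightarrow> ('a^2) set set \<Rightarrow> bool" where
  "system_of_imprimitivity G S \<longleftrightarrow>
     (\<exists>V1 V2. S = {V1, V2} \<and> is_line V1 \<and> is_line V2 \<and>
        V1 \<inter> V2 = {0} \<and> {v + w |v w. v \<in> V1 \<and> w \<in> V2} = UNIV) \<and>
     (\<forall>g\<in>G. (\<lambda>V. (\<lambda>v. g *v v) ` V) ` S = S)"

definition quaternionic_system :: "(complex^2^2) set \<Rightarrow> (quat^2) set set \<Rightarrow> bool" where
  "quaternionic_system G S \<longleftrightarrow> system_of_imprimitivity (quat_mat ` G) S"

definition qinner :: "quat^2 \<Rightarrow> quat^2 \<Rightarrow> quat" where
  "qinner v w = (\<Sum>r\<in>UNIV. qcnj (v $ r) * w $ r)"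

definition orth_compl :: "(quat^2) set \<Rightarrow> (quat^2) set" where
  "orth_compl V = {w. \<forall>v\<in>V. qinner v w = 0}"

text \<open>The pair given by the vector \<open>(1, q)\<close>.\<close>

definition system_given_by :: "quat \<Rightarrow> (quat^2) set set" where
  "system_given_by q =
     {right_span (vector [1, q]), orth_compl (right_span (vector [1, q]))}"

definition change_of_basis :: "quat^2^2 \<Rightarrow> (quat^2) set set \<Rightarrow> bool" where
  "change_of_basis U S \<longleftrightarrow>
     invertible U \<and> S = {right_span (column 1 U), right_span (column 2 U)}"

definition quat_unitary :: "quat^2^2 \<Rightarrow> bool" where
  "quat_unitary U \<longleftrightarrow>
     U ** (\<chi> r s. qcnj (U $ s $ r)) = mat 1 \<and> (\<chi> r s. qcnj (U $ s $ r)) ** U = mat 1"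


section \<open>Primitive complex reflection groups of rank two\<close>

text \<open>Finite order is not required here, as it is automatic in a finite group.\<close>

definition complex_reflection :: "complex^2^2 \<Rightarrow> bool" where
  "complex_reflection g \<longleftrightarrow> invertible g \<and> vec.dim {v. g *v v = v} = 1"

definition irreducible_group :: "(complex^2^2) set \<Rightarrow> bool" where
  "irreducible_group G \<longleftrightarrow>
     (\<forall>V. vec.subspace V \<and> (\<forall>g\<in>G. \<forall>v\<in>V. g *v v \<in> V) \<longrightarrow> V = {0} \<or> V = UNIV)"

definition primitive_complex_reflection_group :: "(complex^2^2) set \<Rightarrow> bool" where
  "primitive_complex_reflection_group G \<longleftrightarrow>
     subgroup G GL \<and> finite G \<and> G = generate GL {g \<in> G. complex_reflection g} \<and>
     irreducible_group G \<and> (\<nexists>S. system_of_imprimitivity G S)"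


section \<open>The Shephard--Todd groups of rank two\<close>

definition gold_tau :: real where "gold_tau = (1 + sqrt 5) / 2"

definition gold_sigma :: real where "gold_sigma = 1 - gold_tau"

definition refl_F1 :: "complex^2^2" where
  "refl_F1 = scale_mat (1 / sqrt 2) (mat2 1 1 1 (-1))"

definition refl_F2 :: "complex^2^2" where
  "refl_F2 = scale_mat (1 / sqrt 2) (mat2 1 \<i> (- \<i>) (-1))"

definition refl_F3 :: "complex^2^2" where
  "refl_F3 = scale_mat (1 / sqrt 2) (mat2 0 (1 + \<i>) (1 - \<i>) 0)"

definition refl_A1 :: "complex^2^2" where
  "refl_A1 = mat2 1 0 0 (-1)"

definition refl_A2 :: "complex^2^2" where
  "refl_A2 = mat2 0 \<i> (- \<i>) 0"

definition refl_A3 :: "complex^2^2" where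
  "refl_A3 = mat2 (gold_tau / 2) (- 1 / 2 - gold_sigma / 2 * \<i>)
                  (- 1 / 2 + gold_sigma / 2 * \<i>) (- gold_tau / 2)"

text \<open>The group element of the binary polyhedral groups corresponding to a unit quaternion, and
  the reflections of order \<open>m\<close> obtained from those with real part \<open>cos (pi / m)\<close>: such an element
  has the eigenvalues \<open>cis (pi / m)\<close> and \<open>cis (- pi / m)\<close>, so that multiplication by
  \<open>cis (pi / m)\<close> turns them into \<open>cis (2 * pi / m)\<close> and \<open>1\<close>.\<close>

definition su2 :: "quat \<Rightarrow> complex^2^2" where
  "su2 q = mat2 (Complex (qre q) (qim_i q)) (Complex (qim_j q) (qim_k q))
                (Complex (- qim_j q) (qim_k q)) (Complex (qre q) (- qim_i q))"

definition refl_of_order :: "nat \<Rightarrow> quat \<Rightarrow> complex^2^2" where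
  "refl_of_order m q = scale_mat (cis (pi / real m)) (su2 q)"

definition refl_R1 :: "complex^2^2" where
  "refl_R1 = refl_of_order 3 (Quat (1/2) (1/2) (1/2) (1/2))"

definition refl_R2 :: "complex^2^2" where
  "refl_R2 = refl_of_order 3 (Quat (1/2) (1/2) (-1/2) (1/2))"

definition refl_R3 :: "complex^2^2" where
  "refl_R3 = refl_of_order 3 (Quat (1/2) (1/2) (-1/2) (-1/2))"

definition refl_R4 :: "complex^2^2" where
  "refl_R4 = refl_of_order 3 (Quat (1/2) 0 (- gold_sigma / 2) (gold_tau / 2))"

definition refl_P1 :: "complex^2^2" where
  "refl_P1 = refl_of_order 4 (Quat (1 / sqrt 2) (1 / sqrt 2) 0 0)"

definition refl_P2 :: "complex^2^2" where
  "refl_P2 = refl_of_order 4 (Quat (1 / sqrt 2) 0 (1 / sqrt 2) 0)"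

definition refl_Q1 :: "complex^2^2" where
  "refl_Q1 = refl_of_order 5 (Quat (gold_tau / 2) (- gold_sigma / 2) 0 (1/2))"

definition refl_Q2 :: "complex^2^2" where
  "refl_Q2 = refl_of_order 5 (Quat (gold_tau / 2) 0 (1/2) (- gold_sigma / 2))"

definition refl_B :: "complex^2^2" where
  "refl_B = mat2 (gold_tau / 2) (1 / 2 + gold_sigma / 2 * \<i>)
                 (1 / 2 - gold_sigma / 2 * \<i>) (- gold_tau / 2)"

text \<open>
  The group with Shephard--Todd number \<open>n\<close>, \<open>4 \<le> n \<le> 22\<close>, is determined up to conjugacy in
  \<open>GL(\<complex>\<^sup>2)\<close>. The generators below satisfy the relations of the presentations of Broue, Malle
  and Rouquier. In the following list \<open>(e\<^sub>1, e\<^sub>2, \<dots>)\<close> are the orders of the generators in the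
  order in which they are written (\<open>F\<close>, \<open>A\<close>, \<open>B\<close>: order 2, \<open>R\<close>: 3, \<open>P\<close>: 4, \<open>Q\<close>: 5), \<open>s, t, u\<close>
  the generators, and the last entry is the order of the group.
    \<^item> \<open>G\<^sub>4\<close>: (3,3), sts = tst, 24
    \<^item> \<open>G\<^sub>5\<close>: (3,3), stst = tsts, 72
    \<^item> \<open>G\<^sub>6\<close>: (2,3), ststst = tststs, 48
    \<^item> \<open>G\<^sub>7\<close>: (2,3,3), stu = tus = ust, 144
    \<^item> \<open>G\<^sub>8\<close>: (4,4), sts = tst, 96
    \<^item> \<open>G\<^sub>9\<close>: (2,4), ststst = tststs, 192
    \<^item> \<open>G\<^sub>1\<^sub>0\<close>: (3,4), stst = tsts, 288
    \<^item> \<open>G\<^sub>1\<^sub>1\<close>: (2,3,4), stu = tus = ust, 576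
    \<^item> \<open>G\<^sub>1\<^sub>2\<close>: (2,2,2), 48
    \<^item> \<open>G\<^sub>1\<^sub>3\<close>: (2,2,2), 96
    \<^item> \<open>G\<^sub>1\<^sub>4\<close>: (2,3), stststst = tstststs, 144
    \<^item> \<open>G\<^sub>1\<^sub>5\<close>: (2,3,2), stu = tus, ustut = stutu, 288
    \<^item> \<open>G\<^sub>1\<^sub>6\<close>: (5,5), sts = tst, 600
    \<^item> \<open>G\<^sub>1\<^sub>7\<close>: (2,5), ststst = tststs, 1200
    \<^item> \<open>G\<^sub>1\<^sub>8\<close>: (3,5), stst = tsts, 1800
    \<^item> \<open>G\<^sub>1\<^sub>9\<close>: (2,3,5), stu = tus = ust, 3600
    \<^item> \<open>G\<^sub>2\<^sub>0\<close>: (3,3), ststs = tstst, 360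
    \<^item> \<open>G\<^sub>2\<^sub>1\<close>: (2,3), ststststst = tststststs, 720
    \<^item> \<open>G\<^sub>2\<^sub>2\<close>: (2,2,2), 240
\<close>

definition shephard_todd_generators :: "nat \<Rightarrow> (complex^2^2) set" where
  "shephard_todd_generators n =
    (if n = 4 then {refl_R1, refl_R3}
     else if n = 5 then {refl_R1, refl_R2}
     else if n = 6 then {refl_A1, refl_R1}
     else if n = 7 then {refl_A1, refl_R1, refl_R2}
     else if n = 8 then {refl_P1, refl_P2}
     else if n = 9 then {refl_F1, refl_P1}
     else if n = 10 then {refl_R1, refl_P1}
     else if n = 11 then {refl_F1, refl_R2, refl_P1}
     else if n = 12 then {refl_F1, refl_F2, refl_F3}
     else if n = 13 then {refl_F1, refl_F2, refl_A1}
     else if n = 14 then {refl_F1, refl_R1}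
     else if n = 15 then {refl_A1, refl_R1, refl_F1}
     else if n = 16 then {refl_Q1, refl_Q2}
     else if n = 17 then {refl_A2, refl_Q2}
     else if n = 18 then {refl_R1, refl_Q1}
     else if n = 19 then {refl_B, refl_R1, refl_Q1}
     else if n = 20 then {refl_R1, refl_R4}
     else if n = 21 then {refl_B, refl_R1}
     else if n = 22 then {refl_A1, refl_A2, refl_A3}
     else {})"

definition shephard_todd_group :: "nat \<Rightarrow> (complex^2^2) set" where
  "shephard_todd_group n = generate GL (shephard_todd_generators n)"

definition has_shephard_todd_number :: "(complex^2^2) set \<Rightarrow> nat \<Rightarrow> bool" where
  "has_shephard_todd_number G n \<longleftrightarrow>
     n \<in> {4..22} \<and> (\<exists>P. invertible P \<and> G = conj_by P (shephard_todd_group n))"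


section \<open>Imprimitive quaternionic reflection groups\<close>

text \<open>The group \<open>\<G>(L, {})\<close>.\<close>

definition quat_refl_group :: "quat set \<Rightarrow> (quat^2^2) set" where
  "quat_refl_group L = generate GL ((\<lambda>\<beta>. mat2 0 \<beta> (qcnj \<beta>) 0) ` L)"

definition G_T_L12 :: "(quat^2^2) set" where
  "G_T_L12 = quat_refl_group
     {1, Quat 0 1 0 0, Quat (1/2) (1/2) (1/2) (1/2)}"

definition G_O_L18 :: "(quat^2^2) set" where
  "G_O_L18 = quat_refl_group
     {1, Quat (1 / sqrt 2) (1 / sqrt 2) 0 0, Quat (1/2) (1/2) (1/2) (1/2)}"

definition G_I_L30 :: "(quat^2^2) set" where
  "G_I_L30 = quat_refl_group
     {1, Quat (1/2) (1/2) (1/2) (1/2), Quat (gold_tau / 2) (gold_sigma / 2) (-1/2) 0}"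

end

theory Submission
  imports Defs
begin

text \<open>
  Write the elements of a group \<open>G\<close> as \<open>c q\<close> with a scalar \<open>c\<close> and a unit quaternion \<open>q\<close>, acting on
  \<open>\<complex>\<^sup>2\<close> as an element of the special unitary group. A system of imprimitivity has only two lines, so the
  square of every element of \<open>G\<close> stabilises both of them, and everything follows from determining the
  lines fixed by a few such elements.

  Over \<open>\<complex>\<close>: each of the nineteen groups contains, up to scalars, the quaternions
  \<open>h = (1 + i + j + k) / 2\<close> and \<open>h' = (1 + i - j + k) / 2\<close> of order six. As \<open>h\<^sup>4 = - h\<close>, both of them and
  their product \<open>i\<close> would stabilise the lines of a system; but \<open>i\<close> fixes only the coordinate axes and \<open>h\<close>
  fixes neither (\<open>tetrahedral_primitive\<close>, \<open>tetrahedral_irreducible\<close>). The groups are finite because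
  the scalars are roots of unity and the quaternions lie in the binary octahedral or the binary
  icosahedral group. Closure of the former is a parity argument on sums of four squares; the latter
  is handled as a product of the binary tetrahedral group with a cyclic group of order ten.

  Over the quaternions: a generator that is a reflection of order at least three has a square with
  distinct eigenvalues \<open>1\<close> and \<open>\<zeta>\<^sup>2\<close>, and the only quaternionic lines fixed by such a matrix are its two
  eigenlines. These are complex, so a quaternionic system would be a complex one, against
  primitivity (\<open>no_quaternionic_system\<close>). This disposes of all groups but those generated by
  reflections of order two, for which all scalars satisfy \<open>c\<^sup>4 = 1\<close>.

  For these three groups, a special unitary matrix fixes all lines spanned by \<open>(1, z j)\<close> with
  \<open>\<bar>z\<bar> = 1\<close>, and the scalar \<open>c\<close> maps the line of \<open>z\<close> to that of \<open>c\<^sup>2 z = \<plusminus>z\<close>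
  (\<open>scaled_su2_graph_line\<close>); so the pairs of lines of \<open>z\<close> and \<open>- z\<close> are systems. There are no others, since
  these are the only quaternionic lines fixed by both \<open>i\<close> and \<open>h\<close>
  (\<open>quaternionic_system_imp_graph_lines\<close>). In a basis adapted to such a system every reflection of order two
  becomes antidiagonal, and after rescaling the basis vectors it takes the form with entries \<open>\<beta>\<close>
  and \<open>qcnj \<beta>\<close>. It remains to see that the resulting \<open>\<beta>\<close> generate the same group as the given
  ones (\<open>change_of_basis_to_special_reflections\<close> and the three lemmas that use it).
\<close>


section \<open>Two-by-two matrices and quaternions\<close>

lemma mat2_nth [simp]:
  "mat2 a b c d $ 1 $ 1 = a" "mat2 a b c d $ 1 $ 2 = b"
  "mat2 a b c d $ 2 $ 1 = c" "mat2 a b c d $ 2 $ 2 = d"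
  by (simp_all add: mat2_def)

lemma mat2_eta: "A = mat2 (A $ 1 $ 1) (A $ 1 $ 2) (A $ 2 $ 1) (A $ 2 $ 2)"
  by (simp add: vec_eq_iff forall_2)

lemma mat2_eq_iff [simp]:
  "mat2 a b c d = mat2 a' b' c' d' \<longleftrightarrow> a = a' \<and> b = b' \<and> c = c' \<and> d = d'"
  by (metis mat2_nth)

lemma mat2_mult:
  fixes a :: "'a::semiring_1"
  shows "mat2 a b c d ** mat2 a' b' c' d' =
    mat2 (a * a' + b * c') (a * b' + b * d') (c * a' + d * c') (c * b' + d * d')"
  by (simp add: vec_eq_iff forall_2 matrix_matrix_mult_def sum_2)

lemma mat2_mult_vector:
  fixes a :: "'a::semiring_1"
  shows "mat2 a b c d *v vector [x, y] = vector [a * x + b * y, c * x + d * y]"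
  by (simp add: vec_eq_iff forall_2 matrix_vector_mult_def sum_2)

lemma mat_1_eq_mat2: "mat 1 = (mat2 1 0 0 1 :: 'a::semiring_1^2^2)"
  by (simp add: vec_eq_iff forall_2 mat_def)

lemma scale_mat_mat2: "scale_mat k (mat2 a b c d) = mat2 (k * a) (k * b) (k * c) (k * d)"
  by (simp add: vec_eq_iff forall_2 scale_mat_def)

lemma vector2_eq_iff [simp]:
  "(vector [x, y] :: 'a::zero^2) = vector [x', y'] \<longleftrightarrow> x = x' \<and> y = y'"
  by (simp add: vec_eq_iff forall_2)

lemma vector2_eta: "(v :: 'a::zero^2) = vector [v $ 1, v $ 2]"
  by (simp add: vec_eq_iff forall_2)

lemma zero_eq_vector2: "(0 :: 'a::zero^2) = vector [0, 0]"
  by (simp add: vec_eq_iff forall_2)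

lemma matrix_inv_eqI:
  fixes A :: "'a::semiring_1^'n^'n"
  assumes "A ** B = mat 1" "B ** A = mat 1"
  shows "matrix_inv A = B"
proof -
  have *: "A ** matrix_inv A = mat 1 \<and> matrix_inv A ** A = mat 1"
    unfolding matrix_inv_def by (rule someI[of _ B]) (use assms in simp)
  then show ?thesis
    by (metis assms(2) matrix_mul_assoc matrix_mul_lid matrix_mul_rid)
qed

lemma matrix_inv_mult:
  fixes A :: "'a::semiring_1^'n^'n"
  assumes "invertible A"
  shows "A ** matrix_inv A = mat 1" "matrix_inv A ** A = mat 1"
  using assms matrix_inv_eqI by (auto simp: invertible_def)

lemma invertible_matrix_inv:
  fixes A :: "'a::semiring_1^'n^'n"
  assumes "invertible A"
  shows "invertible (matrix_inv A)" "matrix_inv (matrix_inv A) = A"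
  using matrix_inv_mult[OF assms] by (auto simp: invertible_def intro: matrix_inv_eqI)

lemma conj_by_matrix_inv:
  fixes P :: "'a::semiring_1^'n^'n"
  assumes "invertible P"
  shows "conj_by (matrix_inv P) (conj_by P G) = G"
proof -
  have "P ** (matrix_inv P ** g ** P) ** matrix_inv P = g" for g
    by (metis matrix_inv_mult(1)[OF assms] matrix_mul_assoc matrix_mul_lid matrix_mul_rid)
  then show ?thesis
    by (simp add: conj_by_def image_image invertible_matrix_inv[OF assms])
qed

definition qnorm2 :: "quat \<Rightarrow> real" where
  "qnorm2 q = (qre q)\<^sup>2 + (qim_i q)\<^sup>2 + (qim_j q)\<^sup>2 + (qim_k q)\<^sup>2"

lemma quat_eq_iff:
  "p = q \<longleftrightarrow> qre p = qre q \<and> qim_i p = qim_i q \<and> qim_j p = qim_j q \<and> qim_k p = qim_k q"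
  by (cases p; cases q) simp

lemma quat_sel [simp]:
  "qre (p * q) = qre p * qre q - qim_i p * qim_i q - qim_j p * qim_j q - qim_k p * qim_k q"
  "qim_i (p * q) = qre p * qim_i q + qim_i p * qre q + qim_j p * qim_k q - qim_k p * qim_j q"
  "qim_j (p * q) = qre p * qim_j q - qim_i p * qim_k q + qim_j p * qre q + qim_k p * qim_i q"
  "qim_k (p * q) = qre p * qim_k q + qim_i p * qim_j q - qim_j p * qim_i q + qim_k p * qre q"
  "qre (p + q) = qre p + qre q" "qim_i (p + q) = qim_i p + qim_i q"
  "qim_j (p + q) = qim_j p + qim_j q" "qim_k (p + q) = qim_k p + qim_k q"
  "qre (- q) = - qre q" "qim_i (- q) = - qim_i q" "qim_j (- q) = - qim_j q" "qim_k (- q) = - qim_k q"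
  "qre (p - q) = qre p - qre q" "qim_i (p - q) = qim_i p - qim_i q"
  "qim_j (p - q) = qim_j p - qim_j q" "qim_k (p - q) = qim_k p - qim_k q"
  "qre 1 = 1" "qim_i 1 = 0" "qim_j 1 = 0" "qim_k 1 = 0"
  "qre 0 = 0" "qim_i 0 = 0" "qim_j 0 = 0" "qim_k 0 = 0"
  "qre (qcnj q) = qre q" "qim_i (qcnj q) = - qim_i q"
  "qim_j (qcnj q) = - qim_j q" "qim_k (qcnj q) = - qim_k q"
  "qre (quat_of_complex z) = Re z" "qim_i (quat_of_complex z) = Im z"
  "qim_j (quat_of_complex z) = 0" "qim_k (quat_of_complex z) = 0"
  "qre quat_j = 0" "qim_i quat_j = 0" "qim_j quat_j = 1" "qim_k quat_j = 0"
  by (simp_all add: quat_defs qcnj_def quat_of_complex_def quat_j_def)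

lemma qnorm2_mult: "qnorm2 (p * q) = qnorm2 p * qnorm2 q"
  by (simp add: qnorm2_def power2_eq_square algebra_simps)

lemma qcnj_mult: "qcnj (p * q) = qcnj q * qcnj p"
  by (simp add: quat_eq_iff)

lemma qcnj_qcnj [simp]: "qcnj (qcnj q) = q"
  by (simp add: quat_eq_iff)

lemma mult_qcnj:
  "q * qcnj q = Quat (qnorm2 q) 0 0 0" "qcnj q * q = Quat (qnorm2 q) 0 0 0"
  by (simp_all add: quat_eq_iff qnorm2_def power2_eq_square)

lemma quat_of_complex_hom:
  "quat_of_complex (w + z) = quat_of_complex w + quat_of_complex z"
  "quat_of_complex (w * z) = quat_of_complex w * quat_of_complex z"
  "quat_of_complex 0 = 0" "quat_of_complex 1 = 1"
  "quat_of_complex (- z) = - quat_of_complex z"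
  by (simp_all add: quat_eq_iff)

lemma quat_of_complex_eq_0_iff [simp]: "quat_of_complex z = 0 \<longleftrightarrow> z = 0"
  by (simp add: quat_eq_iff complex_eq_iff)

lemma quat_mat_mat2:
  "quat_mat (mat2 a b c d) =
    mat2 (quat_of_complex a) (quat_of_complex b) (quat_of_complex c) (quat_of_complex d)"
  by (simp add: vec_eq_iff forall_2 quat_mat_def)

lemma quat_mat_mult:
  fixes A B :: "complex^2^2"
  shows "quat_mat (A ** B) = quat_mat A ** quat_mat B"
  by (subst (1 2) mat2_eta[of A], subst (1 2) mat2_eta[of B])
     (simp add: mat2_mult quat_mat_mat2 quat_of_complex_hom)

lemma quat_mat_one: "quat_mat (mat 1 :: complex^2^2) = mat 1"
  by (simp add: mat_1_eq_mat2 quat_mat_mat2 quat_of_complex_hom)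

lemma quat_mat_inverse:
  fixes A :: "complex^2^2"
  assumes "invertible A"
  shows "invertible (quat_mat A)" "matrix_inv (quat_mat A) = quat_mat (matrix_inv A)"
proof -
  have *: "quat_mat A ** quat_mat (matrix_inv A) = mat 1"
       "quat_mat (matrix_inv A) ** quat_mat A = mat 1"
    using matrix_inv_mult[OF assms] by (simp_all flip: quat_mat_mult add: quat_mat_one)
  then show "invertible (quat_mat A)" "matrix_inv (quat_mat A) = quat_mat (matrix_inv A)"
    by (auto simp: invertible_def intro: matrix_inv_eqI)
qed

lemma quat_mat_conj_by:
  fixes P :: "complex^2^2"
  assumes "invertible P"
  shows "quat_mat ` conj_by P G = conj_by (quat_mat P) (quat_mat ` G)"
  by (simp add: conj_by_def image_image quat_mat_mult quat_mat_inverse[OF assms])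


section \<open>Unit quaternions up to scalars\<close>

text \<open>Every group element below is a scalar times a unit quaternion acting on
  \<open>\<complex>\<^sup>2\<close>. Keeping the two factors apart turns products of matrices
  into products of quaternions, and the scalar is exactly what decides whether a quaternionic
  line is moved.\<close>

abbreviation scaled_su2 :: "complex \<Rightarrow> quat \<Rightarrow> complex^2^2" where
  "scaled_su2 c q \<equiv> scale_mat c (su2 q)"

lemma scaled_su2_eq_mat2:
  "scaled_su2 c q = mat2 (c * Complex (qre q) (qim_i q)) (c * Complex (qim_j q) (qim_k q))
     (c * Complex (- qim_j q) (qim_k q)) (c * Complex (qre q) (- qim_i q))"
  by (simp add: su2_def scale_mat_mat2)

lemma scaled_su2_mult:
  "scaled_su2 c p ** scaled_su2 d q = scaled_su2 (c * d) (p * q)"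
  by (simp add: scaled_su2_eq_mat2 mat2_mult complex_eq_iff algebra_simps)

lemma scaled_su2_one: "scaled_su2 1 1 = mat 1"
  by (simp add: scaled_su2_eq_mat2 mat_1_eq_mat2 complex_eq_iff)

lemma scaled_su2_minus: "scaled_su2 (- c) q = scaled_su2 c (- q)"
  by (simp add: scaled_su2_eq_mat2 complex_eq_iff)

lemma scaled_su2_inverse:
  assumes "c \<noteq> 0" "qnorm2 q = 1"
  shows "invertible (scaled_su2 c q)"
    "matrix_inv (scaled_su2 c q) = scaled_su2 (inverse c) (qcnj q)"
proof -
  have one: "Quat 1 0 0 0 = 1"
    by (simp add: quat_eq_iff)
  have *: "scaled_su2 c q ** scaled_su2 (inverse c) (qcnj q) = mat 1"
       "scaled_su2 (inverse c) (qcnj q) ** scaled_su2 c q = mat 1"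
    using assms by (simp_all add: scaled_su2_mult mult_qcnj one scaled_su2_one)
  then show "invertible (scaled_su2 c q)"
    "matrix_inv (scaled_su2 c q) = scaled_su2 (inverse c) (qcnj q)"
    by (auto simp: invertible_def intro: matrix_inv_eqI)
qed

lemma Complex_scale [simp]: "complex_of_real r * Complex a b = Complex (r * a) (r * b)"
  by (simp add: complex_eq_iff)

text \<open>A reflection of order two has determinant \<open>-1\<close> and trace
  \<open>0\<close>; dividing it by \<open>\<i>\<close> gives an element of determinant
  \<open>1\<close> and trace \<open>0\<close>, which is a purely imaginary unit
  quaternion.\<close>

lemma order_two_generators_eq_scaled_su2:
  "refl_F1 = scaled_su2 \<i> (Quat 0 (- 1 / sqrt 2) 0 (- 1 / sqrt 2))"
  "refl_F2 = scaled_su2 \<i> (Quat 0 (- 1 / sqrt 2) (1 / sqrt 2) 0)"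
  "refl_F3 = scaled_su2 \<i> (Quat 0 0 (1 / sqrt 2) (- 1 / sqrt 2))"
  "refl_A1 = scaled_su2 \<i> (Quat 0 (- 1) 0 0)"
  "refl_A2 = scaled_su2 \<i> (Quat 0 0 1 0)"
  "refl_A3 = scaled_su2 \<i> (Quat 0 (- gold_tau / 2) (- gold_sigma / 2) (1 / 2))"
  "refl_B = scaled_su2 \<i> (Quat 0 (- gold_tau / 2) (gold_sigma / 2) (- 1 / 2))"
  by (simp_all add: refl_F1_def refl_F2_def refl_F3_def refl_A1_def refl_A2_def refl_A3_def
      refl_B_def scaled_su2_eq_mat2 scale_mat_mat2 complex_eq_iff real_div_sqrt Re_divide Im_divide power2_eq_square)

lemmas higher_order_generators_eq_scaled_su2 =
  refl_R1_def refl_R2_def refl_R3_def refl_R4_def refl_P1_def refl_P2_def refl_Q1_def refl_Q2_def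


section \<open>Lines and systems of imprimitivity\<close>

lemma zero_in_right_span: "0 \<in> right_span v"
  unfolding right_span_def by (rule image_eqI[of _ _ 0]) (simp_all add: vec_eq_iff)

lemma self_in_right_span: "v \<in> right_span v"
  unfolding right_span_def by (rule image_eqI[of _ _ 1]) (simp_all add: vec_eq_iff)

lemma right_span_vector2: "right_span (vector [x, y]) = range (\<lambda>q. vector [x * q, y * q])"
  unfolding right_span_def by (intro arg_cong[where f = range]) (auto simp: vec_eq_iff forall_2)

lemma right_span_rescale:
  assumes "q \<noteq> 0"
  shows "right_span (vector [x * q, y * q]) = right_span (vector [x, y])"
proof -
  have "vector [x * q, y * q] = (\<lambda>p. vector [x * p, y * p]) q" 
    "vector [x * p, y * p] = (\<lambda>p. vector [x * q * p, y * q * p]) (inverse q * p)" for p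
    using assms by (simp_all add: mult.assoc[of _ q] flip: mult.assoc[of q "inverse q" p])
  then show ?thesis
    unfolding right_span_vector2 by (auto simp: mult.assoc) 
qed

lemma right_span_graph_eq_iff:
  fixes x y q :: "'a::division_ring"
  shows "right_span (vector [x, y]) = right_span (vector [1, q]) \<longleftrightarrow> x \<noteq> 0 \<and> y = q * x"
proof
  assume eq: "right_span (vector [x, y]) = right_span (vector [1, q])"
  have "vector [x, y] \<in> right_span (vector [1, q])" "vector [1, q] \<in> right_span (vector [x, y])"
    using self_in_right_span[of "vector [x, y]"] self_in_right_span[of "vector [1, q]"]
    by (simp_all add: eq)
  then obtain p r where "vector [x, y] = (vector [1 * p, q * p] :: 'a^2)"
    "vector [1, q] = (vector [x * r, y * r] :: 'a^2)"
    unfolding right_span_vector2 by blast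
  then show "x \<noteq> 0 \<and> y = q * x"
    by auto
next
  assume "x \<noteq> 0 \<and> y = q * x"
  then show "right_span (vector [x, y]) = right_span (vector [1, q])"
    using right_span_rescale[of x 1 q] by simp
qed

lemma right_span_axis_eq_iff:
  fixes x y :: "'a::division_ring"
  shows "right_span (vector [x, y]) = right_span (vector [0, 1]) \<longleftrightarrow> x = 0 \<and> y \<noteq> 0"
proof
  assume eq: "right_span (vector [x, y]) = right_span (vector [0, 1])"
  have "vector [x, y] \<in> right_span (vector [0, 1])" "vector [0, 1] \<in> right_span (vector [x, y])"
    using self_in_right_span[of "vector [x, y]"] self_in_right_span[of "vector [0, 1]"]
    by (simp_all add: eq)
  then obtain p r where "vector [x, y] = (vector [0 * p, 1 * p] :: 'a^2)"
    "vector [0, 1] = (vector [x * r, y * r] :: 'a^2)"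
    unfolding right_span_vector2 by blast
  then show "x = 0 \<and> y \<noteq> 0"
    by auto
next
  assume "x = 0 \<and> y \<noteq> 0"
  then show "right_span (vector [x, y]) = right_span (vector [0, 1])"
    using right_span_rescale[of y 0 1] by simp
qed

lemma is_line_cases:
  assumes "is_line V"
  obtains q where "V = right_span (vector [1, q])" | "V = right_span (vector [0, 1])"
proof -
  obtain v where v: "v \<noteq> 0" "V = right_span v"
    using assms by (auto simp: is_line_def)
  obtain x y where xy: "v = vector [x, y]"
    using vector2_eta by blast
  show thesis
  proof (cases "x = 0")
    case True
    then have "V = right_span (vector [0, 1])"
      using v by (simp add: xy right_span_axis_eq_iff zero_eq_vector2)
    then show thesis by (rule that(2))
  next
    case False
    then have "V = right_span (vector [1, y * inverse x])"
      by (simp add: v xy right_span_graph_eq_iff mult.assoc)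
    then show thesis by (rule that(1))
  qed
qed

text \<open>Matrices act on the left and scalars on the right, so lines go to lines even though
  the scalars do not commute.\<close>

lemma image_right_span: "(*v) A ` right_span v = right_span (A *v v)"
  unfolding right_span_def image_image
  by (intro image_cong)
     (simp_all add: vec_eq_iff matrix_vector_mult_def sum_distrib_right mult.assoc)

lemma image_mat2_line:
  "(*v) (mat2 a b c d) ` right_span (vector [x, y]) =
     right_span (vector [a * x + b * y, c * x + d * y])"
  by (simp add: image_right_span mat2_mult_vector)

lemma system_of_imprimitivityE:
  assumes "system_of_imprimitivity G S"
  obtains V1 V2 where "S = {V1, V2}" "V1 \<noteq> V2" "is_line V1" "is_line V2"
    "V1 \<inter> V2 = {0}" "{v + w |v w. v \<in> V1 \<and> w \<in> V2} = UNIV"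
proof -
  obtain V1 V2 where V: "S = {V1, V2}" "is_line V1" "is_line V2"
    "V1 \<inter> V2 = {0}" "{v + w |v w. v \<in> V1 \<and> w \<in> V2} = UNIV"
    using assms unfolding system_of_imprimitivity_def
    by (elim conjE exE) (erule that, assumption+)
  have "V1 \<noteq> V2"
    using V(2,4) self_in_right_span by (auto simp: is_line_def)
  with V show thesis
    using that by blast
qed

lemma system_is_line: "system_of_imprimitivity G S \<Longrightarrow> V \<in> S \<Longrightarrow> is_line V"
  by (auto elim: system_of_imprimitivityE)

lemma system_image_in:
  assumes "system_of_imprimitivity G S" "g \<in> G" "V \<in> S"
  shows "(*v) g ` V \<in> S"
proof -
  have "(\<lambda>V. (\<lambda>v. g *v v) ` V) ` S = S"
    using assms(1,2) by (simp add: system_of_imprimitivity_def)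
  then show ?thesis
    using assms(3) by blast
qed

lemma permutation_of_pair_square:
  assumes "f ` {a, b} = {a, b}" "x \<in> {a, b}"
  shows "f (f x) = x"
  using assms by (auto simp: doubleton_eq_iff)

text \<open>The restriction on lines that every later argument starts from: a permutation of two
  lines has trivial square, so the square of each group element stabilises both lines.\<close>

lemma system_square_fixes:
  assumes "system_of_imprimitivity G S" "g \<in> G" "V \<in> S"
  shows "(*v) (g ** g) ` V = V"
proof -
  obtain V1 V2 where S: "S = {V1, V2}"
    using assms(1) by (elim system_of_imprimitivityE)
  have "(\<lambda>V. (\<lambda>v. g *v v) ` V) ` S = S"
    using assms(1,2) by (simp add: system_of_imprimitivity_def)
  then have "(*v) g ` ((*v) g ` V) = V"
    using assms(3) unfolding S by (rule permutation_of_pair_square)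
  then show ?thesis
    by (simp add: image_image matrix_vector_mul_assoc)
qed

lemma system_of_imprimitivity_image:
  fixes P :: "'a::division_ring^2^2"
  assumes P: "invertible P" and S: "system_of_imprimitivity G S"
  shows "system_of_imprimitivity ((\<lambda>g. P ** g ** matrix_inv P) ` G) ((`) ((*v) P) ` S)"
proof -
  note inv = matrix_inv_mult[OF P]
  have PQ: "P *v (matrix_inv P *v v) = v" and QP: "matrix_inv P *v (P *v v) = v" for v
    by (simp_all add: matrix_vector_mul_assoc inv)
  obtain V1 V2 where V: "S = {V1, V2}" "is_line V1" "is_line V2"
    "V1 \<inter> V2 = {0}" "{v + w |v w. v \<in> V1 \<and> w \<in> V2} = UNIV"
    using S by (elim system_of_imprimitivityE)
  have line: "is_line ((*v) P ` V)" if "is_line V" for V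
  proof -
    obtain v where v: "v \<noteq> 0" "V = right_span v"
      using \<open>is_line V\<close> by (auto simp: is_line_def)
    have "P *v v \<noteq> 0"
      using v QP[of v] by (metis matrix_vector_mult_0_right)
    then show ?thesis
      unfolding is_line_def v image_right_span by blast
  qed
  have "(*v) P ` V1 \<inter> (*v) P ` V2 = (*v) P ` (V1 \<inter> V2)"
    by (rule image_Int[symmetric]) (metis QP injI)
  then have int: "(*v) P ` V1 \<inter> (*v) P ` V2 = {0}"
    by (simp add: V)
  have "v \<in> {v + w |v w. v \<in> (*v) P ` V1 \<and> w \<in> (*v) P ` V2}" for v
  proof -
    have "matrix_inv P *v v \<in> {v + w |v w. v \<in> V1 \<and> w \<in> V2}"
      by (simp add: V)
    then obtain x y where "x \<in> V1" "y \<in> V2" "matrix_inv P *v v = x + y"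
      by auto
    then have "x \<in> V1" "y \<in> V2" "v = P *v x + P *v y"
      using PQ[of v] by (simp_all add: matrix_vector_right_distrib)
    then show ?thesis by blast
  qed
  moreover have "((\<lambda>V. (*v) (P ** g ** matrix_inv P) ` V) ` (`) ((*v) P) ` S) = (`) ((*v) P) ` S"
    if "g \<in> G" for g
  proof -
    have "(*v) (P ** g ** matrix_inv P) ` ((*v) P ` V) = (*v) P ` ((*v) g ` V)" for V
      by (simp add: image_image QP flip: matrix_vector_mul_assoc)
    moreover have "(\<lambda>V. (*v) g ` V) ` S = S"
      using S that by (simp add: system_of_imprimitivity_def)
    ultimately show ?thesis
      by (metis (no_types, lifting) image_cong image_image)
  qed
  ultimately show ?thesis
    unfolding system_of_imprimitivity_def using V(1) line[OF V(2)] line[OF V(3)] int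
    by (intro conjI exI[of _ "(*v) P ` V1"] exI[of _ "(*v) P ` V2"]) auto
qed

lemma system_of_imprimitivity_conj_by_iff:
  fixes P :: "'a::division_ring^2^2"
  assumes P: "invertible P"
  shows "(\<exists>S. system_of_imprimitivity (conj_by P G) S) \<longleftrightarrow> (\<exists>S. system_of_imprimitivity G S)"
proof -
  have *: "\<exists>S. system_of_imprimitivity (conj_by P G) S"
    if "system_of_imprimitivity G S" "invertible P" for P :: "'a^2^2" and G S
    using system_of_imprimitivity_image[OF invertible_matrix_inv(1)[OF that(2)] that(1)]
    by (auto simp: conj_by_def invertible_matrix_inv[OF that(2)])
  show ?thesis
    using *[OF _ P] *[OF _ invertible_matrix_inv(1)[OF P]] conj_by_matrix_inv[OF P] by metis
qed

text \<open>The coordinate axes are complementary, and an invertible matrix carries them to the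
  lines spanned by its columns; only the permutation of the lines remains to be checked.\<close>

lemma system_of_imprimitivity_columnsI:
  fixes a b c d :: "'a::division_ring"
  assumes inv: "invertible (mat2 a b c d)"
    and S: "S = {right_span (vector [a, c]), right_span (vector [b, d])}"
    and perm: "\<And>g. g \<in> G \<Longrightarrow> (`) ((*v) g) ` S = S"
  shows "system_of_imprimitivity G S"
proof -
  let ?U = "mat2 a b c d"
  let ?V = "right_span (vector [a, c])" and ?W = "right_span (vector [b, d])"
  have QU: "matrix_inv ?U *v (?U *v v) = v" and UQ: "?U *v (matrix_inv ?U *v v) = v" for v
    by (simp_all add: matrix_vector_mul_assoc matrix_inv_mult[OF inv])
  have zero: "p = 0" "q = 0" if "vector [a * p + b * q, c * p + d * q] = (0 :: 'a^2)" for p q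
  proof -
    have "vector [p, q] = matrix_inv ?U *v (?U *v vector [p, q])"
      by (simp add: QU)
    also have "\<dots> = 0"
      by (simp add: mat2_mult_vector that del: vector2_eq_iff)
    finally show "p = 0" "q = 0"
      by (simp_all add: zero_eq_vector2)
  qed
  have "vector [a, c] \<noteq> (0 :: 'a^2)" "vector [b, d] \<noteq> (0 :: 'a^2)"
    using zero[of 1 0] zero[of 0 1] by auto
  then have lines: "is_line ?V" "is_line ?W"
    unfolding is_line_def by blast+
  have "v = 0" if "v \<in> ?V" "v \<in> ?W" for v
  proof -
    obtain p q where "v = vector [a * p, c * p]" "v = vector [b * q, d * q]"
      using \<open>v \<in> ?V\<close> \<open>v \<in> ?W\<close> unfolding right_span_vector2 by blast
    then show ?thesis
      using zero[of p "- q"] by (simp add: zero_eq_vector2)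
  qed
  then have int: "?V \<inter> ?W = {0}"
    using zero_in_right_span by blast
  have "v \<in> {v + w |v w. v \<in> ?V \<and> w \<in> ?W}" for v
  proof -
    obtain p q where "matrix_inv ?U *v v = vector [p, q]"
      using vector2_eta by blast
    then have "v = vector [a * p + b * q, c * p + d * q]"
      using UQ[of v] by (simp add: mat2_mult_vector)
    also have "\<dots> = vector [a * p, c * p] + vector [b * q, d * q]"
      by (simp add: vec_eq_iff forall_2)
    finally show ?thesis
      unfolding right_span_vector2 by blast
  qed
  then show ?thesis
    unfolding system_of_imprimitivity_def S using lines int perm[unfolded S]
    by (intro conjI exI[of _ ?V] exI[of _ ?W]) auto
qed


section \<open>Complex primitivity from the tetrahedral group\<close>

lemma GL_sel: "A \<otimes>\<^bsub>GL\<^esub> B = A ** B" "\<one>\<^bsub>GL\<^esub> = mat 1" "carrier GL = {A. invertible A}"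
  by (simp_all add: GL_def)

text \<open>A scalar fixes every complex line, so irreducibility and primitivity over
  \<open>\<complex>\<close> depend only on the image of the group in the projective group, that
  is, on the quaternions that occur in it up to a scalar.\<close>

definition projectively_contains :: "(complex^2^2) set \<Rightarrow> quat \<Rightarrow> bool" where
  "projectively_contains G q \<longleftrightarrow> (\<exists>c. c \<noteq> 0 \<and> scaled_su2 c q \<in> G)"

lemma projectively_contains_mult:
  assumes "projectively_contains (generate GL X) p" "projectively_contains (generate GL X) q"
  shows "projectively_contains (generate GL X) (p * q)"
proof -
  obtain c d where "c \<noteq> 0" "scaled_su2 c p \<in> generate GL X"
    "d \<noteq> 0" "scaled_su2 d q \<in> generate GL X"
    using assms by (auto simp: projectively_contains_def)
  then have "scaled_su2 (c * d) (p * q) \<in> generate GL X" "c * d \<noteq> 0"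
    using generate.eng[of "scaled_su2 c p" GL X "scaled_su2 d q"]
    by (simp_all add: GL_sel scaled_su2_mult)
  then show ?thesis
    unfolding projectively_contains_def by blast
qed

lemma projectively_contains_uminus:
  assumes "projectively_contains G q"
  shows "projectively_contains G (- q)"
proof -
  obtain c where "c \<noteq> 0" "scaled_su2 c q \<in> G"
    using assms by (auto simp: projectively_contains_def)
  then show ?thesis
    using scaled_su2_minus[of c "- q"] unfolding projectively_contains_def
    by (intro exI[of _ "- c"]) simp
qed

text \<open>Two generators of the binary tetrahedral group, each of order six, with product
  \<open>i\<close>. Their order gives \<open>q\<^sup>4 = - q\<close>: up to sign each of them is
  the square of a square, so it stabilises both lines of any system, and therefore so does
  \<open>i\<close>.\<close>

abbreviation quat_h :: quat where "quat_h \<equiv> Quat (1/2) (1/2) (1/2) (1/2)"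

abbreviation quat_h' :: quat where "quat_h' \<equiv> Quat (1/2) (1/2) (-1/2) (1/2)"

lemma quat_h_mult_h': "quat_h * quat_h' = Quat 0 1 0 0"
  by (simp add: quat_eq_iff)

lemma quat_h_power4:
  "(quat_h * quat_h) * (quat_h * quat_h) = - quat_h"
  "(quat_h' * quat_h') * (quat_h' * quat_h') = - quat_h'"
  by (simp_all add: quat_eq_iff)

lemma image_mult_fixes:
  assumes "(*v) A ` V = V" "(*v) B ` V = V"
  shows "(*v) (A ** B) ` V = V"
proof -
  have "(*v) (A ** B) ` V = (*v) A ` ((*v) B ` V)"
    by (simp add: image_image matrix_vector_mul_assoc)
  with assms show ?thesis by simp
qed

text \<open>Both lines of a system would be fixed by \<open>i\<close>, whose only complex
  eigenlines are the coordinate axes; but \<open>(1 + i + j + k) / 2\<close>, which has to fix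
  the lines too, moves both axes.\<close>

lemma tetrahedral_primitive:
  assumes h: "projectively_contains G quat_h" "projectively_contains G quat_h'"
  shows "\<not> system_of_imprimitivity G S"
proof
  assume S: "system_of_imprimitivity G S"
  then obtain V where V: "V \<in> S" "is_line V"
    by (elim system_of_imprimitivityE) auto
  have fix4: "(*v) (scaled_su2 (c * c * (c * c)) (q * q * (q * q))) ` V = V"
    if "scaled_su2 c q \<in> G" for c q
    using image_mult_fixes[OF system_square_fixes[OF S that V(1)] system_square_fixes[OF S that V(1)]]
    by (simp add: scaled_su2_mult)
  obtain c d where cd: "c \<noteq> 0" "scaled_su2 c quat_h \<in> G" "d \<noteq> 0" "scaled_su2 d quat_h' \<in> G"
    using h by (auto simp: projectively_contains_def)
  define c' d' where "c' = - (c * c * (c * c))" and "d' = - (d * d * (d * d))"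
  have cd': "c' \<noteq> 0" "d' \<noteq> 0" "(*v) (scaled_su2 c' quat_h) ` V = V"
    "(*v) (scaled_su2 d' quat_h') ` V = V"
    using cd(1,3) fix4[OF cd(2)] fix4[OF cd(4)]
    unfolding c'_def d'_def scaled_su2_minus quat_h_power4 by simp_all
  have "(*v) (scaled_su2 (c' * d') (Quat 0 1 0 0)) ` V = V"
    using image_mult_fixes[OF cd'(3,4)] by (simp only: scaled_su2_mult quat_h_mult_h')
  then have i: "(*v) (mat2 (c' * d' * \<i>) 0 0 (- (c' * d' * \<i>))) ` V = V"
    by (simp add: scaled_su2_eq_mat2 Complex_eq)
  have h: "(*v) (mat2 (c' * Complex (1/2) (1/2)) (c' * Complex (1/2) (1/2))
      (c' * Complex (-1/2) (1/2)) (c' * Complex (1/2) (-1/2))) ` V = V"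
    using cd'(3) by (simp add: scaled_su2_eq_mat2)
  show False
    using V(2)
  proof (cases rule: is_line_cases)
    case (1 q)
    then have "q = 0"
      using i cd' by (simp add: image_mat2_line right_span_graph_eq_iff)
    then show False
      using h cd' 1 by (auto simp: image_mat2_line right_span_graph_eq_iff complex_eq_iff)
  next
    case 2
    then show False
      using h cd' by (simp add: image_mat2_line right_span_axis_eq_iff complex_eq_iff)
  qed
qed

text \<open>An invariant subspace is closed under \<open>i\<close>, hence under both coordinate
  projections, and \<open>(1 + i + j + k) / 2\<close> mixes the two coordinates.\<close>

lemma tetrahedral_irreducible:
  assumes h: "projectively_contains (generate GL X) quat_h"
    "projectively_contains (generate GL X) quat_h'"
  shows "irreducible_group (generate GL X)"
  unfolding irreducible_group_def
proof (intro allI impI)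
  fix V :: "(complex^2) set"
  assume "vec.subspace V \<and> (\<forall>g\<in>generate GL X. \<forall>v\<in>V. g *v v \<in> V)"
  then have sub: "vec.subspace V" and inv: "\<And>g v. g \<in> generate GL X \<Longrightarrow> v \<in> V \<Longrightarrow> g *v v \<in> V"
    by auto
  have scale: "vector [k * x, k * y] \<in> V" if "vector [x, y] \<in> V" for k x y
  proof -
    have "k *s vector [x, y] = (vector [k * x, k * y] :: complex^2)"
      by (simp add: vec_eq_iff forall_2)
    then show ?thesis
      using vec.subspace_scale[OF sub that, of k] by simp
  qed
  have add: "vector [x + x', y + y'] \<in> V" if "vector [x, y] \<in> V" "vector [x', y'] \<in> V" for x y x' y'
  proof -
    have "vector [x, y] + vector [x', y'] = (vector [x + x', y + y'] :: complex^2)"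
      by (simp add: vec_eq_iff forall_2)
    then show ?thesis
      using vec.subspace_add[OF sub that] by simp
  qed
  have act: "su2 q *v v \<in> V" if q: "projectively_contains (generate GL X) q" and "v \<in> V" for q v
  proof -
    obtain c where c: "c \<noteq> 0" "scaled_su2 c q \<in> generate GL X"
      using q by (auto simp: projectively_contains_def)
    have "inverse c *s (scaled_su2 c q *v v) = su2 q *v v"
      using c(1) by (simp add: vec_eq_iff scale_mat_def matrix_vector_mult_def sum_2 field_simps)
    then show ?thesis
      using vec.subspace_scale[OF sub inv[OF c(2) \<open>v \<in> V\<close>], of "inverse c"] by simp
  qed
  have i: "vector [\<i> * x, - (\<i> * y)] \<in> V" if "vector [x, y] \<in> V" for x y
    using act[OF projectively_contains_mult[OF h] that]
    by (simp add: quat_h_mult_h' su2_def mat2_mult_vector Complex_eq)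
  have split: "vector [x, 0] \<in> V" "vector [0, y] \<in> V" if "vector [x, y] \<in> V" for x y
  proof -
    have "vector [- \<i> * (\<i> * x), - \<i> * - (\<i> * y)] \<in> V" 
      using scale[OF i[OF that], of "- \<i>"] by simp
    then have *: "vector [x, - y] \<in> V"
      by simp
    show "vector [x, 0] \<in> V"
      using scale[OF add[OF that *], of "1/2"] by simp
    show "vector [0, y] \<in> V"
      using scale[OF add[OF that scale[OF *, of "- 1"]], of "1/2"] by simp
  qed
  have h: "vector [Complex (1/2) (1/2) * (x + y), Complex (-1/2) (1/2) * (x - y)] \<in> V"
    if "vector [x, y] \<in> V" for x y
  proof -
    have "Complex (- 1/2) (1/2) * x + Complex (1/2) (- 1/2) * y = Complex (-1/2) (1/2) * (x - y)"
      by (simp add: complex_eq_iff algebra_simps)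
    then show ?thesis
      using act[OF h(1) that] by (simp add: su2_def mat2_mult_vector distrib_left)
  qed
  have nz: "Complex (1/2) (1/2) \<noteq> 0" "Complex (-1/2) (1/2) \<noteq> 0"
    by (simp_all add: complex_eq_iff)
  have units: "vector [1, 0] \<in> V \<and> vector [0, 1] \<in> V" if "vector [x, y] \<in> V" "x - y \<noteq> 0" "x + y \<noteq> 0" for x y
  proof
    have "Complex (1/2) (1/2) * (x + y) \<noteq> 0"
      using that(3) nz by (metis mult_eq_0_iff)
    then show "vector [1, 0] \<in> V"
      using scale[OF split(1)[OF h[OF that(1)]], of "inverse (Complex (1/2) (1/2) * (x + y))"]
      by (metis left_inverse mult_zero_right)
    have "Complex (-1/2) (1/2) * (x - y) \<noteq> 0"
      using that(2) nz by (metis mult_eq_0_iff)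
    then show "vector [0, 1] \<in> V"
      using scale[OF split(2)[OF h[OF that(1)]], of "inverse (Complex (-1/2) (1/2) * (x - y))"]
      by (metis left_inverse mult_zero_right)
  qed
  show "V = {0} \<or> V = UNIV"
  proof (rule disjCI)
    assume "V \<noteq> UNIV"
    have "v = 0" if v: "v \<in> V" for v
    proof (rule ccontr)
      assume "v \<noteq> 0"
      obtain x y where xy: "v = vector [x, y]"
        using vector2_eta by blast
      have "vector [1, 0] \<in> V \<and> vector [0, 1] \<in> V"
      proof (cases "x = 0")
        case True
        then show ?thesis
          using units[of 0 y] v \<open>v \<noteq> 0\<close> by (simp add: xy zero_eq_vector2)
      next
        case False
        then show ?thesis
          using units[of x 0] split(1)[of x y] v by (simp add: xy)
      qed
      then have "vector [a, b] \<in> V" for a b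
        using add[OF scale[of 1 0 a] scale[of 0 1 b]] by simp
      then have "V = UNIV"
        using vector2_eta by (metis UNIV_eq_I)
      with \<open>V \<noteq> UNIV\<close> show False by simp
    qed
    then show "V = {0}"
      using vec.subspace_0[OF sub] by auto
  qed
qed


section \<open>Complex reflections and their quaternionic systems\<close>

text \<open>The trace and the determinant say that the eigenvalues are \<open>1\<close> and
  \<open>\<zeta>\<close>. The columns of \<open>P\<close> are eigenvectors, read off from
  \<open>A - \<zeta>\<close> and \<open>A - 1\<close>; which entries of these rank-one matrices
  serve depends on which off-diagonal entry of \<open>A\<close> is nonzero.\<close>

lemma reflection_diagonalisable:
  fixes a b c d \<zeta> :: complex
  assumes tr: "a + d = 1 + \<zeta>" and det: "a * d - b * c = \<zeta>" and "\<zeta> \<noteq> 1"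
  shows "\<exists>P. invertible P \<and> mat2 a b c d ** P = P ** mat2 1 0 0 \<zeta>"
proof -
  have d: "d = 1 + \<zeta> - a"
    using tr by (simp add: algebra_simps)
  have bc: "b * c = (a - 1) * (\<zeta> - a)"
    using det by (simp add: d algebra_simps)
  consider "b \<noteq> 0" | "b = 0" "c \<noteq> 0" | "b = 0" "c = 0" "a = 1" | "b = 0" "c = 0" "a = \<zeta>"
    using bc by (metis mult_eq_0_iff right_minus_eq)
  then show ?thesis
  proof cases
    case 1
    have "invertible (mat2 b b (1 - a) (\<zeta> - a))"
      using 1 \<open>\<zeta> \<noteq> 1\<close> by (simp add: invertible_det_nz det_2 algebra_simps)
    moreover have "mat2 a b c d ** mat2 b b (1 - a) (\<zeta> - a) = mat2 b b (1 - a) (\<zeta> - a) ** mat2 1 0 0 \<zeta>"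
      using bc by (simp add: mat2_mult d algebra_simps)
    ultimately show ?thesis by blast
  next
    case 2
    have "invertible (mat2 (a - \<zeta>) (a - 1) c c)"
      using 2 \<open>\<zeta> \<noteq> 1\<close> by (simp add: invertible_det_nz det_2 algebra_simps)
    moreover have "mat2 a b c d ** mat2 (a - \<zeta>) (a - 1) c c = mat2 (a - \<zeta>) (a - 1) c c ** mat2 1 0 0 \<zeta>"
      using bc 2 by (auto simp: mat2_mult d algebra_simps)
    ultimately show ?thesis by blast
  next
    case 3
    then have "mat2 a b c d ** mat 1 = mat 1 ** mat2 1 0 0 \<zeta>"
      by (simp add: d)
    moreover have "invertible (mat 1 :: complex^2^2)"
      by (auto simp: invertible_def)
    ultimately show ?thesis by blast
  next
    case 4
    have "invertible (mat2 0 1 1 0 :: complex^2^2)"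
      by (simp add: invertible_det_nz det_2)
    moreover have "mat2 a b c d ** mat2 0 1 1 0 = mat2 0 1 1 0 ** mat2 1 0 0 \<zeta>"
      using 4 by (simp add: mat2_mult d)
    ultimately show ?thesis by blast
  qed
qed

text \<open>The hypothesis is trace equals one plus determinant for a scaled unit quaternion
  with real part \<open>r\<close>. Determinant \<open>1\<close> would force \<open>r =
  \<plusminus>1\<close>, the case of the identity matrix.\<close>

lemma square_neq_1:
  fixes c :: complex
  assumes "2 * c * of_real r = 1 + c\<^sup>2" "\<bar>r\<bar> < 1"
  shows "c\<^sup>2 \<noteq> 1"
proof
  assume *: "c\<^sup>2 = 1"
  then have "c = 1 \<or> c = - 1"
    by (simp add: power2_eq_1_iff)
  then have "\<bar>r\<bar> = 1"
    using assms(1) * by (auto simp: complex_eq_iff)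
  with assms(2) show False by simp
qed

lemma scaled_su2_diagonalisable:
  fixes c :: complex
  assumes "qnorm2 q = 1" "2 * c * of_real (qre q) = 1 + c\<^sup>2" "\<bar>qre q\<bar> < 1"
  shows "\<exists>P. invertible P \<and> scaled_su2 c q ** P = P ** mat2 1 0 0 (c\<^sup>2)"
  unfolding scaled_su2_eq_mat2
proof (rule reflection_diagonalisable)
  show "c * Complex (qre q) (qim_i q) + c * Complex (qre q) (- qim_i q) = 1 + c\<^sup>2"
    unfolding assms(2)[symmetric] by (simp add: complex_eq_iff)
  have "c * Complex (qre q) (qim_i q) * (c * Complex (qre q) (- qim_i q)) -
      c * Complex (qim_j q) (qim_k q) * (c * Complex (- qim_j q) (qim_k q)) = c\<^sup>2 * of_real (qnorm2 q)"
    by (simp add: complex_eq_iff qnorm2_def power2_eq_square algebra_simps)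
  with assms(1) show "c * Complex (qre q) (qim_i q) * (c * Complex (qre q) (- qim_i q)) -
      c * Complex (qim_j q) (qim_k q) * (c * Complex (- qim_j q) (qim_k q)) = c\<^sup>2"
    by simp
qed (rule square_neq_1[OF assms(2,3)])

lemma scaled_su2_complex_reflection:
  fixes c :: complex
  assumes q: "qnorm2 q = 1" "2 * c * of_real (qre q) = 1 + c\<^sup>2" "\<bar>qre q\<bar> < 1"
  shows "complex_reflection (scaled_su2 c q)"
proof -
  let ?g = "scaled_su2 c q"
  obtain P where P: "invertible P" "?g ** P = P ** mat2 1 0 0 (c\<^sup>2)"
    using scaled_su2_diagonalisable[OF q] by blast
  note inv = matrix_inv_mult[OF P(1)]
  have "c \<noteq> 0"
    using q(2) by auto
  define e where "e = P *v vector [1, 0]"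
  have "?g *v v = v \<longleftrightarrow> (\<exists>k. v = k *s e)" for v
  proof -
    obtain x y where xy: "matrix_inv P *v v = vector [x, y]"
      using vector2_eta by blast
    have v: "v = P *v vector [x, y]"
      by (simp add: matrix_vector_mul_assoc inv flip: xy)
    have inj: "P *v u = P *v w \<longleftrightarrow> u = w" for u w
      by (metis inv(2) matrix_vector_mul_assoc matrix_vector_mul_lid)
    have "?g *v v = (P ** mat2 1 0 0 (c\<^sup>2)) *v vector [x, y]"
      unfolding v matrix_vector_mul_assoc P(2) ..
    also have "\<dots> = P *v vector [x, c\<^sup>2 * y]"
      by (simp add: mat2_mult_vector flip: matrix_vector_mul_assoc)
    finally have "?g *v v = P *v vector [x, c\<^sup>2 * y]" .
    then have "?g *v v = v \<longleftrightarrow> y = 0"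
      using square_neq_1[OF q(2,3)] by (simp add: v inj)
    moreover have "k *s e = P *v vector [k, 0]" for k
      by (simp add: e_def vec_eq_iff forall_2 matrix_vector_mult_def sum_2)
    then have "(\<exists>k. v = k *s e) \<longleftrightarrow> y = 0"
      by (simp add: v inj)
    ultimately show ?thesis by simp
  qed
  then have "{v. ?g *v v = v} = vec.span {e}"
    by (auto simp: vec.span_singleton)
  moreover have "e \<noteq> 0"
  proof
    assume "e = 0"
    then have "matrix_inv P *v (P *v vector [1, 0]) = 0"
      by (simp add: e_def)
    then show False
      by (simp add: matrix_vector_mul_assoc inv zero_eq_vector2)
  qed
  ultimately have "vec.dim {v. ?g *v v = v} = 1"
    using vec.dim_span_eq_card_independent[of "{e}"] by (simp add: vec.dim_span)
  then show ?thesis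
    using scaled_su2_inverse(1)[OF \<open>c \<noteq> 0\<close> q(1)] by (simp add: complex_reflection_def)
qed

text \<open>Since \<open>qre q \<noteq> 0\<close>, the reflection has order at least three. In a
  basis of eigenvectors it is \<open>diag (1, \<zeta>)\<close> with \<open>\<zeta>\<^sup>2
  \<noteq> 1\<close>, and its square still has only the two axes as fixed quaternionic lines.
  Any quaternionic system therefore consists of these axes, which are spanned by complex
  vectors, and so it comes from a complex system.\<close>

lemma no_quaternionic_system:
  fixes c :: complex
  assumes prim: "\<nexists>S. system_of_imprimitivity G S"
    and g: "scaled_su2 c q \<in> G" "qnorm2 q = 1" "2 * c * of_real (qre q) = 1 + c\<^sup>2"
    and q: "0 < \<bar>qre q\<bar>" "\<bar>qre q\<bar> < 1"
  shows "\<not> quaternionic_system G S"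
proof
  assume "quaternionic_system G S"
  define \<zeta> where "\<zeta> = c\<^sup>2"
  have "c\<^sup>2 \<noteq> 1"
    using g(3) q(2) by (rule square_neq_1)
  moreover have "c\<^sup>2 \<noteq> - 1"
    using g(3) q(1) by auto
  ultimately have \<zeta>: "\<zeta> * \<zeta> \<noteq> 1"
    by (simp add: square_eq_1_iff flip: \<zeta>_def)
  obtain P where P: "invertible P" "scaled_su2 c q ** P = P ** mat2 1 0 0 \<zeta>"
    using scaled_su2_diagonalisable[OF g(2,3) q(2)] by (auto simp: \<zeta>_def)
  define G' where "G' = conj_by P G"
  have "matrix_inv P ** scaled_su2 c q ** P = matrix_inv P ** (P ** mat2 1 0 0 \<zeta>)"
    using P(2) by (simp flip: matrix_mul_assoc)
  also have "\<dots> = mat2 1 0 0 \<zeta>"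
    by (simp add: matrix_mul_assoc matrix_inv_mult[OF P(1)])
  finally have D: "mat2 1 0 0 \<zeta> \<in> G'"
    using g(1) by (force simp: G'_def conj_by_def)
  obtain S where S: "system_of_imprimitivity (quat_mat ` G') S"
    using \<open>quaternionic_system G S\<close>
      system_of_imprimitivity_conj_by_iff[OF quat_mat_inverse(1)[OF P(1)], of "quat_mat ` G"]
    by (auto simp: G'_def quat_mat_conj_by[OF P(1)] quaternionic_system_def)
  have axis: "V = right_span (vector [1, 0]) \<or> V = right_span (vector [0, 1])" if "V \<in> S" for V
  proof (rule is_line_cases[OF system_is_line[OF S that]])
    fix p assume V: "V = right_span (vector [1, p])"
    have "(*v) (mat2 1 0 0 (quat_of_complex (\<zeta> * \<zeta>))) ` V = V"
      using system_square_fixes[OF S imageI[OF D] that]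
      by (simp add: quat_mat_mat2 mat2_mult quat_of_complex_hom)
    then have "(quat_of_complex (\<zeta> * \<zeta>) - 1) * p = 0"
      by (simp add: V image_mat2_line right_span_graph_eq_iff left_diff_distrib)
    then have "p = 0"
      using \<zeta> quat_of_complex_eq_0_iff[of "\<zeta> * \<zeta> - 1"]
        quat_of_complex_hom(1)[of "\<zeta> * \<zeta> - 1" 1]
      by (auto simp: quat_of_complex_hom)
    then show ?thesis by (simp add: V)
  qed auto
  obtain V1 V2 where "S = {V1, V2}" "V1 \<noteq> V2"
    using S by (elim system_of_imprimitivityE)
  with axis have S_eq: "S = {right_span (vector [1, 0]), right_span (vector [0, 1])}"
    by blast
  \<comment> \<open>A matrix permuting the two quaternionic axes is monomial, and if its entries are complex it
    permutes the two complex axes.\<close>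
  let ?T = "{right_span (vector [1, 0]), right_span (vector [0, 1])} :: (complex^2) set set"
  have "(`) ((*v) A) ` ?T = ?T" if "A \<in> G'" for A
  proof -
    obtain a b c d where A: "A = mat2 a b c d"
      using mat2_eta by blast
    let ?X = "right_span (vector [1, 0]) :: (quat^2) set"
    let ?Y = "right_span (vector [0, 1]) :: (quat^2) set"
    have neq: "?X \<noteq> ?Y"
      by (simp add: right_span_axis_eq_iff)
    have perm: "(`) ((*v) (quat_mat A)) ` {?X, ?Y} = {?X, ?Y}"
      using S that unfolding S_eq by (simp add: system_of_imprimitivity_def)
    have im: "(*v) (quat_mat A) ` ?X = right_span (vector [quat_of_complex a, quat_of_complex c])"
      "(*v) (quat_mat A) ` ?Y = right_span (vector [quat_of_complex b, quat_of_complex d])"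
      by (simp_all add: A quat_mat_mat2 image_mat2_line)
    have "a \<noteq> 0 \<and> c = 0 \<and> b = 0 \<and> d \<noteq> 0 \<or> a = 0 \<and> c \<noteq> 0 \<and> b \<noteq> 0 \<and> d = 0"
      using perm neq
      by (auto simp: im doubleton_eq_iff right_span_axis_eq_iff right_span_graph_eq_iff[of _ _ 0, simplified])
    then have "(*v) A ` right_span (vector [1, 0]) = (right_span (vector [1, 0]) :: (complex^2) set) \<and>
        (*v) A ` right_span (vector [0, 1]) = (right_span (vector [0, 1]) :: (complex^2) set) \<or>
        (*v) A ` right_span (vector [1, 0]) = (right_span (vector [0, 1]) :: (complex^2) set) \<and>
        (*v) A ` right_span (vector [0, 1]) = (right_span (vector [1, 0]) :: (complex^2) set)"
      by (auto simp: A image_mat2_line right_span_axis_eq_iff right_span_graph_eq_iff[of _ _ 0, simplified])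
    then show ?thesis by auto
  qed
  then have "system_of_imprimitivity G' ?T"
    by (intro system_of_imprimitivity_columnsI[of 1 0 0 1]) (auto simp: invertible_det_nz det_2)
  then show False
    using prim system_of_imprimitivity_conj_by_iff[OF P(1), of G] by (auto simp: G'_def)
qed


section \<open>Finiteness\<close>

definition integral_multiple :: "real \<Rightarrow> quat \<Rightarrow> bool" where
  "integral_multiple r q \<longleftrightarrow>
     (\<exists>a b c d :: int. q = Quat (r * of_int a) (r * of_int b) (r * of_int c) (r * of_int d))"

lemma integral_multiple_mult:
  assumes "integral_multiple r p" "integral_multiple s q"
  shows "integral_multiple (r * s) (p * q)"
proof -
  obtain a b c d :: int where
    p: "p = Quat (r * of_int a) (r * of_int b) (r * of_int c) (r * of_int d)"
    using assms(1) unfolding integral_multiple_def by blast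
  obtain a' b' c' d' :: int where
    q: "q = Quat (s * of_int a') (s * of_int b') (s * of_int c') (s * of_int d')"
    using assms(2) unfolding integral_multiple_def by blast
  have "p * q = Quat (r * s * of_int (a * a' - b * b' - c * c' - d * d'))
      (r * s * of_int (a * b' + b * a' + c * d' - d * c'))
      (r * s * of_int (a * c' - b * d' + c * a' + d * b'))
      (r * s * of_int (a * d' + b * c' - c * b' + d * a'))"
    by (simp add: p q quat_eq_iff algebra_simps)
  then show ?thesis
    unfolding integral_multiple_def by blast
qed

lemma odd_square_mod_8: "odd (a :: int) \<Longrightarrow> a\<^sup>2 mod 8 = 1"
proof -
  assume "odd a"
  then have "a mod 8 = 1 \<or> a mod 8 = 3 \<or> a mod 8 = 5 \<or> a mod 8 = 7"
    by presburger
  moreover have "a\<^sup>2 mod 8 = (a mod 8)\<^sup>2 mod 8"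
    by (simp add: power_mod)
  ultimately show ?thesis by auto
qed

lemma even_square_mod_4: "even (a :: int) \<Longrightarrow> a\<^sup>2 mod 4 = 0"
  by (auto simp: power2_eq_square elim!: evenE)

text \<open>Squares are \<open>1\<close>, \<open>0\<close> or \<open>4\<close> modulo
  \<open>8\<close>, and \<open>1\<close> exactly for odd numbers. Up to three odd squares among
  the four make the sum nonzero modulo \<open>4\<close>, and four of them make it
  \<open>4\<close> modulo \<open>8\<close>.\<close>

lemma four_squares_even:
  fixes a b c d :: int
  assumes "8 dvd a\<^sup>2 + b\<^sup>2 + c\<^sup>2 + d\<^sup>2"
  shows "even a \<and> even b \<and> even c \<and> even d"
proof -
  have 8: "(a\<^sup>2 + b\<^sup>2 + c\<^sup>2 + d\<^sup>2) mod 8 = 0"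
    using assms by simp
  have *: "x\<^sup>2 mod 8 = 1 \<and> odd x \<or> x\<^sup>2 mod 4 = 0 \<and> even x" for x :: int
    using odd_square_mod_8[of x] even_square_mod_4[of x] by blast
  show ?thesis
    using *[of a] *[of b] *[of c] *[of d] 8
    by (elim disjE conjE) (simp_all, presburger+)
qed

text \<open>A product of quaternions with small denominators has a priori larger denominators.
  If it is a unit quaternion, the parity of sums of four squares cancels a factor
  \<open>2\<close> again; this is why the groups below are closed under multiplication.\<close>

lemma integral_multiple_double:
  fixes n :: int
  assumes "integral_multiple r q" "qnorm2 q = 1" "r\<^sup>2 * (8 * of_int n) = 1"
  shows "integral_multiple (2 * r) q"
proof -
  obtain a b c d :: int where q: "q = Quat (r * of_int a) (r * of_int b) (r * of_int c) (r * of_int d)"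
    using assms(1) by (auto simp: integral_multiple_def)
  have "r\<^sup>2 * of_int (a\<^sup>2 + b\<^sup>2 + c\<^sup>2 + d\<^sup>2) = r\<^sup>2 * of_int (8 * n)"
    using assms(2,3) by (simp add: q qnorm2_def power_mult_distrib algebra_simps)
  moreover have "r \<noteq> 0"
    using assms(3) by auto
  ultimately have "a\<^sup>2 + b\<^sup>2 + c\<^sup>2 + d\<^sup>2 = 8 * n"
    by (metis mult_cancel_left of_int_eq_iff power_not_zero)
  then have "even a \<and> even b \<and> even c \<and> even d"
    by (intro four_squares_even) simp
  then obtain a' b' c' d' where "a = 2 * a'" "b = 2 * b'" "c = 2 * c'" "d = 2 * d'"
    by (elim conjE evenE)
  then show ?thesis
    unfolding integral_multiple_def q
    by (intro exI[of _ a'] exI[of _ b'] exI[of _ c'] exI[of _ d']) simp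
qed

lemma finite_unit_integral_multiples:
  assumes "r > 0"
  shows "finite {q. qnorm2 q = 1 \<and> integral_multiple r q}"
proof -
  obtain n :: int where n: "1 / r \<le> of_int n"
    using ex_le_of_int by blast
  have bound: "x \<in> {-n..n}" if "(r * of_int x)\<^sup>2 \<le> 1" for x :: int
  proof -
    have "\<bar>r * of_int x\<bar> \<le> 1"
      using that by (simp add: abs_square_le_1)
    then have "\<bar>of_int x :: real\<bar> \<le> 1 / r"
      using assms by (simp add: abs_mult field_simps)
    with n have "\<bar>of_int x :: real\<bar> \<le> of_int n" by linarith
    then show ?thesis by auto
  qed
  have "{q. qnorm2 q = 1 \<and> integral_multiple r q} \<subseteq>
    (\<lambda>(a, b, c, d). Quat (r * of_int a) (r * of_int b) (r * of_int c) (r * of_int d)) `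
      ({-n..n} \<times> {-n..n} \<times> {-n..n} \<times> {-n..n})"
  proof
    fix q assume "q \<in> {q. qnorm2 q = 1 \<and> integral_multiple r q}"
    then obtain a b c d :: int where q: "qnorm2 q = 1"
      "q = Quat (r * of_int a) (r * of_int b) (r * of_int c) (r * of_int d)"
      by (auto simp: integral_multiple_def)
    then have sum: "(r * of_int a)\<^sup>2 + (r * of_int b)\<^sup>2 + (r * of_int c)\<^sup>2 + (r * of_int d)\<^sup>2 = 1"
      by (simp add: qnorm2_def)
    have "(r * of_int a)\<^sup>2 \<le> 1" "(r * of_int b)\<^sup>2 \<le> 1" "(r * of_int c)\<^sup>2 \<le> 1" "(r * of_int d)\<^sup>2 \<le> 1"
      using sum zero_le_power2[of "r * of_int a"] zero_le_power2[of "r * of_int b"]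
        zero_le_power2[of "r * of_int c"] zero_le_power2[of "r * of_int d"] by linarith+
    then have "(a, b, c, d) \<in> {-n..n} \<times> {-n..n} \<times> {-n..n} \<times> {-n..n}"
      using bound by blast
    then show "q \<in> (\<lambda>(a, b, c, d). Quat (r * of_int a) (r * of_int b) (r * of_int c) (r * of_int d)) `
      ({-n..n} \<times> {-n..n} \<times> {-n..n} \<times> {-n..n})"
      using q(2) by (intro image_eqI[of _ _ "(a, b, c, d)"]) auto
  qed
  then show ?thesis
    by (rule finite_subset) auto
qed

text \<open>The 24 units of the Hurwitz order: unit norm forces the coordinates of \<open>2
  q\<close> to be one \<open>\<plusminus>2\<close> and three zeros, or four
  \<open>\<plusminus>1\<close>.\<close>

definition binary_tetrahedral :: "quat set" where
  "binary_tetrahedral = {q. qnorm2 q = 1 \<and> integral_multiple (1 / 2) q}"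

definition binary_octahedral :: "quat set" where
  "binary_octahedral =
     binary_tetrahedral \<union> {q. qnorm2 q = 1 \<and> integral_multiple (1 / sqrt 2) q}"

lemma binary_tetrahedral_mult:
  assumes "p \<in> binary_tetrahedral" "q \<in> binary_tetrahedral"
  shows "p * q \<in> binary_tetrahedral"
  using integral_multiple_double[of "1 / 2 * (1 / 2)" "p * q" 2]
    integral_multiple_mult[of "1 / 2" p "1 / 2" q] assms
  by (simp add: binary_tetrahedral_def qnorm2_mult power2_eq_square)

lemma binary_octahedral_mult:
  assumes "p \<in> binary_octahedral" "q \<in> binary_octahedral"
  shows "p * q \<in> binary_octahedral"
proof -
  have norm: "qnorm2 p = 1" "qnorm2 q = 1" "qnorm2 (p * q) = 1"
    using assms by (auto simp: binary_octahedral_def binary_tetrahedral_def qnorm2_mult)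
  have mixed: "integral_multiple (1 / sqrt 2) (p * q)" if "integral_multiple (1 / (2 * sqrt 2)) (p * q)"
    using integral_multiple_double[OF that norm(3), of 1] by (simp add: power_divide power_mult_distrib)
  consider "p \<in> binary_tetrahedral" "q \<in> binary_tetrahedral"
    | "integral_multiple (1 / 2) p" "integral_multiple (1 / sqrt 2) q"
    | "integral_multiple (1 / sqrt 2) p" "integral_multiple (1 / 2) q"
    | "integral_multiple (1 / sqrt 2) p" "integral_multiple (1 / sqrt 2) q"
    using assms by (auto simp: binary_octahedral_def binary_tetrahedral_def)
  then show ?thesis
  proof cases
    case 1
    then show ?thesis
      by (simp add: binary_octahedral_def binary_tetrahedral_mult)
  next
    case 2
    then show ?thesis
      using mixed integral_multiple_mult[OF 2] norm by (simp add: binary_octahedral_def)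
  next
    case 3
    then show ?thesis
      using mixed integral_multiple_mult[OF 3] norm by (simp add: binary_octahedral_def mult.commute)
  next
    case 4
    then show ?thesis
      using integral_multiple_mult[OF 4] norm
      by (simp add: binary_octahedral_def binary_tetrahedral_def)
  qed
qed

lemma finite_binary_tetrahedral: "finite binary_tetrahedral"
  unfolding binary_tetrahedral_def by (rule finite_unit_integral_multiples) simp

lemma finite_binary_octahedral: "finite binary_octahedral"
  unfolding binary_octahedral_def using finite_binary_tetrahedral
  by (simp add: finite_unit_integral_multiples)

definition half_quat :: "int \<Rightarrow> int \<Rightarrow> int \<Rightarrow> int \<Rightarrow> quat" where
  "half_quat a b c d = Quat (of_int a / 2) (of_int b / 2) (of_int c / 2) (of_int d / 2)"

lemma binary_tetrahedral_eq:
  "binary_tetrahedral = {half_quat a b c d |a b c d. a\<^sup>2 + b\<^sup>2 + c\<^sup>2 + d\<^sup>2 = 4}"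
proof -
  have "qnorm2 (half_quat a b c d) = 1 \<longleftrightarrow> a\<^sup>2 + b\<^sup>2 + c\<^sup>2 + d\<^sup>2 = 4" for a b c d
  proof -
    have "qnorm2 (half_quat a b c d) = of_int (a\<^sup>2 + b\<^sup>2 + c\<^sup>2 + d\<^sup>2) / 4"
      by (simp add: qnorm2_def half_quat_def power_divide add_divide_distrib)
    also have "\<dots> = 1 \<longleftrightarrow> a\<^sup>2 + b\<^sup>2 + c\<^sup>2 + d\<^sup>2 = 4"
      by (simp del: of_int_add of_int_power)
    finally show ?thesis .
  qed
  then show ?thesis
    by (auto simp: binary_tetrahedral_def integral_multiple_def half_quat_def)
qed

lemma four_squares_eq_4:
  fixes a b c d :: int
  assumes "a\<^sup>2 + b\<^sup>2 + c\<^sup>2 + d\<^sup>2 = 4"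
  shows "(a, b, c, d) \<in> {-1, 1} \<times> {-1, 1} \<times> {-1, 1} \<times> {-1, 1} \<union>
    {(2,0,0,0), (-2,0,0,0), (0,2,0,0), (0,-2,0,0), (0,0,2,0), (0,0,-2,0), (0,0,0,2), (0,0,0,-2)}"
proof -
  have bound: "x = -2 \<or> x = -1 \<or> x = 0 \<or> x = 1 \<or> x = 2" if "x\<^sup>2 \<le> 4" for x :: int
  proof -
    have "\<bar>x\<bar> \<le> 2"
      using that power2_le_iff_abs_le[of 2 x] by simp
    then show ?thesis by auto
  qed
  have "a\<^sup>2 \<le> 4" "b\<^sup>2 \<le> 4" "c\<^sup>2 \<le> 4" "d\<^sup>2 \<le> 4"
    using assms zero_le_power2[of a] zero_le_power2[of b] zero_le_power2[of c] zero_le_power2[of d]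
    by linarith+
  from this[THEN bound] assms show ?thesis
    by (elim disjE) simp_all
qed

text \<open>All icosahedral coordinates lie in \<open>\<int>[\<tau>] / 2\<close>, and this
  relation is what reduces products of them to normal form.\<close>

lemma gold_sq: "gold_tau * gold_tau = gold_tau + 1"
  by (simp add: gold_tau_def field_simps)

definition quat_eta :: quat where
  "quat_eta = Quat (gold_tau / 2) (- gold_sigma / 2) 0 (1 / 2)"

lemma quat_eta_powers:
  "quat_eta ^ 2 = Quat (- gold_sigma / 2) (1 / 2) 0 (gold_tau / 2)"
  "quat_eta ^ 3 = Quat (gold_sigma / 2) (1 / 2) 0 (gold_tau / 2)"
  "quat_eta ^ 4 = Quat (- gold_tau / 2) (- gold_sigma / 2) 0 (1 / 2)"
  "quat_eta ^ 5 = - 1"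
proof -
  show 2: "quat_eta ^ 2 = Quat (- gold_sigma / 2) (1 / 2) 0 (gold_tau / 2)"
    by (simp add: quat_eta_def power2_eq_square quat_eq_iff gold_sigma_def gold_sq field_simps)
  have *: "quat_eta ^ 3 = quat_eta ^ 2 * quat_eta"
    by (simp add: eval_nat_numeral mult.assoc)
  show 3: "quat_eta ^ 3 = Quat (gold_sigma / 2) (1 / 2) 0 (gold_tau / 2)"
    unfolding * 2 by (simp add: quat_eta_def quat_eq_iff gold_sigma_def gold_sq field_simps)
  have *: "quat_eta ^ 4 = quat_eta ^ 3 * quat_eta"
    by (simp add: eval_nat_numeral mult.assoc)
  show 4: "quat_eta ^ 4 = Quat (- gold_tau / 2) (- gold_sigma / 2) 0 (1 / 2)"
    unfolding * 3 by (simp add: quat_eta_def quat_eq_iff gold_sigma_def gold_sq field_simps)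
  have *: "quat_eta ^ 5 = quat_eta ^ 4 * quat_eta"
    by (simp add: eval_nat_numeral mult.assoc)
  show "quat_eta ^ 5 = - 1"
    unfolding * 4 by (simp add: quat_eta_def quat_eq_iff gold_sigma_def gold_sq field_simps)
qed

text \<open>The factorisation of the alternating group \<open>A\<^sub>5\<close> into the
  subgroups \<open>A\<^sub>4\<close> and \<open>C\<^sub>5\<close>, lifted to quaternions:
  \<open>quat_eta\<close> has order ten and \<open>quat_eta\<^sup>5 = -1\<close>.\<close>

definition binary_icosahedral :: "quat set" where
  "binary_icosahedral = {t * quat_eta ^ k |t k. t \<in> binary_tetrahedral}"

lemma binary_icosahedralI:
  assumes "t \<in> binary_tetrahedral" "q = t * quat_eta ^ k"
  shows "q \<in> binary_icosahedral"
  using assms by (auto simp: binary_icosahedral_def)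

text \<open>One entry for each pair \<open>\<plusminus>t\<close> of elements of the binary
  tetrahedral group: the coset of \<open>quat_eta t\<close> and its representative. With it,
  left multiplication by \<open>quat_eta\<close> preserves the product set.\<close>

lemma eta_mult_table:
  shows "quat_eta * half_quat 2 0 0 0 = half_quat 2 0 0 0 * quat_eta ^ 1"
  "quat_eta * half_quat 1 1 1 1 = half_quat 1 (-1) (-1) (-1) * quat_eta ^ 4"
  "quat_eta * half_quat 1 1 (-1) 1 = half_quat 1 (-1) 1 (-1) * quat_eta ^ 4"
  "quat_eta * half_quat 0 2 0 0 = half_quat 1 (-1) 1 1 * quat_eta ^ 3"
  "quat_eta * half_quat 0 0 0 2 = half_quat 1 1 (-1) 1 * quat_eta ^ 2"
  "quat_eta * half_quat 0 0 2 0 = half_quat 0 0 (-2) 0 * quat_eta ^ 4"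
  "quat_eta * half_quat 1 (-1) (-1) (-1) = half_quat 0 0 0 (-2) * quat_eta ^ 2"
  "quat_eta * half_quat 1 (-1) 1 (-1) = half_quat (-1) (-1) (-1) (-1) * quat_eta ^ 3"
  "quat_eta * half_quat 1 1 (-1) (-1) = half_quat 1 1 1 (-1) * quat_eta ^ 1"
  "quat_eta * half_quat 1 (-1) (-1) 1 = half_quat 1 1 (-1) (-1) * quat_eta ^ 2"
  "quat_eta * half_quat 1 1 1 (-1) = half_quat 0 (-2) 0 0 * quat_eta ^ 3"
  "quat_eta * half_quat 1 (-1) 1 1 = half_quat 1 (-1) (-1) 1 * quat_eta ^ 1"
  unfolding half_quat_def quat_eta_powers power_one_right
  by (simp_all add: quat_eta_def quat_eq_iff gold_sigma_def gold_sq field_simps)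

lemma eta_mult_tetrahedral:
  assumes "t \<in> binary_tetrahedral"
  shows "quat_eta * t \<in> binary_icosahedral"
proof -
  have *: "quat_eta * half_quat a b c d \<in> binary_icosahedral \<and>
      quat_eta * half_quat (- a) (- b) (- c) (- d) \<in> binary_icosahedral"
    if "quat_eta * half_quat a b c d = half_quat a' b' c' d' * quat_eta ^ k"
      "a'\<^sup>2 + b'\<^sup>2 + c'\<^sup>2 + d'\<^sup>2 = 4" for a b c d a' b' c' d' k
  proof
    show "quat_eta * half_quat a b c d \<in> binary_icosahedral"
      using that by (intro binary_icosahedralI) (auto simp: binary_tetrahedral_eq)
    have minus: "half_quat (- a) (- b) (- c) (- d) = - half_quat a b c d" for a b c d
      by (simp add: half_quat_def quat_eq_iff)
    have "half_quat (- a') (- b') (- c') (- d') \<in> binary_tetrahedral"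
      using that(2) unfolding binary_tetrahedral_eq
      by (intro CollectI exI[of _ "- a'"] exI[of _ "- b'"] exI[of _ "- c'"] exI[of _ "- d'"]) simp
    then show "quat_eta * half_quat (- a) (- b) (- c) (- d) \<in> binary_icosahedral"
      using that(1) by (intro binary_icosahedralI) (auto simp: minus)
  qed
  obtain a b c d where t: "t = half_quat a b c d" "a\<^sup>2 + b\<^sup>2 + c\<^sup>2 + d\<^sup>2 = 4"
    using assms by (auto simp: binary_tetrahedral_eq)
  show ?thesis
    using four_squares_eq_4[OF t(2)] eta_mult_table[THEN *] unfolding t(1) by auto
qed

lemma binary_icosahedral_mult:
  assumes "p \<in> binary_icosahedral" "q \<in> binary_icosahedral"
  shows "p * q \<in> binary_icosahedral"
proof -
  have t: "t * q \<in> binary_icosahedral" if "t \<in> binary_tetrahedral" "q \<in> binary_icosahedral" for t q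
    using that binary_tetrahedral_mult[OF that(1)]
    by (auto simp: binary_icosahedral_def mult.assoc[symmetric]) blast
  have eta: "quat_eta * q \<in> binary_icosahedral" if q: "q \<in> binary_icosahedral" for q
  proof -
    obtain t k where q: "q = t * quat_eta ^ k" "t \<in> binary_tetrahedral"
      using q by (auto simp: binary_icosahedral_def)
    obtain s l where "quat_eta * t = s * quat_eta ^ l" "s \<in> binary_tetrahedral"
      using eta_mult_tetrahedral[OF q(2)] by (auto simp: binary_icosahedral_def)
    then have "quat_eta * q = s * quat_eta ^ (l + k)" "s \<in> binary_tetrahedral"
      unfolding q power_add by (simp_all flip: mult.assoc)
    then show ?thesis
      by (auto simp: binary_icosahedral_def)
  qed
  obtain s k where p: "p = s * quat_eta ^ k" "s \<in> binary_tetrahedral"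
    using assms(1) by (auto simp: binary_icosahedral_def)
  have "quat_eta ^ k * q \<in> binary_icosahedral"
    by (induction k) (simp_all add: assms(2) eta mult.assoc)
  then show ?thesis
    using t[OF p(2)] by (simp add: p(1) mult.assoc)
qed

lemma finite_binary_icosahedral: "finite binary_icosahedral"
proof -
  have "quat_eta ^ 10 = (quat_eta ^ 5)\<^sup>2"
    by (simp flip: power_mult)
  then have "quat_eta ^ 10 = 1"
    by (simp add: quat_eta_powers)
  then have mod: "quat_eta ^ k = quat_eta ^ (k mod 10)" for k
    using power_add[of quat_eta "10 * (k div 10)" "k mod 10"] by (simp add: power_mult)
  have "binary_icosahedral \<subseteq> (\<lambda>(t, k). t * quat_eta ^ k) ` (binary_tetrahedral \<times> {..<10})"
  proof
    fix q assume "q \<in> binary_icosahedral"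
    then obtain t k where "t \<in> binary_tetrahedral" "q = t * quat_eta ^ (k mod 10)"
      using mod by (auto simp: binary_icosahedral_def)
    then show "q \<in> (\<lambda>(t, k). t * quat_eta ^ k) ` (binary_tetrahedral \<times> {..<10})"
      by (intro image_eqI[of _ _ "(t, k mod 10)"]) auto
  qed
  then show ?thesis
    by (rule finite_subset) (simp add: finite_binary_tetrahedral)
qed


section \<open>The Shephard--Todd groups are primitive complex reflection groups\<close>

text \<open>For \<open>x = \<pi> / 5\<close> the identity \<open>3 x = \<pi> - 2 x\<close> gives
  a cubic equation for \<open>cos x\<close> with the root \<open>-1\<close>; the positive root
  of the remaining quadratic is \<open>\<tau> / 2\<close>.\<close>

lemma cos_pi_5: "cos (pi / 5) = gold_tau / 2"
proof -
  define t where "t = cos (pi / 5)"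
  define x where "x = pi / 5"
  have angle: "3 * x = pi - 2 * x"
    by (simp add: x_def)
  have "cos (3 * x) = - cos (2 * x)"
    unfolding angle by simp
  then have "4 * t ^ 3 - 3 * t = - (2 * t\<^sup>2 - 1)"
    unfolding cos_treble_cos cos_double_cos by (simp add: t_def x_def)
  then have "(t + 1) * (4 * t\<^sup>2 - 2 * t - 1) = 0"
    by (simp add: algebra_simps power2_eq_square power3_eq_cube)
  moreover have "t > 0"
    unfolding t_def by (rule cos_gt_zero) simp_all
  ultimately have "4 * t\<^sup>2 - 2 * t - 1 = 0"
    by simp
  then have "(4 * t - 1)\<^sup>2 = 5"
    by (simp add: algebra_simps power2_eq_square)
  then have "\<bar>4 * t - 1\<bar> = sqrt 5"
    by (metis real_sqrt_abs)
  moreover have "sqrt 5 > 1"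
    by simp
  ultimately have "4 * t - 1 = sqrt 5"
    using \<open>t > 0\<close> by linarith
  then show ?thesis
    by (simp add: t_def gold_tau_def field_simps)
qed

text \<open>The second conjunct says that the trace is one more than the determinant, so that
  \<open>1\<close> is an eigenvalue. The scalars of the generators have the orders 4, 6, 8 and
  10, whence the exponent 120.\<close>

definition reflection_data :: "complex \<Rightarrow> quat \<Rightarrow> bool" where
  "reflection_data c q \<longleftrightarrow> qnorm2 q = 1 \<and> 2 * c * of_real (qre q) = 1 + c\<^sup>2 \<and> \<bar>qre q\<bar> < 1 \<and> c ^ 120 = 1"

lemma reflection_data_order_two:
  assumes "qnorm2 q = 1" "qre q = 0"
  shows "reflection_data \<i> q"
proof -
  have "\<i> ^ 120 = (\<i>\<^sup>2) ^ 60"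
    by (simp flip: power_mult)
  then show ?thesis
    using assms by (simp add: reflection_data_def)
qed

lemma reflection_data_cis:
  assumes "m \<in> {3, 4, 5}" "qnorm2 q = 1" "qre q = cos (pi / real m)"
  shows "reflection_data (cis (pi / real m)) q" "qre q > 0"
proof -
  have angle: "0 < pi / real m" "pi / real m < pi / 2"
    using assms(1) by (auto simp: field_simps)
  have "pi / real m \<le> pi"
    using angle(2) pi_gt_zero by linarith
  then have cos: "0 < cos (pi / real m)" "cos (pi / real m) < 1"
    using cos_gt_zero[OF angle] cos_monotone_0_pi[OF order_refl angle(1)] by simp_all
  have turns: "real 120 * (pi / real m) = 2 * pi * of_nat (60 div m)"
    using assms(1) by auto
  have "cis (pi / real m) ^ 120 = 1"
    unfolding Complex.DeMoivre turns by (rule cis_multiple_2pi) simp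
  moreover have "2 * cis (pi / real m) * of_real (cos (pi / real m)) = 1 + (cis (pi / real m))\<^sup>2"
    using sin_cos_squared_add[of "pi / real m"]
    by (auto simp: complex_eq_iff power2_eq_square algebra_simps)
  ultimately show "reflection_data (cis (pi / real m)) q" "qre q > 0"
    using assms(2,3) cos by (simp_all add: reflection_data_def)
qed

definition reflection_over :: "quat set \<Rightarrow> complex^2^2 \<Rightarrow> bool" where
  "reflection_over \<Gamma> g \<longleftrightarrow> (\<exists>c q. g = scaled_su2 c q \<and> reflection_data c q \<and> q \<in> \<Gamma>)"

text \<open>Left multiplication by a generator is injective on \<open>W\<close>, hence a
  permutation of the finite set \<open>W\<close>, so that inverses of generators preserve
  \<open>W\<close> too.\<close>

lemma generate_GL_subset_left_closed:
  fixes W :: "('a::semiring_1^'n^'n) set"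
  assumes X: "X \<subseteq> carrier GL" and W: "finite W" "W \<subseteq> carrier GL" "mat 1 \<in> W"
    and closed: "\<And>x w. x \<in> X \<Longrightarrow> w \<in> W \<Longrightarrow> x ** w \<in> W"
  shows "generate GL X \<subseteq> W"
proof
  interpret group "GL :: ('a^'n^'n) monoid"
    by (rule group_GL)
  fix g assume "g \<in> generate GL X"
  then have "\<forall>w\<in>W. g \<otimes>\<^bsub>GL\<^esub> w \<in> W"
  proof induction
    case one
    then show ?case by (simp add: GL_sel)
  next
    case (incl x)
    then show ?case by (simp add: closed GL_sel)
  next
    case (inv x)
    have "inj_on (\<lambda>w. x \<otimes>\<^bsub>GL\<^esub> w) W"
    proof (rule inj_onI)
      fix v w assume "v \<in> W" "w \<in> W" "x \<otimes>\<^bsub>GL\<^esub> v = x \<otimes>\<^bsub>GL\<^esub> w"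
      moreover from this have "v \<in> carrier GL" "w \<in> carrier GL" "x \<in> Units GL"
        using inv X W(2) by auto
      ultimately show "v = w"
        by simp
    qed
    moreover have "(\<lambda>w. x \<otimes>\<^bsub>GL\<^esub> w) ` W \<subseteq> W"
      using closed[OF inv] by (auto simp: GL_sel)
    ultimately have onto: "(\<lambda>w. x \<otimes>\<^bsub>GL\<^esub> w) ` W = W"
      using W(1) by (simp add: endo_inj_surj)
    show ?case
    proof
      fix w assume "w \<in> W"
      then obtain v where v: "v \<in> W" "w = x \<otimes>\<^bsub>GL\<^esub> v"
        using onto by blast
      moreover from v(1) have "v \<in> carrier GL" "x \<in> carrier GL"
        using inv X W(2) by auto
      ultimately have "inv\<^bsub>GL\<^esub> x \<otimes>\<^bsub>GL\<^esub> w = v"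
        by (simp flip: m_assoc)
      with v show "inv\<^bsub>GL\<^esub> x \<otimes>\<^bsub>GL\<^esub> w \<in> W" by simp
    qed
  next
    case (eng g h)
    show ?case
    proof
      fix w assume w: "w \<in> W"
      have "g \<in> carrier GL" "h \<in> carrier GL" "w \<in> carrier GL"
        using generate_in_carrier[OF X] eng.hyps w W(2) by auto
      then have "g \<otimes>\<^bsub>GL\<^esub> h \<otimes>\<^bsub>GL\<^esub> w = g \<otimes>\<^bsub>GL\<^esub> (h \<otimes>\<^bsub>GL\<^esub> w)"
        by (rule m_assoc)
      then show "g \<otimes>\<^bsub>GL\<^esub> h \<otimes>\<^bsub>GL\<^esub> w \<in> W"
        using eng.IH w by simp
    qed
  qed
  then have "g \<otimes>\<^bsub>GL\<^esub> mat 1 \<in> W"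
    using W(3) by blast
  then show "g \<in> W"
    by (simp add: GL_sel)
qed

lemma reflection_over_imp:
  assumes "reflection_over \<Gamma> g"
  shows "g \<in> carrier GL" "complex_reflection g"
  using assms scaled_su2_complex_reflection
  by (auto simp: reflection_over_def reflection_data_def GL_sel complex_reflection_def)

text \<open>Multiplying the scalars and the quaternions separately confines the group to
  finitely many products of a 120th root of unity and an element of
  \<open>\<Gamma>\<close>.\<close>

lemma finite_reflection_group:
  assumes gens: "\<And>g. g \<in> X \<Longrightarrow> reflection_over \<Gamma> g"
    and \<Gamma>: "finite \<Gamma>" "1 \<in> \<Gamma>" "\<And>q. q \<in> \<Gamma> \<Longrightarrow> qnorm2 q = 1"
      "\<And>p q. p \<in> \<Gamma> \<Longrightarrow> q \<in> \<Gamma> \<Longrightarrow> p * q \<in> \<Gamma>"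
  shows "finite (generate GL X)"
proof -
  let ?W = "(\<lambda>(c, q). scaled_su2 c q) ` ({c. c ^ 120 = 1} \<times> \<Gamma>)"
  have W: "finite ?W"
    using \<Gamma>(1) finite_nth_roots[of 120 1]
    by (intro finite_imageI finite_cartesian_product) simp_all
  have "generate GL X \<subseteq> ?W"
  proof (rule generate_GL_subset_left_closed)
    show "X \<subseteq> carrier GL"
      using gens reflection_over_imp(1) by blast
    show "?W \<subseteq> carrier GL"
    proof
      fix w assume "w \<in> ?W"
      then obtain c q where "w = scaled_su2 c q" "c ^ 120 = 1" "q \<in> \<Gamma>"
        by auto
      moreover from this have "c \<noteq> 0"
        by auto
      ultimately show "w \<in> carrier GL"
        using scaled_su2_inverse(1) \<Gamma>(3) by (simp add: GL_sel)
    qed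
    show "mat 1 \<in> ?W"
      using \<Gamma>(2) by (force simp flip: scaled_su2_one)
    fix g w assume "g \<in> X" "w \<in> ?W"
    then obtain c q d r where "g = scaled_su2 c q" "c ^ 120 = 1" "q \<in> \<Gamma>"
      "w = scaled_su2 d r" "d ^ 120 = 1" "r \<in> \<Gamma>"
      using gens[of g] by (auto simp: reflection_over_def reflection_data_def)
    then have "g ** w = scaled_su2 (c * d) (q * r)" "(c * d) ^ 120 = 1" "q * r \<in> \<Gamma>"
      using \<Gamma>(4) by (auto simp: scaled_su2_mult power_mult_distrib)
    then show "g ** w \<in> ?W"
      by force
  qed (rule W)
  then show ?thesis
    using W finite_subset by blast
qed

lemma primitive_complex_reflection_group_generate:
  assumes gens: "\<And>g. g \<in> X \<Longrightarrow> reflection_over \<Gamma> g"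
    and \<Gamma>: "\<Gamma> = binary_octahedral \<or> \<Gamma> = binary_icosahedral"
    and h: "projectively_contains (generate GL X) quat_h" "projectively_contains (generate GL X) quat_h'"
  shows "primitive_complex_reflection_group (generate GL X)"
proof -
  interpret group "GL :: (complex^2^2) monoid"
    by (rule group_GL)
  let ?G = "generate GL X"
  have X: "X \<subseteq> carrier GL"
    using gens reflection_over_imp(1) by blast
  have G: "subgroup ?G GL"
    by (rule generate_is_subgroup[OF X])
  have "finite ?G"
    using gens
  proof (rule finite_reflection_group)
    show "finite \<Gamma>"
      using \<Gamma> finite_binary_octahedral finite_binary_icosahedral by auto
    have one: "1 = half_quat 2 0 0 0"
      by (simp add: half_quat_def quat_eq_iff)
    have "1 \<in> binary_tetrahedral"
      unfolding one binary_tetrahedral_eq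
      by (intro CollectI exI[of _ 2] exI[of _ 0]) simp
    then show "1 \<in> \<Gamma>"
      using \<Gamma> binary_icosahedralI[of 1 1 0] by (auto simp: binary_octahedral_def)
    have "qnorm2 quat_eta = 1"
      by (simp add: quat_eta_def qnorm2_def gold_sigma_def power2_eq_square gold_sq field_simps)
    moreover have "qnorm2 (q ^ k) = qnorm2 q ^ k" for q k
      by (induction k) (simp_all add: qnorm2_mult, simp add: qnorm2_def)
    ultimately show "qnorm2 q = 1" if "q \<in> \<Gamma>" for q
      using \<Gamma> that by (auto simp: binary_octahedral_def binary_icosahedral_def binary_tetrahedral_def qnorm2_mult)
    show "p * q \<in> \<Gamma>" if "p \<in> \<Gamma>" "q \<in> \<Gamma>" for p q
      using \<Gamma> that binary_octahedral_mult binary_icosahedral_mult by auto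
  qed
  moreover have "?G = generate GL {g \<in> ?G. complex_reflection g}"
  proof
    show "?G \<subseteq> generate GL {g \<in> ?G. complex_reflection g}"
      using gens reflection_over_imp(2) generate.incl by (intro mono_generate) fast
    show "generate GL {g \<in> ?G. complex_reflection g} \<subseteq> ?G"
      using G by (intro generate_subgroup_incl) auto
  qed
  ultimately show ?thesis
    unfolding primitive_complex_reflection_group_def
    using G tetrahedral_irreducible[OF h] tetrahedral_primitive[OF h] by blast
qed

lemma in_binary_octahedralI:
  "q = half_quat a b c d \<Longrightarrow> a\<^sup>2 + b\<^sup>2 + c\<^sup>2 + d\<^sup>2 = 4 \<Longrightarrow> q \<in> binary_octahedral"
  by (auto simp: binary_octahedral_def binary_tetrahedral_eq)

lemma in_binary_octahedralI':
  assumes "q = Quat (1 / sqrt 2 * of_int a) (1 / sqrt 2 * of_int b) (1 / sqrt 2 * of_int c) (1 / sqrt 2 * of_int d)"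
    "qnorm2 q = 1"
  shows "q \<in> binary_octahedral"
  using assms unfolding binary_octahedral_def integral_multiple_def by blast

lemma in_binary_icosahedralI:
  assumes "q = half_quat a b c d * quat_eta ^ k" "a\<^sup>2 + b\<^sup>2 + c\<^sup>2 + d\<^sup>2 = 4"
  shows "q \<in> binary_icosahedral"
  using assms(2) by (intro binary_icosahedralI[OF _ assms(1)]) (auto simp: binary_tetrahedral_eq)

lemma reflection_over_order_two:
  "qnorm2 q = 1 \<Longrightarrow> qre q = 0 \<Longrightarrow> q \<in> \<Gamma> \<Longrightarrow> reflection_over \<Gamma> (scaled_su2 \<i> q)"
  unfolding reflection_over_def using reflection_data_order_two by blast

lemma reflection_over_cis:
  "m \<in> {3, 4, 5} \<Longrightarrow> qnorm2 q = 1 \<Longrightarrow> qre q = cos (pi / real m) \<Longrightarrow> q \<in> \<Gamma> \<Longrightarrow>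
    reflection_over \<Gamma> (refl_of_order m q)"
  unfolding reflection_over_def refl_of_order_def using reflection_data_cis(1) by blast

lemmas quat_word_simps = quat_eq_iff gold_sigma_def gold_sq field_simps

lemma reflection_over_binary_octahedral:
  "reflection_over binary_octahedral refl_F1"
  "reflection_over binary_octahedral refl_F2"
  "reflection_over binary_octahedral refl_F3"
  "reflection_over binary_octahedral refl_A1"
  "reflection_over binary_octahedral refl_R1"
  "reflection_over binary_octahedral refl_R2"
  "reflection_over binary_octahedral refl_R3"
  "reflection_over binary_octahedral refl_P1"
  "reflection_over binary_octahedral refl_P2"
proof -
  note [simp] = qnorm2_def power_divide
  note two = reflection_over_order_two and more = reflection_over_cis
  show "reflection_over binary_octahedral refl_F1"
    unfolding order_two_generators_eq_scaled_su2
    by (rule two[OF _ _ in_binary_octahedralI'[of _ 0 "- 1" 0 "- 1"]]) simp_all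
  show "reflection_over binary_octahedral refl_F2"
    unfolding order_two_generators_eq_scaled_su2
    by (rule two[OF _ _ in_binary_octahedralI'[of _ 0 "- 1" 1 0]]) simp_all
  show "reflection_over binary_octahedral refl_F3"
    unfolding order_two_generators_eq_scaled_su2
    by (rule two[OF _ _ in_binary_octahedralI'[of _ 0 0 1 "- 1"]]) simp_all
  show "reflection_over binary_octahedral refl_A1"
    unfolding order_two_generators_eq_scaled_su2
    by (rule two[OF _ _ in_binary_octahedralI[of _ 0 "- 2" 0 0]]) (simp_all add: half_quat_def)
  show "reflection_over binary_octahedral refl_R1"
    unfolding refl_R1_def
    by (rule more[OF _ _ _ in_binary_octahedralI[of _ 1 1 1 1]]) (simp_all add: half_quat_def cos_60)
  show "reflection_over binary_octahedral refl_R2"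
    unfolding refl_R2_def
    by (rule more[OF _ _ _ in_binary_octahedralI[of _ 1 1 "- 1" 1]]) (simp_all add: half_quat_def cos_60)
  show "reflection_over binary_octahedral refl_R3"
    unfolding refl_R3_def
    by (rule more[OF _ _ _ in_binary_octahedralI[of _ 1 1 "- 1" "- 1"]]) (simp_all add: half_quat_def cos_60)
  show "reflection_over binary_octahedral refl_P1"
    unfolding refl_P1_def
    by (rule more[OF _ _ _ in_binary_octahedralI'[of _ 1 1 0 0]]) (simp_all add: cos_45 real_div_sqrt field_simps)
  show "reflection_over binary_octahedral refl_P2"
    unfolding refl_P2_def
    by (rule more[OF _ _ _ in_binary_octahedralI'[of _ 1 0 1 0]]) (simp_all add: cos_45 real_div_sqrt field_simps)
qed

lemma reflection_over_binary_icosahedral: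
  "reflection_over binary_icosahedral refl_A1"
  "reflection_over binary_icosahedral refl_A2"
  "reflection_over binary_icosahedral refl_A3"
  "reflection_over binary_icosahedral refl_B"
  "reflection_over binary_icosahedral refl_R1"
  "reflection_over binary_icosahedral refl_R4"
  "reflection_over binary_icosahedral refl_Q1"
  "reflection_over binary_icosahedral refl_Q2"
proof -
  note eval = half_quat_def quat_word_simps qnorm2_def power2_eq_square
  note two = reflection_over_order_two and more = reflection_over_cis
  show "reflection_over binary_icosahedral refl_A1"
    unfolding order_two_generators_eq_scaled_su2
    by (rule two[OF _ _ in_binary_icosahedralI[of _ 0 "- 2" 0 0 0]]) (simp_all add: eval)
  show "reflection_over binary_icosahedral refl_A2"
    unfolding order_two_generators_eq_scaled_su2
    by (rule two[OF _ _ in_binary_icosahedralI[of _ 0 0 2 0 0]]) (simp_all add: eval)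
  show "reflection_over binary_icosahedral refl_A3"
    unfolding order_two_generators_eq_scaled_su2
    by (rule two[OF _ _ in_binary_icosahedralI[of _ 0 0 "- 2" 0 3]], unfold quat_eta_powers) (simp_all add: eval)
  show "reflection_over binary_icosahedral refl_B"
    unfolding order_two_generators_eq_scaled_su2
    by (rule two[OF _ _ in_binary_icosahedralI[of _ "- 1" "- 1" "- 1" "- 1" 1]]) (simp_all add: eval quat_eta_def)
  show "reflection_over binary_icosahedral refl_R1"
    unfolding refl_R1_def
    by (rule more[OF _ _ _ in_binary_icosahedralI[of _ 1 1 1 1 0]]) (simp_all add: eval cos_60)
  show "reflection_over binary_icosahedral refl_R4"
    unfolding refl_R4_def
    by (rule more[OF _ _ _ in_binary_icosahedralI[of _ 1 "- 1" "- 1" "- 1" 3]], unfold quat_eta_powers)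
       (simp_all add: eval cos_60)
  show "reflection_over binary_icosahedral refl_Q1"
    unfolding refl_Q1_def
    by (rule more[OF _ _ _ in_binary_icosahedralI[of _ 2 0 0 0 1]]) (simp_all add: eval quat_eta_def cos_pi_5)
  show "reflection_over binary_icosahedral refl_Q2"
    unfolding refl_Q2_def
    by (rule more[OF _ _ _ in_binary_icosahedralI[of _ "- 1" "- 1" "- 1" "- 1" 4]], unfold quat_eta_powers)
       (simp_all add: eval cos_pi_5)
qed

lemma projectively_contains_mult_eq:
  assumes "projectively_contains (generate GL X) p" "projectively_contains (generate GL X) q" "p * q = r"
  shows "projectively_contains (generate GL X) r"
  using projectively_contains_mult[OF assms(1,2)] assms(3) by simp

lemma projectively_contains_mult_eq_minus:
  assumes "projectively_contains (generate GL X) p" "projectively_contains (generate GL X) q" "p * q = - r"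
  shows "projectively_contains (generate GL X) r"
  using projectively_contains_uminus[OF projectively_contains_mult[OF assms(1,2)]] assms(3) by simp

lemma projectively_contains_generator:
  assumes "scaled_su2 c q \<in> X" "c \<noteq> 0"
  shows "projectively_contains (generate GL X) q"
  unfolding projectively_contains_def
  by (intro exI[of _ c] conjI generate.incl assms)

lemma projectively_contains_order_two:
  shows projectively_contains_F1:
      "refl_F1 \<in> X \<Longrightarrow> projectively_contains (generate GL X) (Quat 0 (- 1 / sqrt 2) 0 (- 1 / sqrt 2))"
    and projectively_contains_F2:
      "refl_F2 \<in> X \<Longrightarrow> projectively_contains (generate GL X) (Quat 0 (- 1 / sqrt 2) (1 / sqrt 2) 0)"
    and projectively_contains_F3:
      "refl_F3 \<in> X \<Longrightarrow> projectively_contains (generate GL X) (Quat 0 0 (1 / sqrt 2) (- 1 / sqrt 2))"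
    and projectively_contains_A1:
      "refl_A1 \<in> X \<Longrightarrow> projectively_contains (generate GL X) (Quat 0 (- 1) 0 0)"
    and projectively_contains_A2:
      "refl_A2 \<in> X \<Longrightarrow> projectively_contains (generate GL X) (Quat 0 0 1 0)"
    and projectively_contains_A3:
      "refl_A3 \<in> X \<Longrightarrow> projectively_contains (generate GL X)
      (Quat 0 (- gold_tau / 2) (- gold_sigma / 2) (1 / 2))"
    and projectively_contains_B:
      "refl_B \<in> X \<Longrightarrow> projectively_contains (generate GL X)
      (Quat 0 (- gold_tau / 2) (gold_sigma / 2) (- 1 / 2))"
  unfolding order_two_generators_eq_scaled_su2 by (erule projectively_contains_generator, simp)+

lemma projectively_contains_higher_order:
  shows projectively_contains_R1:
      "refl_R1 \<in> X \<Longrightarrow> projectively_contains (generate GL X) (Quat (1/2) (1/2) (1/2) (1/2))"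
    and projectively_contains_R2:
      "refl_R2 \<in> X \<Longrightarrow> projectively_contains (generate GL X) (Quat (1/2) (1/2) (-1/2) (1/2))"
    and projectively_contains_R3:
      "refl_R3 \<in> X \<Longrightarrow> projectively_contains (generate GL X) (Quat (1/2) (1/2) (-1/2) (-1/2))"
    and projectively_contains_R4:
      "refl_R4 \<in> X \<Longrightarrow> projectively_contains (generate GL X)
      (Quat (1/2) 0 (- gold_sigma / 2) (gold_tau / 2))"
    and projectively_contains_P1:
      "refl_P1 \<in> X \<Longrightarrow> projectively_contains (generate GL X) (Quat (1 / sqrt 2) (1 / sqrt 2) 0 0)"
    and projectively_contains_P2:
      "refl_P2 \<in> X \<Longrightarrow> projectively_contains (generate GL X) (Quat (1 / sqrt 2) 0 (1 / sqrt 2) 0)"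
    and projectively_contains_Q1:
      "refl_Q1 \<in> X \<Longrightarrow> projectively_contains (generate GL X)
      (Quat (gold_tau / 2) (- gold_sigma / 2) 0 (1/2))"
    and projectively_contains_Q2:
      "refl_Q2 \<in> X \<Longrightarrow> projectively_contains (generate GL X)
      (Quat (gold_tau / 2) 0 (1/2) (- gold_sigma / 2))"
  unfolding higher_order_generators_eq_scaled_su2 refl_of_order_def
  by (erule projectively_contains_generator, simp)+

text \<open>The following lemmas exhibit words in the generators, up to scalars, for
  \<open>quat_h\<close> and \<open>quat_h'\<close>. Such words exist because every projective
  image is a tetrahedral, octahedral or icosahedral group that contains the image of this
  particular binary tetrahedral group.\<close>

lemma tetrahedral_in_R1_R3:
  assumes "refl_R1 \<in> X" "refl_R3 \<in> X"
  shows "projectively_contains (generate GL X) quat_h"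
    "projectively_contains (generate GL X) quat_h'"
proof -
  note mult = projectively_contains_mult_eq[where X = X]
    and mult_minus = projectively_contains_mult_eq_minus[where X = X]
  note R1 = projectively_contains_R1[OF assms(1)]
  note R3 = projectively_contains_R3[OF assms(2)]
  show "projectively_contains (generate GL X) quat_h"
    using R1 by simp
  show "projectively_contains (generate GL X) quat_h'"
    by (rule mult[OF R3 R1]) (simp add: quat_word_simps)
qed

lemma tetrahedral_in_A1_R1:
  assumes "refl_A1 \<in> X" "refl_R1 \<in> X"
  shows "projectively_contains (generate GL X) quat_h"
    "projectively_contains (generate GL X) quat_h'"
proof -
  note mult = projectively_contains_mult_eq[where X = X]
    and mult_minus = projectively_contains_mult_eq_minus[where X = X]
  note A1 = projectively_contains_A1[OF assms(1)]
  note R1 = projectively_contains_R1[OF assms(2)]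
  show "projectively_contains (generate GL X) quat_h"
    using R1 by simp
  have w1: "projectively_contains (generate GL X) (Quat (- 1 / 2) (1 / 2) (1 / 2) (1 / 2))"
    by (rule mult[OF R1 R1]) (simp add: quat_word_simps)
  show "projectively_contains (generate GL X) quat_h'"
    by (rule mult[OF w1 A1]) (simp add: quat_word_simps)
qed

lemma tetrahedral_in_P1_P2:
  assumes "refl_P1 \<in> X" "refl_P2 \<in> X"
  shows "projectively_contains (generate GL X) quat_h"
    "projectively_contains (generate GL X) quat_h'"
proof -
  note mult = projectively_contains_mult_eq[where X = X]
    and mult_minus = projectively_contains_mult_eq_minus[where X = X]
  note P1 = projectively_contains_P1[OF assms(1)]
  note P2 = projectively_contains_P2[OF assms(2)]
  show "projectively_contains (generate GL X) quat_h"
    by (rule mult[OF P1 P2]) (simp add: quat_word_simps)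
  have w1: "projectively_contains (generate GL X) (Quat 0 0 1 0)"
    by (rule mult[OF P2 P2]) (simp add: quat_word_simps)
  have w2: "projectively_contains (generate GL X) (Quat (- 1 / sqrt 2) 0 (1 / sqrt 2) 0)"
    by (rule mult[OF w1 P2]) (simp add: quat_word_simps)
  show "projectively_contains (generate GL X) quat_h'"
    by (rule mult_minus[OF w2 P1]) (simp add: quat_word_simps)
qed

lemma tetrahedral_in_F1_P1:
  assumes "refl_F1 \<in> X" "refl_P1 \<in> X"
  shows "projectively_contains (generate GL X) quat_h"
    "projectively_contains (generate GL X) quat_h'"
proof -
  note mult = projectively_contains_mult_eq[where X = X]
    and mult_minus = projectively_contains_mult_eq_minus[where X = X]
  note F1 = projectively_contains_F1[OF assms(1)]
  note P1 = projectively_contains_P1[OF assms(2)]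
  have w1: "projectively_contains (generate GL X) (Quat 0 1 0 0)"
    by (rule mult[OF P1 P1]) (simp add: quat_word_simps)
  have w2: "projectively_contains (generate GL X) (Quat (- 1 / sqrt 2) (1 / sqrt 2) 0 0)"
    by (rule mult[OF w1 P1]) (simp add: quat_word_simps)
  show "projectively_contains (generate GL X) quat_h"
    by (rule mult[OF w2 F1]) (simp add: quat_word_simps)
  have w1: "projectively_contains (generate GL X) (Quat (1 / 2) (- 1 / 2) (- 1 / 2) (- 1 / 2))"
    by (rule mult[OF F1 P1]) (simp add: quat_word_simps)
  have w2: "projectively_contains (generate GL X) (Quat (1 / sqrt 2) 0 (- 1 / sqrt 2) 0)"
    by (rule mult[OF w1 P1]) (simp add: quat_word_simps)
  show "projectively_contains (generate GL X) quat_h'"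
    by (rule mult[OF w2 P1]) (simp add: quat_word_simps)
qed

lemma tetrahedral_in_R1_P1:
  assumes "refl_R1 \<in> X" "refl_P1 \<in> X"
  shows "projectively_contains (generate GL X) quat_h"
    "projectively_contains (generate GL X) quat_h'"
proof -
  note mult = projectively_contains_mult_eq[where X = X]
    and mult_minus = projectively_contains_mult_eq_minus[where X = X]
  note R1 = projectively_contains_R1[OF assms(1)]
  note P1 = projectively_contains_P1[OF assms(2)]
  show "projectively_contains (generate GL X) quat_h"
    using R1 by simp
  have w1: "projectively_contains (generate GL X) (Quat (- 1 / 2) (1 / 2) (1 / 2) (1 / 2))"
    by (rule mult[OF R1 R1]) (simp add: quat_word_simps)
  have w2: "projectively_contains (generate GL X) (Quat (- 1 / sqrt 2) 0 (1 / sqrt 2) 0)"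
    by (rule mult[OF w1 P1]) (simp add: quat_word_simps)
  show "projectively_contains (generate GL X) quat_h'"
    by (rule mult_minus[OF w2 P1]) (simp add: quat_word_simps)
qed

lemma tetrahedral_in_F1_R2_P1:
  assumes "refl_F1 \<in> X" "refl_R2 \<in> X" "refl_P1 \<in> X"
  shows "projectively_contains (generate GL X) quat_h"
    "projectively_contains (generate GL X) quat_h'"
proof -
  note mult = projectively_contains_mult_eq[where X = X]
    and mult_minus = projectively_contains_mult_eq_minus[where X = X]
  note F1 = projectively_contains_F1[OF assms(1)]
  note R2 = projectively_contains_R2[OF assms(2)]
  note P1 = projectively_contains_P1[OF assms(3)]
  have w1: "projectively_contains (generate GL X) (Quat (1 / sqrt 2) (- 1 / sqrt 2) 0 0)"
    by (rule mult[OF F1 R2]) (simp add: quat_word_simps)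
  have w2: "projectively_contains (generate GL X) (Quat (1 / sqrt 2) 0 0 (1 / sqrt 2))"
    by (rule mult[OF w1 R2]) (simp add: quat_word_simps)
  show "projectively_contains (generate GL X) quat_h"
    by (rule mult[OF w2 P1]) (simp add: quat_word_simps)
  show "projectively_contains (generate GL X) quat_h'"
    using R2 by simp
qed

lemma tetrahedral_in_F1_F2_F3:
  assumes "refl_F1 \<in> X" "refl_F2 \<in> X" "refl_F3 \<in> X"
  shows "projectively_contains (generate GL X) quat_h"
    "projectively_contains (generate GL X) quat_h'"
proof -
  note mult = projectively_contains_mult_eq[where X = X]
    and mult_minus = projectively_contains_mult_eq_minus[where X = X]
  note F1 = projectively_contains_F1[OF assms(1)]
  note F2 = projectively_contains_F2[OF assms(2)]
  note F3 = projectively_contains_F3[OF assms(3)]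
  show "projectively_contains (generate GL X) quat_h"
    by (rule mult_minus[OF F2 F3]) (simp add: quat_word_simps)
  have w1: "projectively_contains (generate GL X) (Quat (- 1 / 2) (1 / 2) (1 / 2) (- 1 / 2))"
    by (rule mult[OF F1 F2]) (simp add: quat_word_simps)
  have w2: "projectively_contains (generate GL X) (Quat (- 1 / sqrt 2) 0 0 (1 / sqrt 2))"
    by (rule mult[OF w1 F3]) (simp add: quat_word_simps)
  show "projectively_contains (generate GL X) quat_h'"
    by (rule mult[OF w2 F1]) (simp add: quat_word_simps)
qed

lemma tetrahedral_in_F1_F2_A1:
  assumes "refl_F1 \<in> X" "refl_F2 \<in> X" "refl_A1 \<in> X"
  shows "projectively_contains (generate GL X) quat_h"
    "projectively_contains (generate GL X) quat_h'"
proof -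
  note mult = projectively_contains_mult_eq[where X = X]
    and mult_minus = projectively_contains_mult_eq_minus[where X = X]
  note F1 = projectively_contains_F1[OF assms(1)]
  note F2 = projectively_contains_F2[OF assms(2)]
  note A1 = projectively_contains_A1[OF assms(3)]
  have w1: "projectively_contains (generate GL X) (Quat (- 1 / 2) (1 / 2) (1 / 2) (- 1 / 2))"
    by (rule mult[OF F1 F2]) (simp add: quat_word_simps)
  show "projectively_contains (generate GL X) quat_h"
    by (rule mult[OF w1 A1]) (simp add: quat_word_simps)
  have w1: "projectively_contains (generate GL X) (Quat (- 1 / sqrt 2) 0 0 (1 / sqrt 2))"
    by (rule mult[OF F2 A1]) (simp add: quat_word_simps)
  show "projectively_contains (generate GL X) quat_h'"
    by (rule mult[OF w1 F1]) (simp add: quat_word_simps)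
qed

lemma tetrahedral_in_F1_R1:
  assumes "refl_F1 \<in> X" "refl_R1 \<in> X"
  shows "projectively_contains (generate GL X) quat_h"
    "projectively_contains (generate GL X) quat_h'"
proof -
  note mult = projectively_contains_mult_eq[where X = X]
    and mult_minus = projectively_contains_mult_eq_minus[where X = X]
  note F1 = projectively_contains_F1[OF assms(1)]
  note R1 = projectively_contains_R1[OF assms(2)]
  show "projectively_contains (generate GL X) quat_h"
    using R1 by simp
  have w1: "projectively_contains (generate GL X) (Quat (1 / sqrt 2) 0 0 (- 1 / sqrt 2))"
    by (rule mult[OF F1 R1]) (simp add: quat_word_simps)
  show "projectively_contains (generate GL X) quat_h'"
    by (rule mult_minus[OF w1 F1]) (simp add: quat_word_simps)
qed

lemma tetrahedral_in_Q1_Q2: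
  assumes "refl_Q1 \<in> X" "refl_Q2 \<in> X"
  shows "projectively_contains (generate GL X) quat_h"
    "projectively_contains (generate GL X) quat_h'"
proof -
  note mult = projectively_contains_mult_eq[where X = X]
    and mult_minus = projectively_contains_mult_eq_minus[where X = X]
  note Q1 = projectively_contains_Q1[OF assms(1)]
  note Q2 = projectively_contains_Q2[OF assms(2)]
  show "projectively_contains (generate GL X) quat_h"
    by (rule mult[OF Q2 Q1]) (simp add: quat_word_simps)
  have w1: "projectively_contains (generate GL X) (Quat (1 / 2) 0 (- gold_sigma / 2) (gold_tau / 2))"
    by (rule mult[OF Q1 Q2]) (simp add: quat_word_simps)
  have w2: "projectively_contains (generate GL X) (Quat 0 (gold_sigma / 2) (1 / 2) (gold_tau / 2))"
    by (rule mult[OF w1 Q2]) (simp add: quat_word_simps)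
  have w3: "projectively_contains (generate GL X) (Quat (- 1 / 2) (- 1 / 2) (1 / 2) (1 / 2))"
    by (rule mult[OF w2 Q2]) (simp add: quat_word_simps)
  have w4: "projectively_contains (generate GL X) (Quat (- gold_tau / 2) (- 1 / 2) (- gold_sigma / 2) 0)"
    by (rule mult[OF w3 Q2]) (simp add: quat_word_simps)
  show "projectively_contains (generate GL X) quat_h'"
    by (rule mult_minus[OF w4 Q1]) (simp add: quat_word_simps)
qed

lemma tetrahedral_in_A2_Q2:
  assumes "refl_A2 \<in> X" "refl_Q2 \<in> X"
  shows "projectively_contains (generate GL X) quat_h"
    "projectively_contains (generate GL X) quat_h'"
proof -
  note mult = projectively_contains_mult_eq[where X = X]
    and mult_minus = projectively_contains_mult_eq_minus[where X = X]
  note A2 = projectively_contains_A2[OF assms(1)]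
  note Q2 = projectively_contains_Q2[OF assms(2)]
  have w1: "projectively_contains (generate GL X) (Quat (- gold_sigma / 2) 0 (gold_tau / 2) (1 / 2))"
    by (rule mult[OF Q2 Q2]) (simp add: quat_word_simps)
  have w2: "projectively_contains (generate GL X) (Quat (gold_sigma / 2) 0 (gold_tau / 2) (1 / 2))"
    by (rule mult[OF w1 Q2]) (simp add: quat_word_simps)
  have w3: "projectively_contains (generate GL X) (Quat (- gold_tau / 2) (- 1 / 2) (gold_sigma / 2) 0)"
    by (rule mult[OF w2 A2]) (simp add: quat_word_simps)
  show "projectively_contains (generate GL X) quat_h"
    by (rule mult_minus[OF w3 Q2]) (simp add: quat_word_simps)
  have w1: "projectively_contains (generate GL X) (Quat (- 1 / 2) (gold_sigma / 2) (gold_tau / 2) 0)"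
    by (rule mult[OF Q2 A2]) (simp add: quat_word_simps)
  have w2: "projectively_contains (generate GL X) (Quat (- gold_tau / 2) 0 (1 / 2) (gold_sigma / 2))"
    by (rule mult[OF w1 Q2]) (simp add: quat_word_simps)
  have w3: "projectively_contains (generate GL X) (Quat (- gold_tau / 2) (- gold_sigma / 2) 0 (- 1 / 2))"
    by (rule mult[OF w2 Q2]) (simp add: quat_word_simps)
  have w4: "projectively_contains (generate GL X) (Quat (- 1 / 2) (1 / 2) (- 1 / 2) (- 1 / 2))"
    by (rule mult[OF w3 Q2]) (simp add: quat_word_simps)
  show "projectively_contains (generate GL X) quat_h'"
    by (rule mult[OF w4 A2]) (simp add: quat_word_simps)
qed

lemma tetrahedral_in_R1_Q1:
  assumes "refl_R1 \<in> X" "refl_Q1 \<in> X"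
  shows "projectively_contains (generate GL X) quat_h"
    "projectively_contains (generate GL X) quat_h'"
proof -
  note mult = projectively_contains_mult_eq[where X = X]
    and mult_minus = projectively_contains_mult_eq_minus[where X = X]
  note R1 = projectively_contains_R1[OF assms(1)]
  note Q1 = projectively_contains_Q1[OF assms(2)]
  show "projectively_contains (generate GL X) quat_h"
    using R1 by simp
  have w1: "projectively_contains (generate GL X) (Quat (- gold_sigma / 2) (1 / 2) 0 (gold_tau / 2))"
    by (rule mult[OF Q1 Q1]) (simp add: quat_word_simps)
  have w2: "projectively_contains (generate GL X) (Quat (- 1 / 2) 0 (- gold_sigma / 2) (gold_tau / 2))"
    by (rule mult[OF w1 R1]) (simp add: quat_word_simps)
  have w3: "projectively_contains (generate GL X) (Quat (- gold_tau / 2) (- 1 / 2) (- gold_sigma / 2) 0)"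
    by (rule mult[OF w2 R1]) (simp add: quat_word_simps)
  show "projectively_contains (generate GL X) quat_h'"
    by (rule mult_minus[OF w3 Q1]) (simp add: quat_word_simps)
qed

lemma tetrahedral_in_R1_R4:
  assumes "refl_R1 \<in> X" "refl_R4 \<in> X"
  shows "projectively_contains (generate GL X) quat_h"
    "projectively_contains (generate GL X) quat_h'"
proof -
  note mult = projectively_contains_mult_eq[where X = X]
    and mult_minus = projectively_contains_mult_eq_minus[where X = X]
  note R1 = projectively_contains_R1[OF assms(1)]
  note R4 = projectively_contains_R4[OF assms(2)]
  show "projectively_contains (generate GL X) quat_h"
    using R1 by simp
  have w1: "projectively_contains (generate GL X) (Quat (gold_sigma / 2) 0 (gold_tau / 2) (1 / 2))"
    by (rule mult[OF R4 R1]) (simp add: quat_word_simps)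
  have w2: "projectively_contains (generate GL X) (Quat (- gold_tau / 2) 0 (1 / 2) (gold_sigma / 2))"
    by (rule mult[OF w1 R1]) (simp add: quat_word_simps)
  have w3: "projectively_contains (generate GL X) (Quat (gold_sigma / 2) (1 / 2) 0 (- gold_tau / 2))"
    by (rule mult[OF w2 R4]) (simp add: quat_word_simps)
  have w4: "projectively_contains (generate GL X) (Quat (1 / 2) (1 / 2) (- 1 / 2) (- 1 / 2))"
    by (rule mult[OF w3 R4]) (simp add: quat_word_simps)
  show "projectively_contains (generate GL X) quat_h'"
    by (rule mult[OF w4 R1]) (simp add: quat_word_simps)
qed

lemma tetrahedral_in_B_R1:
  assumes "refl_B \<in> X" "refl_R1 \<in> X"
  shows "projectively_contains (generate GL X) quat_h"
    "projectively_contains (generate GL X) quat_h'"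
proof -
  note mult = projectively_contains_mult_eq[where X = X]
    and mult_minus = projectively_contains_mult_eq_minus[where X = X]
  note B = projectively_contains_B[OF assms(1)]
  note R1 = projectively_contains_R1[OF assms(2)]
  show "projectively_contains (generate GL X) quat_h"
    using R1 by simp
  have w1: "projectively_contains (generate GL X) (Quat (- 1 / 2) (1 / 2) (1 / 2) (1 / 2))"
    by (rule mult[OF R1 R1]) (simp add: quat_word_simps)
  have w2: "projectively_contains (generate GL X) (Quat (gold_tau / 2) (- gold_sigma / 2) 0 (1 / 2))"
    by (rule mult[OF w1 B]) (simp add: quat_word_simps)
  have w3: "projectively_contains (generate GL X) (Quat 0 (- gold_sigma / 2) (1 / 2) (gold_tau / 2))"
    by (rule mult[OF w2 R1]) (simp add: quat_word_simps)
  have w4: "projectively_contains (generate GL X) (Quat (- gold_tau / 2) 0 (1 / 2) (- gold_sigma / 2))"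
    by (rule mult[OF w3 R1]) (simp add: quat_word_simps)
  have w5: "projectively_contains (generate GL X) (Quat (- gold_sigma / 2) (1 / 2) 0 (gold_tau / 2))"
    by (rule mult[OF w4 B]) (simp add: quat_word_simps)
  have w6: "projectively_contains (generate GL X) (Quat (- 1 / 2) 0 (- gold_sigma / 2) (gold_tau / 2))"
    by (rule mult[OF w5 R1]) (simp add: quat_word_simps)
  show "projectively_contains (generate GL X) quat_h'"
    by (rule mult[OF w6 B]) (simp add: quat_word_simps)
qed

lemma tetrahedral_in_A1_A2_A3:
  assumes "refl_A1 \<in> X" "refl_A2 \<in> X" "refl_A3 \<in> X"
  shows "projectively_contains (generate GL X) quat_h"
    "projectively_contains (generate GL X) quat_h'"
proof -
  note mult = projectively_contains_mult_eq[where X = X]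
    and mult_minus = projectively_contains_mult_eq_minus[where X = X]
  note A1 = projectively_contains_A1[OF assms(1)]
  note A2 = projectively_contains_A2[OF assms(2)]
  note A3 = projectively_contains_A3[OF assms(3)]
  have w1: "projectively_contains (generate GL X) (Quat (gold_sigma / 2) (1 / 2) 0 (gold_tau / 2))"
    by (rule mult[OF A2 A3]) (simp add: quat_word_simps)
  have w2: "projectively_contains (generate GL X) (Quat (1 / 2) (- gold_sigma / 2) (- gold_tau / 2) 0)"
    by (rule mult[OF w1 A1]) (simp add: quat_word_simps)
  have w3: "projectively_contains (generate GL X) (Quat (1 / 2) (- gold_tau / 2) 0 (gold_sigma / 2))"
    by (rule mult[OF w2 A3]) (simp add: quat_word_simps)
  have w4: "projectively_contains (generate GL X) (Quat 0 (- gold_sigma / 2) (1 / 2) (- gold_tau / 2))"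
    by (rule mult[OF w3 A2]) (simp add: quat_word_simps)
  show "projectively_contains (generate GL X) quat_h"
    by (rule mult[OF w4 A3]) (simp add: quat_word_simps)
  have w1: "projectively_contains (generate GL X) (Quat (gold_sigma / 2) (1 / 2) 0 (gold_tau / 2))"
    by (rule mult[OF A2 A3]) (simp add: quat_word_simps)
  have w2: "projectively_contains (generate GL X) (Quat 0 (- gold_tau / 2) (gold_sigma / 2) (1 / 2))"
    by (rule mult[OF w1 A2]) (simp add: quat_word_simps)
  have w3: "projectively_contains (generate GL X) (Quat (- gold_tau / 2) (gold_sigma / 2) 0 (- 1 / 2))"
    by (rule mult[OF w2 A3]) (simp add: quat_word_simps)
  have w4: "projectively_contains (generate GL X) (Quat (gold_sigma / 2) (gold_tau / 2) (1 / 2) 0)"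
    by (rule mult[OF w3 A1]) (simp add: quat_word_simps)
  show "projectively_contains (generate GL X) quat_h'"
    by (rule mult[OF w4 A3]) (simp add: quat_word_simps)
qed


section \<open>Quaternionic systems of groups generated by reflections of order two\<close>

text \<open>For \<open>\<bar>z\<bar> = 1\<close> this line is the graph of an antilinear map
  from \<open>\<complex>\<^sup>2\<close> to \<open>\<complex>\<^sup>2 j\<close> that commutes
  with all special unitary matrices.\<close>

abbreviation graph_line :: "complex \<Rightarrow> (quat^2) set" where
  "graph_line z \<equiv> right_span (vector [1, quat_of_complex z * quat_j])"

lemma quat_j_mult_complex: "quat_j * quat_of_complex w = quat_of_complex (cnj w) * quat_j"
  by (simp add: quat_eq_iff)

text \<open>Multiplication in the form in which the lines are computed with: \<open>j\<close>
  conjugates the complex numbers that it passes.\<close>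

lemma complex_pair_mult:
  "(quat_of_complex u + quat_of_complex v * quat_j) * (quat_of_complex s + quat_of_complex t * quat_j) =
    quat_of_complex (u * s - v * cnj t) + quat_of_complex (u * t + v * cnj s) * quat_j"
  by (simp add: quat_eq_iff algebra_simps)

lemma complex_pair_eq_iff:
  "quat_of_complex u + quat_of_complex v * quat_j = quat_of_complex s + quat_of_complex t * quat_j \<longleftrightarrow>
    u = s \<and> v = t"
  by (auto simp: quat_eq_iff complex_eq_iff)

lemma unit_complex_cnj: "cmod z = 1 \<Longrightarrow> z * cnj z = 1"
  by (simp add: complex_norm_square[symmetric])

lemma unit_zj_square:
  assumes "cmod z = 1"
  shows "quat_of_complex z * quat_j * (quat_of_complex z * quat_j) = - 1"
proof -
  have "quat_of_complex z * quat_j * (quat_of_complex z * quat_j) = quat_of_complex (- (z * cnj z))"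
    using complex_pair_mult[of 0 z 0 z] by (simp add: quat_of_complex_hom)
  then show ?thesis
    by (simp add: unit_complex_cnj[OF assms] quat_of_complex_hom)
qed

text \<open>As \<open>q = z j\<close> is a purely imaginary unit quaternion, \<open>(- qcnj q,
  1) = (q, 1)\<close> spans the same line as \<open>(1, - q)\<close>.\<close>

lemma system_given_by_zj:
  assumes "cmod z = 1"
  shows "system_given_by (quat_of_complex z * quat_j) = {graph_line z, graph_line (- z)}"
proof -
  let ?q = "quat_of_complex z * quat_j"
  have cnj: "qcnj ?q = - ?q"
    by (simp add: quat_eq_iff)
  have "orth_compl (graph_line z) = ({vector [?q * p, p] |p. True} :: (quat^2) set)"
  proof (intro Set.set_eqI iffI)
    fix w assume w: "w \<in> orth_compl (graph_line z)"
    obtain x y where xy: "w = vector [x, y]"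
      using vector2_eta by blast
    have "qinner (vector [1, ?q]) w = 0"
      using w self_in_right_span unfolding orth_compl_def by blast
    then have "qcnj 1 * x + qcnj ?q * y = 0"
      by (simp add: xy qinner_def sum_2)
    moreover have "qcnj 1 = 1"
      by (simp add: quat_eq_iff)
    ultimately have "x = ?q * y"
      unfolding cnj by (simp add: minus_mult_left[symmetric] del: minus_mult_left)
    then show "w \<in> {vector [?q * p, p] |p. True}"
      unfolding xy by blast
  next
    fix w :: "quat^2" assume "w \<in> {vector [?q * p, p] |p. True}"
    then obtain p where w: "w = vector [?q * p, p]"
      by blast
    have "qinner (vector [1 * r, ?q * r]) w = 0" for r
    proof -
      have "qinner (vector [1 * r, ?q * r]) w = qcnj r * (?q * p) + qcnj r * qcnj ?q * p"
        unfolding qcnj_mult[symmetric] by (simp add: w qinner_def sum_2)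
      also have "\<dots> = 0"
        unfolding cnj by (simp add: mult.assoc)
      finally show ?thesis .
    qed
    then show "w \<in> orth_compl (graph_line z)"
      unfolding orth_compl_def right_span_vector2 by blast
  qed
  also have "\<dots> = right_span (vector [?q, 1])"
    unfolding right_span_vector2 by auto
  also have "\<dots> = graph_line (- z)"
  proof -
    have "?q \<noteq> 0"
      using unit_zj_square[OF assms] by (metis mult_zero_left neg_equal_0_iff_equal one_neq_zero)
    moreover have "quat_of_complex (- z) * quat_j * ?q = 1"
      using unit_zj_square[OF assms] by (simp add: quat_of_complex_hom)
    ultimately show ?thesis
      by (simp add: right_span_graph_eq_iff)
  qed
  finally show ?thesis
    by (simp add: system_given_by_def)
qed

text \<open>Put \<open>q = z j\<close>, so that \<open>q\<^sup>2 = - 1\<close>. For a special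
  unitary matrix with first row \<open>\<alpha>\<close>, \<open>\<beta>\<close> the identity
  \<open>q (\<alpha> + \<beta> q) = - cnj \<beta> + cnj \<alpha> q\<close> says that the line is
  fixed. The scalar moves it because \<open>c (z j) = (c\<^sup>2 z j) c\<close>. So the pair
  given by \<open>z\<close> and \<open>- z\<close> is preserved exactly when \<open>c\<^sup>4 =
  1\<close>.\<close>

lemma scaled_su2_graph_line:
  assumes c: "cmod c = 1" and z: "cmod z = 1" and y: "qnorm2 y = 1"
  shows "(*v) (quat_mat (scaled_su2 c y)) ` graph_line z = graph_line (c * c * z)"
proof -
  define \<alpha> \<beta> where "\<alpha> = Complex (qre y) (qim_i y)" and "\<beta> = Complex (qim_j y) (qim_k y)"
  have entries: "scaled_su2 c y = mat2 (c * \<alpha>) (c * \<beta>) (- (c * cnj \<beta>)) (c * cnj \<alpha>)"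
    by (simp add: scaled_su2_eq_mat2 \<alpha>_def \<beta>_def complex_eq_iff)
  let ?x = "quat_of_complex (c * \<alpha>) + quat_of_complex (c * \<beta> * z) * quat_j"
  let ?y = "quat_of_complex (- (c * cnj \<beta>)) + quat_of_complex (c * cnj \<alpha> * z) * quat_j"
  have image: "(*v) (quat_mat (scaled_su2 c y)) ` graph_line z = right_span (vector [?x, ?y])"
    unfolding entries quat_mat_mat2 image_mat2_line by (simp add: quat_of_complex_hom mult.assoc)
  have "?x \<noteq> 0"
  proof
    assume "?x = 0"
    then have "c * \<alpha> = 0 \<and> c * \<beta> * z = 0"
      using complex_pair_eq_iff[of "c * \<alpha>" "c * \<beta> * z" 0 0] by (simp add: quat_of_complex_hom)
    moreover have "c \<noteq> 0" "z \<noteq> 0"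
      using c z by auto
    ultimately have "\<alpha> = 0" "\<beta> = 0"
      by simp_all
    with y show False
      by (simp add: \<alpha>_def \<beta>_def qnorm2_def complex_eq_iff)
  qed
  moreover have "?y = quat_of_complex (c * c * z) * quat_j * ?x"
  proof -
    have "quat_of_complex (c * c * z) * quat_j * ?x =
      quat_of_complex (- (c * c * z * cnj (c * \<beta> * z))) + quat_of_complex (c * c * z * cnj (c * \<alpha>)) * quat_j"
      using complex_pair_mult[of 0 "c * c * z" "c * \<alpha>" "c * \<beta> * z"] by (simp add: quat_of_complex_hom)
    also have "c * c * z * cnj (c * \<beta> * z) = (c * cnj c) * (z * cnj z) * (c * cnj \<beta>)"
      by simp
    also have "c * c * z * cnj (c * \<alpha>) = (c * cnj c) * (c * cnj \<alpha> * z)"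
      by simp
    finally show ?thesis
      unfolding unit_complex_cnj[OF c] unit_complex_cnj[OF z] by simp
  qed
  ultimately show ?thesis
    unfolding image by (simp add: right_span_graph_eq_iff)
qed

lemma graph_line_neq_minus:
  assumes "cmod z = 1"
  shows "graph_line z \<noteq> graph_line (- z)"
proof
  assume "graph_line z = graph_line (- z)"
  then have "quat_of_complex z * quat_j = quat_of_complex (- z) * quat_j"
    by (simp add: right_span_graph_eq_iff)
  then have "z = 0"
    using complex_pair_eq_iff[of 0 z 0 "- z"] by (simp add: quat_of_complex_hom)
  with assms show False by simp
qed

text \<open>By \<open>scaled_su2_graph_line\<close> these are the matrices, among the unitary
  ones, that permute the lines of \<open>z\<close> and \<open>- z\<close>.\<close>

definition quartic_unimodular :: "(complex^2^2) set" where
  "quartic_unimodular = {scaled_su2 c y |c y. c ^ 4 = 1 \<and> qnorm2 y = 1}"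

lemma fourth_root_of_unity:
  fixes c :: complex
  assumes "c ^ 4 = 1"
  shows "cmod c = 1" "c * c = 1 \<or> c * c = - 1"
proof -
  have "cmod c ^ 4 = 1"
    using assms by (metis norm_one norm_power)
  then show "cmod c = 1"
    using power_eq_1_iff by force
  have "(c * c) * (c * c) = 1"
    using assms by (simp add: eval_nat_numeral mult.assoc)
  then show "c * c = 1 \<or> c * c = - 1"
    by (simp only: square_eq_1_iff)
qed

lemma inv_GL:
  assumes "invertible (A :: 'a::semiring_1^'n^'n)"
  shows "inv\<^bsub>GL\<^esub> A = matrix_inv A"
proof -
  interpret group "GL :: ('a^'n^'n) monoid"
    by (rule group_GL)
  show ?thesis
    using matrix_inv_mult[OF assms] assms invertible_matrix_inv[OF assms]
    by (intro inv_equality) (simp_all add: GL_sel)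
qed

lemma generate_subset_quartic_unimodular:
  assumes "X \<subseteq> quartic_unimodular"
  shows "generate GL X \<subseteq> quartic_unimodular"
proof
  fix g assume "g \<in> generate GL X"
  then show "g \<in> quartic_unimodular"
  proof induction
    case one
    have "\<one>\<^bsub>GL\<^esub> = scaled_su2 1 1" "qnorm2 1 = 1"
      by (simp_all add: GL_sel scaled_su2_one qnorm2_def)
    then show ?case
      unfolding quartic_unimodular_def by force
  next
    case (incl x)
    then show ?case using assms by blast
  next
    case (inv x)
    then obtain c y where x: "x = scaled_su2 c y" "c ^ 4 = 1" "qnorm2 y = 1"
      using assms by (auto simp: quartic_unimodular_def)
    have "c \<noteq> 0"
      using x(2) by auto
    note inverse = scaled_su2_inverse[OF this x(3)]
    have "inv\<^bsub>GL\<^esub> x = scaled_su2 (inverse c) (qcnj y)"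
      using inverse by (simp add: x(1) inv_GL)
    moreover have "inverse c ^ 4 = 1" "qnorm2 (qcnj y) = 1"
      using x by (simp_all add: power_inverse qnorm2_def)
    ultimately show ?case
      unfolding quartic_unimodular_def by blast
  next
    case (eng g h)
    then obtain c y d w where "g = scaled_su2 c y" "c ^ 4 = 1" "qnorm2 y = 1"
      "h = scaled_su2 d w" "d ^ 4 = 1" "qnorm2 w = 1"
      by (auto simp: quartic_unimodular_def)
    then have "g \<otimes>\<^bsub>GL\<^esub> h = scaled_su2 (c * d) (y * w)" "(c * d) ^ 4 = 1" "qnorm2 (y * w) = 1"
      by (simp_all add: GL_sel scaled_su2_mult power_mult_distrib qnorm2_mult)
    then show ?case
      unfolding quartic_unimodular_def by blast
  qed
qed

lemma graph_lines_quaternionic_system: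
  assumes G: "G \<subseteq> quartic_unimodular" and z: "cmod z = 1"
  shows "quaternionic_system G {graph_line z, graph_line (- z)}"
  unfolding quaternionic_system_def
proof (rule system_of_imprimitivity_columnsI)
  let ?q = "quat_of_complex z * quat_j"
  let ?h = "quat_of_complex (1 / 2)"
  have half: "?h + ?h = 1"
    by (simp add: quat_eq_iff)
  have q: "?q * (?h * ?q) = - ?h"
  proof -
    have "?q * ?h = ?h * ?q"
      by (simp add: quat_eq_iff)
    then show ?thesis
      using unit_zj_square[OF z] by (metis mult.assoc mult_minus_right mult.right_neutral)
  qed
  have "mat2 1 1 ?q (- ?q) ** mat2 ?h (- (?h * ?q)) ?h (?h * ?q) = mat 1"
    using half by (simp add: mat2_mult mat_1_eq_mat2 q)
  moreover have "mat2 ?h (- (?h * ?q)) ?h (?h * ?q) ** mat2 1 1 ?q (- ?q) = mat 1"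
    using half unit_zj_square[OF z] by (simp add: mat2_mult mat_1_eq_mat2 mult.assoc)
  ultimately show "invertible (mat2 1 1 ?q (- ?q))"
    unfolding invertible_def by blast
  show "{graph_line z, graph_line (- z)} = {graph_line z, right_span (vector [1, - ?q])}"
    by (simp add: quat_of_complex_hom)
  fix g assume "g \<in> quat_mat ` G"
  then obtain c y where g: "g = quat_mat (scaled_su2 c y)" "c ^ 4 = 1" "qnorm2 y = 1"
    using G by (auto simp: quartic_unimodular_def)
  note c = fourth_root_of_unity[OF g(2)]
  have "(*v) g ` graph_line z = graph_line (c * c * z)"
    "(*v) g ` graph_line (- z) = graph_line (c * c * (- z))"
    unfolding g(1) using scaled_su2_graph_line[OF c(1) _ g(3)] z by simp_all
  then show "(`) ((*v) g) ` {graph_line z, graph_line (- z)} = {graph_line z, graph_line (- z)}"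
    using c(2) by auto
qed

lemma det_scaled_su2: "det (scaled_su2 c q) = c\<^sup>2 * of_real (qnorm2 q)"
  by (simp add: scaled_su2_eq_mat2 det_2 complex_eq_iff qnorm2_def power2_eq_square algebra_simps)

text \<open>As over the complex numbers, both lines are fixed by \<open>i\<close> and by
  \<open>(1 + i + j + k) / 2\<close>. Over the quaternions \<open>i\<close> fixes, besides the
  axes, the lines spanned by \<open>(1, z j)\<close> for all complex \<open>z\<close>, and the
  second element leaves only those with \<open>|z| = 1\<close>. An element with scalar part
  \<open>\<plusminus>\<i>\<close> sends one line of the system to the line of \<open>-
  z\<close>, which has to be the other one.\<close>

lemma quaternionic_system_imp_graph_lines:
  assumes G: "G \<subseteq> quartic_unimodular"
    and h: "projectively_contains G quat_h" "projectively_contains G quat_h'"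
    and s: "scaled_su2 c s \<in> G" "c * c = - 1" "qnorm2 s = 1"
    and S: "quaternionic_system G S"
  shows "\<exists>z. cmod z = 1 \<and> S = {graph_line z, graph_line (- z)}"
proof -
  have S': "system_of_imprimitivity (quat_mat ` G) S"
    using S by (simp add: quaternionic_system_def)
  have fix4: "(*v) (quat_mat (su2 (q * q * (q * q)))) ` V = V"
    if pc: "projectively_contains G q" and "qnorm2 q = 1" "V \<in> S" for q V
  proof -
    obtain c where c: "scaled_su2 c q \<in> G"
      using pc by (auto simp: projectively_contains_def)
    then obtain d w where "scaled_su2 c q = scaled_su2 d w" "d ^ 4 = 1" "qnorm2 w = 1"
      using G by (auto simp: quartic_unimodular_def)
    then have "c\<^sup>2 = d\<^sup>2" "d ^ 4 = 1"
      using det_scaled_su2[of c q] det_scaled_su2[of d w] \<open>qnorm2 q = 1\<close> by simp_all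
    then have "c * c * (c * c) = 1"
      by (simp add: eval_nat_numeral mult.assoc)
    moreover have "scale_mat 1 A = A" for A :: "complex^2^2"
      by (simp add: scale_mat_def vec_eq_iff)
    ultimately show ?thesis
      using image_mult_fixes[OF system_square_fixes[OF S' imageI[OF c] \<open>V \<in> S\<close>]
          system_square_fixes[OF S' imageI[OF c] \<open>V \<in> S\<close>]]
      by (simp add: scaled_su2_mult flip: quat_mat_mult)
  qed
  have line: "\<exists>z. cmod z = 1 \<and> V = graph_line z" if V: "V \<in> S" for V
  proof -
    have fixes_V: "(*v) (quat_mat (su2 (- quat_h))) ` V = V" "(*v) (quat_mat (su2 (- quat_h'))) ` V = V"
      using fix4[OF h(1) _ V] fix4[OF h(2) _ V] unfolding quat_h_power4
      by (simp_all add: qnorm2_def power_divide)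
    have "su2 p ** su2 q = su2 (p * q)" for p q
      using scaled_su2_mult[of 1 p 1 q] by (simp add: scale_mat_def)
    then have "(*v) (quat_mat (su2 (Quat 0 1 0 0))) ` V = V"
      using image_mult_fixes[OF fixes_V] quat_h_mult_h' by (simp flip: quat_mat_mult)
    then have i: "(*v) (mat2 (quat_of_complex \<i>) 0 0 (quat_of_complex (- \<i>))) ` V = V"
      by (simp add: su2_def quat_mat_mat2 Complex_eq quat_of_complex_hom)
    show ?thesis
    proof (rule is_line_cases[OF system_is_line[OF S' V]])
      fix q assume V_eq: "V = right_span (vector [1, q])"
      have "quat_of_complex (- \<i>) * q = q * quat_of_complex \<i>"
        using i by (simp add: V_eq image_mat2_line right_span_graph_eq_iff)
      then have q: "qre q = 0" "qim_i q = 0"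
        by (simp_all add: quat_eq_iff)
      have "(qim_j q)\<^sup>2 + (qim_k q)\<^sup>2 = 1"
        using fixes_V(1) by (simp add: V_eq su2_def quat_mat_mat2 image_mat2_line right_span_graph_eq_iff
            quat_eq_iff q power2_eq_square algebra_simps)
      then have "cmod (Complex (qim_j q) (qim_k q)) = 1"
        by (simp add: cmod_def)
      moreover have "q = quat_of_complex (Complex (qim_j q) (qim_k q)) * quat_j"
        by (simp add: quat_eq_iff q)
      ultimately show ?thesis
        using V_eq by metis
    next
      assume V_eq: "V = right_span (vector [0, 1])"
      show ?thesis
        using fixes_V(1) by (simp add: V_eq su2_def quat_mat_mat2 image_mat2_line right_span_axis_eq_iff
            quat_eq_iff)
    qed
  qed
  obtain V1 V2 where V12: "S = {V1, V2}" "V1 \<noteq> V2"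
    using S' by (elim system_of_imprimitivityE)
  obtain z where z: "cmod z = 1" "V1 = graph_line z"
    using line V12 by blast
  have "cmod c * cmod c = 1"
    using s(2) by (metis norm_minus_cancel norm_mult norm_one)
  then have "cmod c = 1"
    by (metis abs_norm_cancel abs_square_eq_1 power2_eq_square)
  then have "(*v) (quat_mat (scaled_su2 c s)) ` V1 = graph_line (- z)"
    using scaled_su2_graph_line[of c z s] z s by simp
  then have "graph_line (- z) \<in> S"
    using system_image_in[OF S' imageI[OF s(1)], of V1] V12 by simp
  then have "S = {graph_line z, graph_line (- z)}"
    using V12 z graph_line_neq_minus[OF z(1)] by auto
  with z show ?thesis by blast
qed


section \<open>Change of basis\<close>

definition qadjoint :: "quat^2^2 \<Rightarrow> quat^2^2" where
  "qadjoint A = (\<chi> r s. qcnj (A $ s $ r))"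

lemma qadjoint_mat2: "qadjoint (mat2 a b c d) = mat2 (qcnj a) (qcnj c) (qcnj b) (qcnj d)"
  by (simp add: qadjoint_def vec_eq_iff forall_2)

lemma qadjoint_mult: "qadjoint (A ** B) = qadjoint B ** qadjoint A"
proof -
  have "qcnj (p + q) = qcnj p + qcnj q" for p q
    by (simp add: quat_eq_iff)
  then show ?thesis
    by (simp add: qadjoint_def vec_eq_iff forall_2 matrix_matrix_mult_def sum_2 qcnj_mult)
qed

lemma quat_unitary_mult:
  assumes "quat_unitary A" "quat_unitary B"
  shows "quat_unitary (A ** B)"
proof -
  have "A ** B ** (qadjoint B ** qadjoint A) = A ** (B ** qadjoint B) ** qadjoint A"
    "qadjoint B ** qadjoint A ** (A ** B) = qadjoint B ** (qadjoint A ** A) ** B"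
    by (simp_all add: matrix_mul_assoc)
  with assms show ?thesis
    by (simp add: quat_unitary_def flip: qadjoint_def qadjoint_mult)
qed

lemma quat_unitary_inverse:
  assumes "quat_unitary U"
  shows "invertible U" "matrix_inv U = qadjoint U"
  using assms by (auto simp: quat_unitary_def invertible_def qadjoint_def intro!: matrix_inv_eqI)

text \<open>The columns span the lines of \<open>(1, j)\<close> and \<open>(1, - j)\<close>; the
  parameters rescale them, and squared norm one half makes the matrix unitary.\<close>

definition zj_frame :: "quat \<Rightarrow> quat \<Rightarrow> quat^2^2" where
  "zj_frame \<alpha> \<delta> = mat2 \<alpha> \<delta> (quat_j * \<alpha>) (- (quat_j * \<delta>))"

lemma zj_frame_unitary:
  assumes "qnorm2 \<alpha> = 1 / 2" "qnorm2 \<delta> = 1 / 2"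
  shows "quat_unitary (zj_frame \<alpha> \<delta>)"
proof -
  have j: "qcnj quat_j = - quat_j" "quat_j * quat_j = - 1"
    and minus: "qcnj (- q) = - qcnj q" for q
    by (simp_all add: quat_eq_iff)
  have jj: "quat_j * (quat_j * q) = - q" for q
    by (simp add: j flip: mult.assoc)
  have "\<alpha> * (qcnj \<alpha> * q) = Quat (1 / 2) 0 0 0 * q" "qcnj \<alpha> * (\<alpha> * q) = Quat (1 / 2) 0 0 0 * q"
    "\<delta> * (qcnj \<delta> * q) = Quat (1 / 2) 0 0 0 * q" "qcnj \<delta> * (\<delta> * q) = Quat (1 / 2) 0 0 0 * q" for q
    using assms by (simp_all add: mult_qcnj flip: mult.assoc)
  note norm = this mult_qcnj assms
  have half: "Quat (1 / 2) 0 0 0 + Quat (1 / 2) 0 0 0 = 1" "quat_j * (Quat (1 / 2) 0 0 0 * quat_j) = - Quat (1 / 2) 0 0 0"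
    by (simp_all add: quat_eq_iff)
  show ?thesis
    unfolding quat_unitary_def qadjoint_def[symmetric] zj_frame_def qadjoint_mat2 mat2_mult mat_1_eq_mat2
    by (simp add: qcnj_mult j jj minus norm half mult.assoc)
qed

abbreviation special_reflection :: "quat \<Rightarrow> quat^2^2" where
  "special_reflection \<beta> \<equiv> mat2 0 \<beta> (qcnj \<beta>) 0"

text \<open>The reflection interchanges the two lines of the frame. In the unscaled frame its
  off-diagonal entries are \<open>i\<close> times the quaternion and \<open>i\<close> times its
  conjugate under \<open>j \<mapsto> - j\<close>; the hypotheses describe what the scaling by
  \<open>\<alpha>\<close> and \<open>\<delta>\<close> makes of them.\<close>

lemma reflection_zj_frame:
  assumes "\<alpha> * \<beta> = Quat 0 1 0 0 * Quat a b (- c) (- d) * \<delta>"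
    and "\<delta> * qcnj \<beta> = Quat 0 1 0 0 * Quat a b c d * \<alpha>"
  shows "quat_mat (scaled_su2 \<i> (Quat a b c d)) ** zj_frame \<alpha> \<delta> = zj_frame \<alpha> \<delta> ** special_reflection \<beta>"
proof -
  have "quat_of_complex (\<i> * Complex a b) * p + quat_of_complex (\<i> * Complex c d) * (quat_j * p) =
      Quat 0 1 0 0 * Quat a b c d * p"
    "quat_of_complex (\<i> * Complex a b) * p + quat_of_complex (\<i> * Complex c d) * (- (quat_j * p)) =
      Quat 0 1 0 0 * Quat a b (- c) (- d) * p"
    "quat_of_complex (\<i> * Complex (- c) d) * p + quat_of_complex (\<i> * Complex a (- b)) * (quat_j * p) =
      - (quat_j * (Quat 0 1 0 0 * Quat a b c d * p))"
    "quat_of_complex (\<i> * Complex (- c) d) * p + quat_of_complex (\<i> * Complex a (- b)) * (- (quat_j * p)) =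
      quat_j * (Quat 0 1 0 0 * Quat a b (- c) (- d) * p)" for p
    by (simp_all add: quat_eq_iff algebra_simps)
  then show ?thesis
    unfolding scaled_su2_eq_mat2 zj_frame_def quat_mat_mat2 mat2_mult mat2_eq_iff quat.sel
    by (simp add: assms mult.assoc)
qed

lemma quat_refl_group_eq: "quat_refl_group L = generate GL (special_reflection ` L)"
  by (simp add: quat_refl_group_def)

text \<open>Conjugating a special reflection by another gives a special reflection again, and
  this operation alone suffices to express each of the generating systems below in terms of the
  other.\<close>

lemma special_reflection_conjugate:
  assumes "special_reflection \<beta> \<in> quat_refl_group L" "special_reflection \<gamma> \<in> quat_refl_group L"
    and "\<beta> * (qcnj \<gamma> * \<beta>) = \<delta>"
  shows "special_reflection \<delta> \<in> quat_refl_group L"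
proof -
  have "special_reflection \<beta> \<otimes>\<^bsub>GL\<^esub> (special_reflection \<gamma> \<otimes>\<^bsub>GL\<^esub> special_reflection \<beta>) \<in> quat_refl_group L"
    using assms(1,2) unfolding quat_refl_group_eq by (intro generate.eng)
  moreover have "special_reflection \<beta> \<otimes>\<^bsub>GL\<^esub> (special_reflection \<gamma> \<otimes>\<^bsub>GL\<^esub> special_reflection \<beta>) =
      special_reflection \<delta>"
    by (simp add: GL_sel mat2_mult qcnj_mult mult.assoc flip: assms(3))
  ultimately show ?thesis by simp
qed

lemma special_reflection_generator: "\<beta> \<in> L \<Longrightarrow> special_reflection \<beta> \<in> quat_refl_group L"
  unfolding quat_refl_group_eq by (blast intro: generate.incl)

lemma special_reflection_in_GL:
  assumes "qnorm2 \<beta> = 1"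
  shows "special_reflection \<beta> \<in> carrier GL"
proof -
  have "Quat 1 0 0 0 = 1"
    by (simp add: quat_eq_iff)
  then have "special_reflection \<beta> ** special_reflection \<beta> = mat 1"
    by (simp add: mat2_mult mat_1_eq_mat2 mult_qcnj assms)
  then show ?thesis
    by (auto simp: GL_sel invertible_def)
qed

lemma quat_refl_group_subset:
  assumes "\<And>\<beta>. \<beta> \<in> L \<Longrightarrow> qnorm2 \<beta> = 1"
    and "\<And>\<beta>. \<beta> \<in> B \<Longrightarrow> special_reflection \<beta> \<in> quat_refl_group L"
  shows "quat_refl_group B \<subseteq> quat_refl_group L"
proof -
  interpret group "GL :: (quat^2^2) monoid"
    by (rule group_GL)
  have "subgroup (quat_refl_group L) GL"
    unfolding quat_refl_group_eq
    using assms(1) special_reflection_in_GL by (intro generate_is_subgroup) blast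
  then show ?thesis
    unfolding quat_refl_group_eq[of B] using assms(2) by (intro generate_subgroup_incl) auto
qed

text \<open>Conjugation is a homomorphism on the complex matrices, so the images of the
  generators generate the conjugated group.\<close>

lemma conj_by_generate:
  fixes U :: "quat^2^2"
  assumes X: "X \<subseteq> carrier GL" and U: "invertible U"
  shows "conj_by U (quat_mat ` generate GL X) = generate GL ((\<lambda>g. matrix_inv U ** quat_mat g ** U) ` X)"
proof -
  let ?\<phi> = "\<lambda>g :: complex^2^2. matrix_inv U ** quat_mat g ** U"
  note inv = matrix_inv_mult[OF U]
  have mult: "?\<phi> (g ** h) = ?\<phi> g ** ?\<phi> h" for g h
  proof -
    have "?\<phi> g ** ?\<phi> h = matrix_inv U ** quat_mat g ** (U ** matrix_inv U) ** quat_mat h ** U"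
      by (simp only: matrix_mul_assoc)
    also have "\<dots> = ?\<phi> (g ** h)"
      by (simp add: inv quat_mat_mult matrix_mul_assoc)
    finally show ?thesis ..
  qed
  have "?\<phi> \<in> hom GL GL"
    using quat_mat_inverse(1) invertible_matrix_inv(1)[OF U] U
    by (auto simp: hom_def GL_sel mult intro!: invertible_mult)
  then interpret group_hom "GL :: (complex^2^2) monoid" "GL :: (quat^2^2) monoid" ?\<phi>
    by (intro group_hom.intro group_hom_axioms.intro group_GL)
  show ?thesis
    using generate_img[OF X] by (simp add: conj_by_def image_image)
qed

text \<open>A square root \<open>w\<close> of \<open>z\<close> moves the frame of
  \<open>j\<close> to that of \<open>z j = w j w\<^sup>-\<^sup>1\<close>. As \<open>w\<close> is
  a scalar matrix over \<open>\<complex>\<close>, it commutes with the complex group, so the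
  conjugated group is the same for all \<open>z\<close>.\<close>

lemma change_of_basis_to_special_reflections:
  assumes X: "X \<subseteq> carrier GL" and norm: "qnorm2 \<alpha> = 1 / 2" "qnorm2 \<delta> = 1 / 2"
    and XB: "\<And>g. g \<in> X \<Longrightarrow> \<exists>\<beta>\<in>B. quat_mat g ** zj_frame \<alpha> \<delta> = zj_frame \<alpha> \<delta> ** special_reflection \<beta>"
    and BX: "\<And>\<beta>. \<beta> \<in> B \<Longrightarrow> \<exists>g\<in>X. quat_mat g ** zj_frame \<alpha> \<delta> = zj_frame \<alpha> \<delta> ** special_reflection \<beta>"
    and z: "cmod z = 1"
  shows "\<exists>U. change_of_basis U (system_given_by (quat_of_complex z * quat_j)) \<and> quat_unitary U \<and>
    conj_by U (quat_mat ` generate GL X) = quat_refl_group B"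
proof -
  define w where "w = csqrt z"
  have w: "w * w = z"
    unfolding w_def by (metis power2_csqrt power2_eq_square)
  then have "cmod w * cmod w = 1"
    using z by (metis norm_mult)
  then have cmod_w: "cmod w = 1"
    by (metis abs_norm_cancel abs_square_eq_1 power2_eq_square)
  define W U where "W = mat2 w 0 0 w" and "U = quat_mat W ** zj_frame \<alpha> \<delta>"
  note frame = zj_frame_unitary[OF norm]
  have "quat_of_complex w * qcnj (quat_of_complex w) = 1" "qcnj (quat_of_complex w) * quat_of_complex w = 1"
    "qcnj 0 = 0"
    using cmod_w by (simp_all add: quat_eq_iff cmod_def flip: power2_eq_square)
  then have W: "quat_unitary (quat_mat W)"
    unfolding quat_unitary_def qadjoint_def[symmetric] W_def quat_mat_mat2 qadjoint_mat2 mat2_mult mat_1_eq_mat2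
    by (simp add: quat_of_complex_hom)
  then have U: "quat_unitary U"
    unfolding U_def using frame by (rule quat_unitary_mult)
  have conj: "matrix_inv U ** quat_mat g ** U = special_reflection \<beta>"
    if "quat_mat g ** zj_frame \<alpha> \<delta> = zj_frame \<alpha> \<delta> ** special_reflection \<beta>" for g \<beta>
  proof -
    have "g ** W = W ** g"
      by (subst (1 2) mat2_eta[of g]) (simp add: W_def mat2_mult mult.commute)
    then have "quat_mat g ** U = quat_mat W ** (quat_mat g ** zj_frame \<alpha> \<delta>)"
      unfolding U_def by (metis matrix_mul_assoc quat_mat_mult)
    also have "\<dots> = U ** special_reflection \<beta>"
      unfolding that U_def by (simp add: matrix_mul_assoc)
    finally have "matrix_inv U ** quat_mat g ** U = matrix_inv U ** U ** special_reflection \<beta>"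
      by (simp flip: matrix_mul_assoc)
    then show ?thesis
      by (simp add: matrix_inv_mult[OF quat_unitary_inverse(1)[OF U]])
  qed
  have "(\<lambda>g. matrix_inv U ** quat_mat g ** U) ` X = special_reflection ` B"
  proof (intro equalityI subsetI)
    fix A assume "A \<in> (\<lambda>g. matrix_inv U ** quat_mat g ** U) ` X"
    then obtain g where "g \<in> X" "A = matrix_inv U ** quat_mat g ** U"
      by blast
    then show "A \<in> special_reflection ` B"
      using XB[of g] conj[of g] by auto
  next
    fix A assume "A \<in> special_reflection ` B"
    then obtain \<beta> where "\<beta> \<in> B" "A = special_reflection \<beta>"
      by blast
    moreover from this obtain g where "g \<in> X"
      "quat_mat g ** zj_frame \<alpha> \<delta> = zj_frame \<alpha> \<delta> ** special_reflection \<beta>"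
      using BX by blast
    ultimately show "A \<in> (\<lambda>g. matrix_inv U ** quat_mat g ** U) ` X"
      using conj[of g \<beta>] by (intro image_eqI[of _ _ g]) simp_all
  qed
  then have "conj_by U (quat_mat ` generate GL X) = quat_refl_group B"
    by (simp add: conj_by_generate[OF X quat_unitary_inverse(1)[OF U]] quat_refl_group_eq)
  moreover have "change_of_basis U (system_given_by (quat_of_complex z * quat_j))"
  proof -
    have U_eq: "U = mat2 (quat_of_complex w * \<alpha>) (quat_of_complex w * \<delta>)
        (quat_of_complex w * (quat_j * \<alpha>)) (- (quat_of_complex w * (quat_j * \<delta>)))"
      by (simp add: U_def W_def quat_mat_mat2 zj_frame_def mat2_mult quat_of_complex_hom)
    have "z * cnj w = w"
      using unit_complex_cnj[OF cmod_w] by (simp flip: w add: mult.assoc)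
    then have commute: "quat_of_complex z * (quat_j * (quat_of_complex w * p)) = quat_of_complex w * (quat_j * p)" for p
      by (metis mult.assoc quat_j_mult_complex quat_of_complex_hom(2))
    have "w \<noteq> 0" "\<alpha> \<noteq> 0" "\<delta> \<noteq> 0"
      using cmod_w norm by (auto simp: qnorm2_def)
    then have "right_span (vector [quat_of_complex w * \<alpha>, quat_of_complex w * (quat_j * \<alpha>)]) = graph_line z"
      "right_span (vector [quat_of_complex w * \<delta>, - (quat_of_complex w * (quat_j * \<delta>))]) = graph_line (- z)"
      unfolding right_span_graph_eq_iff by (simp_all add: commute mult.assoc quat_of_complex_hom(5))
    moreover have "column 1 (mat2 a b c d) = vector [a, c]" "column 2 (mat2 a b c d) = vector [b, d]" for a b c d :: quat
      by (simp_all add: column_def vec_eq_iff forall_2)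
    ultimately show ?thesis
      unfolding change_of_basis_def system_given_by_zj[OF z]
      using quat_unitary_inverse(1)[OF U] by (simp add: U_eq)
  qed
  ultimately show ?thesis
    using U by blast
qed


section \<open>The classification\<close>

lemma shephard_todd_numbers:
  "n \<in> {4..22} \<longleftrightarrow> n \<in> {4, 5, 6, 7, 8, 9, 10, 11, 12, 13, 14, 15, 16, 17, 18, 19, 20, 21, 22 :: nat}"
  by auto presburger

lemma shephard_todd_generators_over:
  assumes "n \<in> {4..22}"
  shows "\<exists>\<Gamma>. (\<Gamma> = binary_octahedral \<or> \<Gamma> = binary_icosahedral) \<and>
    (\<forall>g\<in>shephard_todd_generators n. reflection_over \<Gamma> g)"
proof (cases "n \<le> 15")
  case True
  then have "\<forall>g\<in>shephard_todd_generators n. reflection_over binary_octahedral g"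
    by (auto simp: shephard_todd_generators_def reflection_over_binary_octahedral split: if_splits)
  then show ?thesis by blast
next
  case False
  then have "\<forall>g\<in>shephard_todd_generators n. reflection_over binary_icosahedral g"
    by (auto simp: shephard_todd_generators_def reflection_over_binary_icosahedral split: if_splits)
  then show ?thesis by blast
qed

lemma tetrahedral_in_shephard_todd_group:
  assumes "n \<in> {4..22}"
  shows "projectively_contains (shephard_todd_group n) quat_h"
    "projectively_contains (shephard_todd_group n) quat_h'"
proof -
  have "projectively_contains (shephard_todd_group n) quat_h \<and>
    projectively_contains (shephard_todd_group n) quat_h'"
    using assms unfolding shephard_todd_numbers insert_iff empty_iff simp_thms shephard_todd_group_def
    by (elim disjE; hypsubst)
       (rule conjI; (rule projectively_contains_R1 projectively_contains_R2 tetrahedral_in_R1_R3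
          tetrahedral_in_A1_R1 tetrahedral_in_P1_P2 tetrahedral_in_F1_P1 tetrahedral_in_R1_P1
          tetrahedral_in_F1_R2_P1 tetrahedral_in_F1_F2_F3 tetrahedral_in_F1_F2_A1
          tetrahedral_in_F1_R1 tetrahedral_in_Q1_Q2 tetrahedral_in_A2_Q2 tetrahedral_in_R1_Q1
          tetrahedral_in_R1_R4 tetrahedral_in_B_R1 tetrahedral_in_A1_A2_A3;
          simp add: shephard_todd_generators_def; fail))+
  then show "projectively_contains (shephard_todd_group n) quat_h"
    "projectively_contains (shephard_todd_group n) quat_h'"
    by auto
qed

lemma shephard_todd_group_primitive:
  assumes "n \<in> {4..22}"
  shows "primitive_complex_reflection_group (shephard_todd_group n)"
proof -
  obtain \<Gamma> where \<Gamma>: "\<Gamma> = binary_octahedral \<or> \<Gamma> = binary_icosahedral"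
    and gens: "\<And>g. g \<in> shephard_todd_generators n \<Longrightarrow> reflection_over \<Gamma> g"
    using shephard_todd_generators_over[OF assms] by blast
  show ?thesis
    unfolding shephard_todd_group_def
    by (rule primitive_complex_reflection_group_generate[OF gens \<Gamma>])
       (use tetrahedral_in_shephard_todd_group[OF assms] in \<open>simp_all add: shephard_todd_group_def\<close>)
qed

lemma no_quaternionic_system_of_higher_order:
  assumes G: "primitive_complex_reflection_group G" and g: "refl_of_order m q \<in> G"
    and m: "m \<in> {3, 4, 5}" and q: "qnorm2 q = 1" "qre q = cos (pi / real m)"
  shows "\<not> quaternionic_system G S"
proof (rule no_quaternionic_system)
  show "\<nexists>S. system_of_imprimitivity G S"
    using G by (simp add: primitive_complex_reflection_group_def)
  show "scaled_su2 (cis (pi / real m)) q \<in> G"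
    using g by (simp add: refl_of_order_def)
qed (use reflection_data_cis[OF m q] in \<open>simp_all add: reflection_data_def\<close>)

text \<open>Each of these sixteen groups has, among its generators, a reflection of order three,
  four or five.\<close>

lemma shephard_todd_group_no_quaternionic_system:
  assumes n: "n \<in> {4, 5, 6, 7, 8, 9, 10, 11, 14, 15, 16, 17, 18, 19, 20, 21}"
  shows "\<not> quaternionic_system (shephard_todd_group n) S"
proof -
  have "refl_R1 \<in> shephard_todd_generators n \<or> refl_P1 \<in> shephard_todd_generators n \<or>
      refl_Q2 \<in> shephard_todd_generators n"
    using n by (auto simp: shephard_todd_generators_def)
  then have "refl_R1 \<in> shephard_todd_group n \<or> refl_P1 \<in> shephard_todd_group n \<or>
      refl_Q2 \<in> shephard_todd_group n"
    unfolding shephard_todd_group_def using generate.incl by fast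
  then obtain m q where "refl_of_order m q \<in> shephard_todd_group n" "m \<in> {3, 4, 5}" "qnorm2 q = 1"
    "qre q = cos (pi / real m)"
  proof (elim disjE)
    note eval = qnorm2_def power_divide cos_60 cos_45 cos_pi_5 real_div_sqrt
    assume "refl_R1 \<in> shephard_todd_group n"
    then show thesis
      by (intro that[of 3 quat_h]) (simp_all add: eval refl_R1_def)
  next
    assume "refl_P1 \<in> shephard_todd_group n"
    then show thesis
      by (intro that[of 4 "Quat (1 / sqrt 2) (1 / sqrt 2) 0 0"])
         (simp_all add: refl_P1_def qnorm2_def power_divide cos_45 real_div_sqrt field_simps)
  next
    assume "refl_Q2 \<in> shephard_todd_group n"
    then show thesis
      by (intro that[of 5 "Quat (gold_tau / 2) 0 (1/2) (- gold_sigma / 2)"])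
         (simp_all add: refl_Q2_def qnorm2_def power2_eq_square cos_pi_5 gold_sigma_def gold_sq field_simps)
  qed
  moreover have "primitive_complex_reflection_group (shephard_todd_group n)"
    using n by (intro shephard_todd_group_primitive) auto
  ultimately show ?thesis
    by (blast dest: no_quaternionic_system_of_higher_order)
qed

lemma quaternionic_system_has_shephard_todd_number:
  assumes "has_shephard_todd_number G n"
  shows "(\<exists>S. quaternionic_system G S) \<longleftrightarrow> (\<exists>S. quaternionic_system (shephard_todd_group n) S)"
proof -
  obtain P where "invertible P" "G = conj_by P (shephard_todd_group n)"
    using assms by (auto simp: has_shephard_todd_number_def)
  then show ?thesis
    unfolding quaternionic_system_def
    by (simp add: quat_mat_conj_by system_of_imprimitivity_conj_by_iff quat_mat_inverse(1))
qed

lemma order_two_generators_quartic_unimodular: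
  "refl_F1 \<in> quartic_unimodular" "refl_F2 \<in> quartic_unimodular" "refl_F3 \<in> quartic_unimodular"
  "refl_A1 \<in> quartic_unimodular" "refl_A2 \<in> quartic_unimodular" "refl_A3 \<in> quartic_unimodular"
proof -
  have i: "\<i> ^ 4 = 1"
    by (simp add: eval_nat_numeral)
  note eval = qnorm2_def power2_eq_square gold_sigma_def gold_sq field_simps
  show "refl_F1 \<in> quartic_unimodular" "refl_F2 \<in> quartic_unimodular" "refl_F3 \<in> quartic_unimodular"
  "refl_A1 \<in> quartic_unimodular" "refl_A2 \<in> quartic_unimodular" "refl_A3 \<in> quartic_unimodular"
    unfolding quartic_unimodular_def order_two_generators_eq_scaled_su2
    by (intro CollectI exI conjI, rule refl, rule i, simp add: eval)+
qed

text \<open>The generator with scalar part \<open>\<i>\<close> interchanges the two lines; it is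
  what pairs the line of \<open>z\<close> with that of \<open>- z\<close> and no other.\<close>

lemma quaternionic_systems_eq:
  assumes X: "X \<subseteq> quartic_unimodular"
    and h: "projectively_contains (generate GL X) quat_h" "projectively_contains (generate GL X) quat_h'"
    and s: "scaled_su2 \<i> s \<in> X" "qnorm2 s = 1"
  shows "{S. quaternionic_system (generate GL X) S} =
    {system_given_by (quat_of_complex z * quat_j) |z. cmod z = 1}"
proof (intro equalityI subsetI)
  note G = generate_subset_quartic_unimodular[OF X]
  fix S assume "S \<in> {S. quaternionic_system (generate GL X) S}"
  then have "\<exists>z. cmod z = 1 \<and> S = {graph_line z, graph_line (- z)}"
    using quaternionic_system_imp_graph_lines[OF G h generate.incl[OF s(1)] _ s(2)] by simp
  then show "S \<in> {system_given_by (quat_of_complex z * quat_j) |z. cmod z = 1}"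
    using system_given_by_zj by fastforce
next
  note G = generate_subset_quartic_unimodular[OF X]
  fix S assume "S \<in> {system_given_by (quat_of_complex z * quat_j) |z. cmod z = 1}"
  then show "S \<in> {S. quaternionic_system (generate GL X) S}"
    using graph_lines_quaternionic_system[OF G] by (auto simp: system_given_by_zj)
qed

text \<open>The scalings of the frame in this and the next two lemmas are chosen so that the
  reflections become special reflections \<open>\<beta>\<close> in the target group. Here
  \<open>F\<^sub>1\<close> becomes the reflection of \<open>h\<^sup>2\<close> with \<open>h = (1
  + i + j + k) / 2\<close>. Conjugation by the reflection of \<open>h\<close> interchanges it
  with the reflection of \<open>1\<close>.\<close>

lemma G12_change_of_basis:
  assumes "cmod z = 1"
  shows "\<exists>U. change_of_basis U (system_given_by (quat_of_complex z * quat_j)) \<and> quat_unitary U \<and>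
    conj_by U (quat_mat ` generate GL {refl_F1, refl_F2, refl_F3}) = G_T_L12"
proof -
  let ?L = "{1, Quat 0 1 0 0, quat_h}"
  let ?B = "{Quat (- 1 / 2) (1/2) (1/2) (1/2), Quat 0 1 0 0, quat_h}"
  let ?\<alpha> = "Quat (- 1 / 2) 0 (1 / 2) 0"
  let ?\<delta> = "Quat (1 / (2 * sqrt 2)) (- 1 / (2 * sqrt 2)) (- 1 / (2 * sqrt 2)) (- 1 / (2 * sqrt 2))"
  note eval = quat_eq_iff real_div_sqrt field_simps
  have R: "quat_mat refl_F1 ** zj_frame ?\<alpha> ?\<delta> = zj_frame ?\<alpha> ?\<delta> ** special_reflection (Quat (- 1 / 2) (1/2) (1/2) (1/2))"
    "quat_mat refl_F2 ** zj_frame ?\<alpha> ?\<delta> = zj_frame ?\<alpha> ?\<delta> ** special_reflection (Quat 0 1 0 0)"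
    "quat_mat refl_F3 ** zj_frame ?\<alpha> ?\<delta> = zj_frame ?\<alpha> ?\<delta> ** special_reflection quat_h"
    unfolding order_two_generators_eq_scaled_su2 by (rule reflection_zj_frame; simp add: eval)+
  have "quat_refl_group ?B = quat_refl_group ?L"
  proof
    have "special_reflection (Quat (- 1 / 2) (1/2) (1/2) (1/2)) \<in> quat_refl_group ?L"
      by (rule special_reflection_conjugate[of quat_h _ 1])
         (auto intro: special_reflection_generator simp: eval)
    then show "quat_refl_group ?B \<subseteq> quat_refl_group ?L"
      by (intro quat_refl_group_subset) (auto intro: special_reflection_generator simp: qnorm2_def power_divide)
    have "special_reflection 1 \<in> quat_refl_group ?B"
      by (rule special_reflection_conjugate[of quat_h _ "Quat (- 1 / 2) (1/2) (1/2) (1/2)"])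
         (auto intro: special_reflection_generator simp: eval)
    then show "quat_refl_group ?L \<subseteq> quat_refl_group ?B"
      by (intro quat_refl_group_subset) (auto intro: special_reflection_generator simp: qnorm2_def power_divide)
  qed
  moreover have "\<exists>U. change_of_basis U (system_given_by (quat_of_complex z * quat_j)) \<and> quat_unitary U \<and>
    conj_by U (quat_mat ` generate GL {refl_F1, refl_F2, refl_F3}) = quat_refl_group ?B"
    by (rule change_of_basis_to_special_reflections[OF _ _ _ _ _ assms, of _ ?\<alpha> ?\<delta>])
       (use R reflection_over_imp(1) reflection_over_binary_octahedral in
        \<open>auto simp: qnorm2_def power_divide power_mult_distrib\<close>)
  ultimately show ?thesis
    by (simp add: G_T_L12_def)
qed

text \<open>For this scaling the three generators are carried to the three defining reflections
  of the target group.\<close>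

lemma G13_change_of_basis:
  assumes "cmod z = 1"
  shows "\<exists>U. change_of_basis U (system_given_by (quat_of_complex z * quat_j)) \<and> quat_unitary U \<and>
    conj_by U (quat_mat ` generate GL {refl_F1, refl_F2, refl_A1}) = G_O_L18"
proof -
  let ?\<alpha> = "Quat 0 (1 / 2) (1 / 2) 0"
  let ?\<delta> = "Quat (- 1 / (2 * sqrt 2)) (1 / (2 * sqrt 2)) (1 / (2 * sqrt 2)) (- 1 / (2 * sqrt 2))"
  note eval = quat_eq_iff real_div_sqrt field_simps
  have R: "quat_mat refl_F1 ** zj_frame ?\<alpha> ?\<delta> = zj_frame ?\<alpha> ?\<delta> ** special_reflection 1"
    "quat_mat refl_F2 ** zj_frame ?\<alpha> ?\<delta> = zj_frame ?\<alpha> ?\<delta> ** special_reflection quat_h"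
    "quat_mat refl_A1 ** zj_frame ?\<alpha> ?\<delta> = zj_frame ?\<alpha> ?\<delta> ** special_reflection (Quat (1 / sqrt 2) (1 / sqrt 2) 0 0)"
    unfolding order_two_generators_eq_scaled_su2 by (rule reflection_zj_frame; simp add: eval)+
  show ?thesis
    unfolding G_O_L18_def
    by (rule change_of_basis_to_special_reflections[OF _ _ _ _ _ assms, of _ ?\<alpha> ?\<delta>])
       (use R reflection_over_imp(1) reflection_over_binary_octahedral in
        \<open>auto simp: qnorm2_def power_divide power_mult_distrib\<close>)
qed

text \<open>The generators are carried to the reflections of \<open>b\<^sub>1\<close>,
  \<open>b\<^sub>2\<close> and \<open>1\<close>, which generate the same group as those of
  \<open>1\<close>, \<open>h\<close> and \<open>c\<close>: each of them is an iterated conjugate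
  of the others.\<close>

lemma G22_change_of_basis:
  assumes "cmod z = 1"
  shows "\<exists>U. change_of_basis U (system_given_by (quat_of_complex z * quat_j)) \<and> quat_unitary U \<and>
    conj_by U (quat_mat ` generate GL {refl_A1, refl_A2, refl_A3}) = G_I_L30"
proof -
  let ?c = "Quat (gold_tau / 2) (gold_sigma / 2) (- 1 / 2) 0"
  let ?L = "{1, quat_h, ?c}"
  let ?b1 = "Quat (gold_tau / 2) 0 (gold_sigma / 2) (1 / 2)"
  let ?b2 = "Quat (- gold_sigma / 2) (1 / 2) (gold_tau / 2) 0"
  let ?B = "{?b1, ?b2, 1}"
  let ?\<alpha> = "Quat 0 0 (1 / 2) (- 1 / 2)"
  let ?\<delta> = "Quat (gold_tau / 4) (gold_sigma\<^sup>2 / 4) (gold_tau / 4) (- gold_tau / 4)"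
  have gold_sq_left: "gold_tau * (gold_tau * x) = (gold_tau + 1) * x" for x
    by (simp add: gold_sq flip: mult.assoc)
  note eval = quat_eq_iff gold_sigma_def gold_sq gold_sq_left power2_eq_square field_simps
  note norm = qnorm2_def gold_sigma_def gold_sq gold_sq_left power2_eq_square field_simps
  have R: "quat_mat refl_A1 ** zj_frame ?\<alpha> ?\<delta> = zj_frame ?\<alpha> ?\<delta> ** special_reflection ?b1"
    "quat_mat refl_A2 ** zj_frame ?\<alpha> ?\<delta> = zj_frame ?\<alpha> ?\<delta> ** special_reflection ?b2"
    "quat_mat refl_A3 ** zj_frame ?\<alpha> ?\<delta> = zj_frame ?\<alpha> ?\<delta> ** special_reflection 1"
    unfolding order_two_generators_eq_scaled_su2 by (rule reflection_zj_frame; simp add: eval)+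
  have "quat_refl_group ?B = quat_refl_group ?L"
  proof
    note conj = special_reflection_conjugate[where L = ?L]
    have gen: "special_reflection 1 \<in> quat_refl_group ?L" "special_reflection quat_h \<in> quat_refl_group ?L"
      "special_reflection ?c \<in> quat_refl_group ?L"
      by (simp_all add: special_reflection_generator)
    have "special_reflection (Quat (1/2) (-1/2) (-1/2) (-1/2)) \<in> quat_refl_group ?L"
      by (rule conj[OF gen(1,2)]) (simp add: eval)
    then have "special_reflection ?b1 \<in> quat_refl_group ?L"
      by (rule conj[OF gen(3)]) (simp add: eval)
    moreover have "special_reflection (?c * ?c) \<in> quat_refl_group ?L"
      by (rule conj[OF gen(3,1)]) (simp add: eval)
    then have "special_reflection ?b2 \<in> quat_refl_group ?L"
      by (rule conj[OF gen(1)]) (simp add: eval)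
    ultimately show "quat_refl_group ?B \<subseteq> quat_refl_group ?L"
      using gen(1) by (intro quat_refl_group_subset) (auto simp: norm)
  next
    note conj = special_reflection_conjugate[where L = ?B]
    have gen: "special_reflection ?b1 \<in> quat_refl_group ?B" "special_reflection ?b2 \<in> quat_refl_group ?B"
      "special_reflection 1 \<in> quat_refl_group ?B"
      by (simp_all add: special_reflection_generator)
    have cb: "special_reflection (qcnj ?b2) \<in> quat_refl_group ?B"
      by (rule conj[OF gen(3,2)]) (simp add: eval)
    then have h: "special_reflection quat_h \<in> quat_refl_group ?B"
      by (rule conj[OF gen(1)]) (simp add: eval)
    have "special_reflection (?b1 * (qcnj ?b2 * ?b1)) \<in> quat_refl_group ?B"
      by (rule conj[OF gen(1,2)]) simp
    then have "special_reflection ?c \<in> quat_refl_group ?B"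
      by (rule conj[OF cb]) (simp add: eval)
    then show "quat_refl_group ?L \<subseteq> quat_refl_group ?B"
      using gen(3) h by (intro quat_refl_group_subset) (auto simp: norm)
  qed
  moreover have "\<exists>U. change_of_basis U (system_given_by (quat_of_complex z * quat_j)) \<and> quat_unitary U \<and>
    conj_by U (quat_mat ` generate GL {refl_A1, refl_A2, refl_A3}) = quat_refl_group ?B"
    by (rule change_of_basis_to_special_reflections[OF _ _ _ _ _ assms, of _ ?\<alpha> ?\<delta>])
       (use R reflection_over_imp(1) reflection_over_binary_icosahedral in \<open>auto simp: norm\<close>)
  ultimately show ?thesis
    by (simp add: G_I_L30_def)
qed

theorem theorem4p2:
  shows "(\<forall>n\<in>{4..22}. primitive_complex_reflection_group (shephard_todd_group n))
    \<and> (\<forall>n\<in>{4..22}. \<forall>G. has_shephard_todd_number G n \<longrightarrow>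
         ((\<exists>S. quaternionic_system G S) \<longleftrightarrow> n \<in> {12, 13, 22}))
    \<and> (\<forall>(G, H)\<in>{(generate GL {refl_F1, refl_F2, refl_F3}, G_T_L12),
                (generate GL {refl_F1, refl_F2, refl_A1}, G_O_L18),
                (generate GL {refl_A1, refl_A2, refl_A3}, G_I_L30)}.
         {S. quaternionic_system G S} =
           {system_given_by (quat_of_complex z * quat_j) |z. cmod z = 1}
         \<and> (\<forall>z. cmod z = 1 \<longrightarrow>
              (\<exists>U. change_of_basis U (system_given_by (quat_of_complex z * quat_j))
                 \<and> quat_unitary U \<and> conj_by U (quat_mat ` G) = H)))
    \<and> (\<forall>n\<in>{4, 5, 6, 7, 8, 9, 10, 11, 14, 15, 16, 17, 18, 19, 20, 21}.
         \<forall>G. has_shephard_todd_number G n \<longrightarrow> (\<nexists>S. quaternionic_system G S))"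
proof -
  note quartic = order_two_generators_quartic_unimodular
  have F1: "scaled_su2 \<i> (Quat 0 (- 1 / sqrt 2) 0 (- 1 / sqrt 2)) = refl_F1"
    "qnorm2 (Quat 0 (- 1 / sqrt 2) 0 (- 1 / sqrt 2)) = 1"
    and A1: "scaled_su2 \<i> (Quat 0 (- 1) 0 0) = refl_A1" "qnorm2 (Quat 0 (- 1) 0 0) = 1"
    by (simp_all only: order_two_generators_eq_scaled_su2) (simp_all add: qnorm2_def power_divide)
  let ?systems = "{system_given_by (quat_of_complex z * quat_j) |z. cmod z = 1}"
  have systems_12: "{S. quaternionic_system (generate GL {refl_F1, refl_F2, refl_F3}) S} = ?systems"
    by (rule quaternionic_systems_eq[OF _ tetrahedral_in_F1_F2_F3 _ F1(2)], unfold F1(1))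
       (simp_all add: quartic)
  have systems_13: "{S. quaternionic_system (generate GL {refl_F1, refl_F2, refl_A1}) S} = ?systems"
    by (rule quaternionic_systems_eq[OF _ tetrahedral_in_F1_F2_A1 _ F1(2)], unfold F1(1))
       (simp_all add: quartic)
  have systems_22: "{S. quaternionic_system (generate GL {refl_A1, refl_A2, refl_A3}) S} = ?systems"
    by (rule quaternionic_systems_eq[OF _ tetrahedral_in_A1_A2_A3 _ A1(2)], unfold A1(1))
       (simp_all add: quartic)
  note systems = systems_12 systems_13 systems_22
  have groups: "shephard_todd_group 12 = generate GL {refl_F1, refl_F2, refl_F3}"
    "shephard_todd_group 13 = generate GL {refl_F1, refl_F2, refl_A1}"
    "shephard_todd_group 22 = generate GL {refl_A1, refl_A2, refl_A3}"
    by (simp_all add: shephard_todd_group_def shephard_todd_generators_def)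
  have ex: "\<exists>S. quaternionic_system (shephard_todd_group n) S" if "n \<in> {12, 13, 22}" for n
  proof -
    have "{S. quaternionic_system (shephard_todd_group n) S} =
        {system_given_by (quat_of_complex z * quat_j) |z. cmod z = 1}"
      using that unfolding insert_iff empty_iff simp_thms
      by (elim disjE) (simp_all only: groups systems)
    moreover have "system_given_by (quat_of_complex 1 * quat_j) \<in>
        {system_given_by (quat_of_complex z * quat_j) |z. cmod z = 1}"
      by (intro CollectI exI[of _ 1]) simp
    ultimately show ?thesis by blast
  qed
  have none: "\<nexists>S. quaternionic_system G S"
    if "has_shephard_todd_number G n" "n \<in> {4, 5, 6, 7, 8, 9, 10, 11, 14, 15, 16, 17, 18, 19, 20, 21}" for G n
    using quaternionic_system_has_shephard_todd_number[OF that(1)]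
      shephard_todd_group_no_quaternionic_system[OF that(2)] by blast
  have "(\<exists>S. quaternionic_system G S) \<longleftrightarrow> n \<in> {12, 13, 22}"
    if "n \<in> {4..22}" "has_shephard_todd_number G n" for G n
  proof (cases "n \<in> {12, 13, 22}")
    case True
    then show ?thesis
      using ex quaternionic_system_has_shephard_todd_number[OF that(2)] by blast
  next
    case False
    then have "n \<in> {4, 5, 6, 7, 8, 9, 10, 11, 14, 15, 16, 17, 18, 19, 20, 21}"
      using that(1) unfolding shephard_todd_numbers by simp
    then show ?thesis
      using False none[OF that(2)] by blast
  qed
  then show ?thesis
    using shephard_todd_group_primitive none systems
      G12_change_of_basis G13_change_of_basis G22_change_of_basis
    by (intro conjI) simp_all
qed

end
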